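(* Let $G$ be a non-complete chordal graph of order $n$ with vertex connectivity $\kappa$, clique number $d$ and $b$--vector $(b_1,\ldots,b_d)$. Then $$b_i=\sum_{Y\subseteq V(G),\ |Y|=i-1}\bigl(W(G-Y)-1\bigr)+1=\beta_{n-i}(R/I_{\Delta(G)})+1$$ for every $i=1,\ldots,\kappa+1$. In addition, $$b_i<\sum_{Y\subseteq V(G),\ |Y|=i-1}\bigl(W(G-Y)-1\bigr)+1=\beta_{n-i}(R/I_{\Delta(G)})+1$$ for every $i=\kappa+2,\ldots,d$.
   Context: Graphs are finite and simple; chordal means every cycle of length at least $4$ has a chord. $c_i$ is the number of cliques with $i$ vertices, $d$ is the clique number, and the $b$--vector is defined by $\sum_{i=1}^d b_i(x+1)^{i-1}=\sum_{i=1}^d c_ix^{i-1}$. The vertex connectivity $\kappa$ is the minimum size of a vertex set whose removal disconnects $G$. $W(G-Y)$ is the number of connected components of $G-Y$. Identify $V(G)$ with $[n]$; $\Delta(G)$ is the clique complex of $G$, $K$ a field, $R=K[x_1,\ldots,x_n]$, $I_{\Delta(G)}$ the Stanley–Reisner ideal of $\Delta(G)$ (generated by squarefree monomials $\prod_{k\in\sigma}x_k$ with $\sigma$ not a clique), and $\beta_j(R/I_{\Delta(G)})$ the $j$-th total Betti number (rank of the $j$-th free module in a minimal free resolution over $R$). *)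

theory Defs
  imports
    "HOL-Library.Poly_Mapping"
    "HOL-Computational_Algebra.Polynomial"
    "Jordan_Normal_Form.Matrix_Kernel"
begin

section \<open>Graphs\<close>

text \<open>A finite simple graph is given by its adjacency relation on a finite type; the vertex set
  is the whole type.\<close>

definition simple_graph :: "'v rel \<Rightarrow> bool" where
  "simple_graph G \<longleftrightarrow> sym G \<and> irrefl G"

definition clique :: "'v rel \<Rightarrow> 'v set \<Rightarrow> bool" where
  "clique G S \<longleftrightarrow> (\<forall>u\<in>S. \<forall>v\<in>S. u \<noteq> v \<longrightarrow> (u, v) \<in> G)"

definition complete_graph :: "'v rel \<Rightarrow> bool" where
  "complete_graph G \<longleftrightarrow> clique G UNIV"

definition clique_count :: "'v::finite rel \<Rightarrow> nat \<Rightarrow> nat" where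
  "clique_count G i = card {S. clique G S \<and> card S = i}"

definition clique_number :: "'v::finite rel \<Rightarrow> nat" where
  "clique_number G = Max {card S | S. clique G S}"

definition cycle :: "'v rel \<Rightarrow> 'v list \<Rightarrow> bool" where
  "cycle G vs \<longleftrightarrow> 3 \<le> length vs \<and> distinct vs \<and>
     (\<forall>i < length vs. (vs ! i, vs ! (Suc i mod length vs)) \<in> G)"

definition has_chord :: "'v rel \<Rightarrow> 'v list \<Rightarrow> bool" where
  "has_chord G vs \<longleftrightarrow> (\<exists>i < length vs. \<exists>j < length vs. i \<noteq> j \<and>
     j \<noteq> Suc i mod length vs \<and> i \<noteq> Suc j mod length vs \<and> (vs ! i, vs ! j) \<in> G)"

definition chordal :: "'v rel \<Rightarrow> bool" where
  "chordal G \<longleftrightarrow> (\<forall>vs. cycle G vs \<and> 4 \<le> length vs \<longrightarrow> has_chord G vs)"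

text \<open>The vertex sets of the connected components of \<open>G - Y\<close>, as the classes of reachability
  within the complement of \<open>Y\<close>.\<close>

definition components_minus :: "'v rel \<Rightarrow> 'v set \<Rightarrow> 'v set set" where
  "components_minus G Y = (- Y) // ((G \<inter> (- Y) \<times> (- Y))\<^sup>*)"

definition num_components_minus :: "'v rel \<Rightarrow> 'v set \<Rightarrow> nat" where
  "num_components_minus G Y = card (components_minus G Y)"

text \<open>No removal of vertices disconnects a complete graph, so the value below is meaningful for
  non-complete graphs only.\<close>

definition vertex_connectivity :: "'v::finite rel \<Rightarrow> nat" where
  "vertex_connectivity G = Min {card Y | Y. 2 \<le> num_components_minus G Y}"

text \<open>Only the values of \<open>b\<close> on \<open>{1..d}\<close>, with \<open>d\<close> the clique number, are constrained.\<close>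

definition is_b_vector :: "'v::finite rel \<Rightarrow> (nat \<Rightarrow> int) \<Rightarrow> bool" where
  "is_b_vector G b \<longleftrightarrow>
     (\<Sum>i = 1..clique_number G. Polynomial.smult (b i) ([:1, 1:] ^ (i - 1))) =
     (\<Sum>i = 1..clique_number G. Polynomial.smult (int (clique_count G i)) ([:0, 1:] ^ (i - 1)))"


section \<open>The polynomial ring and the Stanley--Reisner ideal\<close>

text \<open>One variable per element of the finite type \<open>'v\<close>; the exponent vectors are the elements of
  \<open>'v \<Rightarrow>\<^sub>0 nat\<close>.\<close>

type_synonym ('v, 'k) mpoly = "('v \<Rightarrow>\<^sub>0 nat) \<Rightarrow>\<^sub>0 'k"

definition Var :: "'v \<Rightarrow> ('v, 'k::field) mpoly" where
  "Var v = Poly_Mapping.single (Poly_Mapping.single v 1) 1"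

abbreviation ideal_gen :: "'a::comm_ring_1 set \<Rightarrow> 'a set" where
  "ideal_gen \<equiv> Modules.module.span (*)"

definition sr_ideal :: "'v::finite rel \<Rightarrow> ('v, 'k::field) mpoly set" where
  "sr_ideal G = ideal_gen {\<Prod>k\<in>\<sigma>. Var k | \<sigma>. \<not> clique G \<sigma>}"

definition max_ideal :: "('v, 'k::field) mpoly set" where
  "max_ideal = ideal_gen (range Var)"

definition homogeneous_of_deg :: "int \<Rightarrow> ('v::finite, 'k::field) mpoly \<Rightarrow> bool" where
  "homogeneous_of_deg t f \<longleftrightarrow>
     (\<forall>m\<in>Poly_Mapping.keys f. int (\<Sum>v\<in>UNIV. Poly_Mapping.lookup m v) = t)"


section \<open>Minimal free resolutions\<close>

text \<open>
  A minimal graded free resolution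
  \<open>\<dots> \<rightarrow> F\<^sub>2 \<rightarrow> F\<^sub>1 \<rightarrow> F\<^sub>0 \<rightarrow> R/I \<rightarrow> 0\<close>, where \<open>F\<^sub>j\<close> is free with \<open>rk j\<close> basis elements, the
  \<open>p\<close>-th of which has degree \<open>sh j p\<close>.  The matrix \<open>\<phi> j\<close> represents the map from \<open>F\<^bsub>j+1\<^esub>\<close> to \<open>F\<^sub>j\<close>.
  The augmentation from \<open>F\<^sub>0\<close> to \<open>R/I\<close> sends \<open>v\<close> to the class of \<open>e \<bullet> v\<close> modulo \<open>I\<close>; every linear
  map to \<open>R/I\<close> is of this form.  Minimality says that the image of \<open>\<phi> j\<close> lies in
  \<open>max_ideal\<close> times \<open>F\<^sub>j\<close>, i.e.\ that all entries of \<open>\<phi> j\<close> lie in \<open>max_ideal\<close>.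
\<close>

definition mat_image :: "'a::comm_ring_1 mat \<Rightarrow> 'a vec set" where
  "mat_image A = (\<lambda>v. A *\<^sub>v v) ` carrier_vec (dim_col A)"

definition minimal_free_resolution ::
  "('v::finite, 'k::field) mpoly set \<Rightarrow> (nat \<Rightarrow> nat) \<Rightarrow> (nat \<Rightarrow> nat \<Rightarrow> int) \<Rightarrow>
   ('v, 'k) mpoly vec \<Rightarrow> (nat \<Rightarrow> ('v, 'k) mpoly mat) \<Rightarrow> bool" where
  "minimal_free_resolution I rk sh e \<phi> \<longleftrightarrow>
     e \<in> carrier_vec (rk 0) \<and>
     (\<forall>j. \<phi> j \<in> carrier_mat (rk j) (rk (Suc j))) \<and>
     (\<forall>p < rk 0. homogeneous_of_deg (sh 0 p) (e $ p)) \<and>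
     (\<forall>j. \<forall>p < rk j. \<forall>q < rk (Suc j).
        homogeneous_of_deg (sh (Suc j) q - sh j p) (\<phi> j $$ (p, q))) \<and>
     (\<forall>f. \<exists>v \<in> carrier_vec (rk 0). f - e \<bullet> v \<in> I) \<and>
     {v \<in> carrier_vec (rk 0). e \<bullet> v \<in> I} = mat_image (\<phi> 0) \<and>
     (\<forall>j. mat_kernel (\<phi> j) = mat_image (\<phi> (Suc j))) \<and>
     (\<forall>j. \<forall>p < rk j. \<forall>q < rk (Suc j). \<phi> j $$ (p, q) \<in> max_ideal)"

text \<open>The total Betti number \<open>\<beta>\<^sub>j(R/I)\<close>.\<close>

definition betti :: "('v::finite, 'k::field) mpoly set \<Rightarrow> nat \<Rightarrow> nat" where
  "betti I j = (THE r. \<exists>rk sh e \<phi>. minimal_free_resolution I rk sh e \<phi> \<and> rk j = r)"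

end

theory Submission
  imports Defs "HOL-Library.Multiset"
begin

text \<open>
  A chordal graph is rebuilt by adding simplicial vertices one at a time.  When the new vertex \<open>v\<close>
  has \<open>k\<close> earlier neighbours, it contributes \<open>(x + 1) ^ k\<close> to \<open>\<Sum>i. c\<^sub>i x ^ (i - 1)\<close>, so \<open>b\<^sub>i\<close>
  counts the vertices with \<open>i - 1\<close> earlier neighbours.  The numbers of components of the induced
  subgraphs obey a similar recursion, which yields
  \<open>\<Sum>Y. (W(G - Y) - 1) = b\<^sub>i - 1 + \<Sum>l<i. (b\<^sub>l - 1) * (n - l choose i - l)\<close>.
  Sets of fewer than \<open>\<kappa>\<close> vertices do not separate, so \<open>b\<^sub>l = 1\<close> for \<open>l \<le> \<kappa>\<close>, while
  \<open>b\<^bsub>\<kappa>+1\<^esub> > 1\<close>; hence equality up to \<open>\<kappa> + 1\<close> and strict inequality afterwards.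

  On the algebraic side, adding \<open>v\<close> replaces the ideal \<open>I\<close> by \<open>I + v P\<close>, where \<open>P \<supseteq> I\<close> is
  generated by the non-neighbours of \<open>v\<close>.  Since \<open>I \<inter> v P = v I\<close>, the mapping cone of the linear
  resolutions of \<open>I\<close> and \<open>P\<close> is a linear, hence minimal, resolution of \<open>I + v P\<close>, and its ranks
  satisfy the same recursion as the numbers of components.
\<close>

section \<open>Simplicial vertices of chordal graphs\<close>

text \<open>The vertex set is a whole type, so vertices cannot be deleted from a graph. Everything
  is relativized to a subset \<open>S\<close> of one fixed \<open>G\<close>, and the ideal belonging
  to \<open>S\<close> lives in the full ring, with the variables outside \<open>S\<close> free. This
  is why x_v is a nonzerodivisor modulo the old ideal when \<open>v\<close> lies outside
  \<open>S\<close>. Graph and algebra meet in one polynomial c, \<open>component_poly\<close>, which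
  collects W(G[U]) - 1 by the size of U and satisfies c' = (1 + X) c + X (1 + X)^m, with m the
  number of non-neighbours of the new vertex. On the graph side 1 + X is the choice whether v
  belongs to U. On the algebraic side the three contributions are I, a shifted copy of I, and P,
  whose m variables give the Koszul ranks. Betti numbers are defined by a definite description, so
  uniqueness of the ranks has to be shown besides existence. A mapping cone of minimal resolutions
  need not be minimal in general; keeping all lifts homogeneous of degree 1 secures it, because
  entries of positive degree lie in \<open>max_ideal\<close>.\<close>

lemma relpow_shortcut:
  assumes f: "f 0 = x" "f n = y" "\<forall>i<n. (f i, f (Suc i)) \<in> R"
    and least: "\<And>m. (x, y) \<in> R ^^ m \<Longrightarrow> n \<le> m"
  shows "inj_on f {..n}"
    and "\<And>i j. \<lbrakk>i < j; j \<le> n; (f i, f j) \<in> R\<rbrakk> \<Longrightarrow> j = Suc i"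
proof -
  have seg: "(f i, f j) \<in> R ^^ (j - i)" if "i \<le> j" "j \<le> n" for i j
    unfolding relpow_fun_conv
    using f(3) that by (intro exI[of _ "\<lambda>k. f (i + k)"]) auto
  \<comment> \<open>Replacing the stretch from \<open>f i\<close> to \<open>f j\<close> by
    \<open>m\<close> steps gives a walk of length i + m + (n - j), which cannot beat the minimum.
    With m = 0 this yields injectivity, with m = 1 the absence of chords.\<close>
  have cut: "n \<le> i + m + (n - j)" if "i \<le> n" "j \<le> n" "(f i, f j) \<in> R ^^ m" for i j m
  proof (rule least)
    have "(x, f j) \<in> R ^^ (i + m)"
      using seg[of 0 i] that f(1) by (auto simp: relpow_add)
    then show "(x, y) \<in> R ^^ (i + m + (n - j))"
      using seg[of j n] that f(2) by (subst relpow_add) auto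
  qed
  show "inj_on f {..n}"
  proof (rule linorder_inj_onI')
    fix i j assume "i \<in> {..n}" "j \<in> {..n}" "i < j"
    then show "f i \<noteq> f j"
      using cut[of i j 0] by auto
  qed
  show "j = Suc i" if "i < j" "j \<le> n" "(f i, f j) \<in> R" for i j
    using cut[of i j 1] that by auto
qed

text \<open>If \<open>x\<close> and \<open>y\<close> were not adjacent, a shortest path between them
  with interior in \<open>A\<close> would have length n at least 2. It has no chords, and
  \<open>z\<close> sees only its two ends, so closing it through \<open>z\<close> gives a chordless
  cycle of length n + 2, at least 4.\<close>

lemma chordal_common_neighbors:
  assumes G: "simple_graph G" "chordal G"
    and path: "(x, y) \<in> (G \<inter> insert x (insert y A) \<times> insert x (insert y A))\<^sup>*"
    and z: "(x, z) \<in> G" "(y, z) \<in> G" "\<forall>a\<in>A. (z, a) \<notin> G" "z \<notin> A" and "x \<noteq> y"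
  shows "(x, y) \<in> G"
proof (rule ccontr)
  assume nxy: "(x, y) \<notin> G"
  have sym: "(u, v) \<in> G \<Longrightarrow> (v, u) \<in> G" for u v
    using G(1) by (auto simp: simple_graph_def dest: symD)
  have irr: "(u, u) \<notin> G" for u
    using G(1) by (auto simp: simple_graph_def irrefl_def)
  let ?R = "G \<inter> insert x (insert y A) \<times> insert x (insert y A)"
  define n where "n = (LEAST n. (x, y) \<in> ?R ^^ n)"
  have "(x, y) \<in> ?R ^^ n"
    unfolding n_def using rtrancl_imp_relpow[OF path] by (elim exE) (rule LeastI)
  then obtain f where f: "f 0 = x" "f n = y" "\<forall>i<n. (f i, f (Suc i)) \<in> ?R"
    unfolding relpow_fun_conv by blast
  have least: "n \<le> m" if "(x, y) \<in> ?R ^^ m" for m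
    unfolding n_def using that by (rule Least_le)
  note inj = relpow_shortcut(1)[OF f least] and chordless = relpow_shortcut(2)[OF f least]
  have "n \<noteq> 0"
    using f \<open>x \<noteq> y\<close> by metis
  moreover have "n \<noteq> 1"
    using f nxy by auto
  ultimately have n: "n \<ge> 2" by simp
  have in_A: "f i \<in> insert x (insert y A)" if "i \<le> n" for i
    using f(1) f(3)[rule_format, of "i - 1"] that by (cases i) auto
  have ends: "i = 0 \<or> i = n" if "i \<le> n" "(z, f i) \<in> G \<or> (f i, z) \<in> G \<or> f i = z" for i
  proof -
    have "f i \<notin> A" using that z(3,4) sym by metis
    moreover have "x \<noteq> z" "y \<noteq> z" using z irr by auto
    ultimately have "f i = f 0 \<or> f i = f n" using in_A[OF that(1)] f(1,2) by auto
    then show ?thesis using inj that(1) by (auto dest: inj_onD)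
  qed
  let ?vs = "z # map f [0..<Suc n]"
  have len: "length ?vs = Suc (Suc n)" by simp
  have nth: "?vs ! i = (if i = 0 then z else f (i - 1))" if "i < length ?vs" for i
    using that by (cases i) (auto simp del: upt_Suc)
  have zf: "z \<noteq> f i" if "i \<le> n" for i
    using ends[OF that] f(1,2) z irr by metis
  have "cycle G ?vs"
    unfolding cycle_def
  proof (intro conjI allI impI)
    show "3 \<le> length ?vs" using n by simp
    show "distinct ?vs"
      using inj zf by (auto simp: distinct_map atLeast0LessThan lessThan_Suc_atMost simp del: upt_Suc)
    fix i assume i: "i < length ?vs"
    show "(?vs ! i, ?vs ! (Suc i mod length ?vs)) \<in> G"
    proof (cases "i = Suc n")
      case True
      then show ?thesis using nth[of i] nth[of 0] f(2) z(2) by simp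
    next
      case False
      then have "Suc i mod length ?vs = Suc i" "Suc i < length ?vs" using i by auto
      then show ?thesis
        using nth[OF i] nth[of "Suc i"] f(1,3) z(1) sym i False
        by (cases i) auto
    qed
  qed
  moreover have "4 \<le> length ?vs" using n by simp
  ultimately have "has_chord G ?vs"
    using G(2) by (auto simp: chordal_def)
  then obtain i j where ij: "i < length ?vs" "j < length ?vs" "i \<noteq> j"
      "j \<noteq> Suc i mod length ?vs" "i \<noteq> Suc j mod length ?vs" "(?vs ! i, ?vs ! j) \<in> G"
    unfolding has_chord_def by blast
  \<comment> \<open>A chord at position 0 starts at \<open>z\<close> and can only reach an end of
    the path; any other chord joins two path vertices, which must be consecutive. Both are edges of
    the cycle itself. The order a < b loses nothing, by symmetry.\<close>
  have no: False if a: "a < b" "b < length ?vs" "b \<noteq> Suc a mod length ?vs"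
      "a \<noteq> Suc b mod length ?vs" "(?vs ! a, ?vs ! b) \<in> G" for a b
  proof (cases "a = 0")
    case True
    have "(z, f (b - 1)) \<in> G" using a nth[of 0] nth[of b] True by simp
    then have "b - 1 = 0 \<or> b - 1 = n"
      using a(2) by (intro ends) auto
    then have "b = 1 \<or> b = Suc n" using a(1) by auto
    then show False using a(3,4) True len by (auto simp: n)
  next
    case False
    have bn: "b - 1 \<le> n" using a(2) by simp
    have an: "a - 1 \<le> n" using a(1,2) by simp
    have "?vs ! a = f (a - 1)" "?vs ! b = f (b - 1)"
      using a(1,2) False by (simp_all only: nth) simp_all
    with a(5) have "(f (a - 1), f (b - 1)) \<in> G" by argo
    then have "(f (a - 1), f (b - 1)) \<in> ?R"
      using in_A[OF an] in_A[OF bn] by blast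
    then have "b - 1 = Suc (a - 1)"
      by (intro chordless) (use a(1,2) False in auto)
    then show False using a(1,2,3) False by simp
  qed
  show False
  proof (cases "i < j")
    case True
    then show False using no[of i j] ij by blast
  next
    case False
    then show False using no[of j i] ij sym by (metis nat_neq_iff)
  qed
qed

text \<open>If no set is \<open>good\<close>, every singleton dominates \<open>S\<close>, so
  \<open>S\<close> is a clique. Otherwise take a maximal connected \<open>A\<close> that does not
  dominate \<open>S\<close>, and let \<open>B\<close> be the vertices outside \<open>A\<close> and
  its neighbourhood \<open>nb A\<close>. Then \<open>nb A\<close> is a clique that is completely
  joined to \<open>B\<close>, so a simplicial vertex of the smaller set \<open>B\<close> remains
  simplicial in \<open>S\<close>: its neighbours lie in \<open>B\<close> and
  \<open>nb A\<close>.\<close>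

lemma chordal_simplicial_vertex:
  fixes G :: "'v rel"
  assumes G: "simple_graph G" "chordal G" and "finite S" "S \<noteq> {}"
  shows "\<exists>v\<in>S. clique G {u \<in> S. (v, u) \<in> G}"
  using assms(3,4)
proof (induction "card S" arbitrary: S rule: less_induct)
  case (less S)
  have sym: "(u, v) \<in> G \<Longrightarrow> (v, u) \<in> G" for u v
    using G(1) by (auto simp: simple_graph_def dest: symD)
  have irr: "(u, u) \<notin> G" for u
    using G(1) by (auto simp: simple_graph_def irrefl_def)
  define nb where "nb A = {x \<in> S - A. \<exists>a\<in>A. (a, x) \<in> G}" for A
  define good where "good A \<longleftrightarrow> A \<subseteq> S \<and> A \<noteq> {} \<and> A \<union> nb A \<noteq> S \<and>
    (\<forall>a\<in>A. \<forall>b\<in>A. (a, b) \<in> (G \<inter> A \<times> A)\<^sup>*)" for A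
  show ?case
  proof (cases "\<exists>A. good A")
    case False
    have "clique G S"
      unfolding clique_def
    proof (intro ballI impI)
      fix u v assume uv: "u \<in> S" "v \<in> S" "u \<noteq> v"
      then have "{u} \<union> nb {u} = S"
        using False unfolding good_def by (metis empty_subsetI insert_subset insert_not_empty rtrancl.rtrancl_refl singletonD)
      then show "(u, v) \<in> G" using uv by (auto simp: nb_def)
    qed
    then show ?thesis
      using less.prems by (auto simp: clique_def)
  next
    case True
    have "finite {A. good A}"
      using less.prems by (auto simp: good_def intro: rev_finite_subset[of "Pow S"])
    then obtain A where A: "good A" and max: "\<And>B. good B \<Longrightarrow> A \<subseteq> B \<Longrightarrow> A = B"
      using finite_has_maximal[of "{A. good A}"] True by (metis (mono_tags) empty_iff mem_Collect_eq)
    define B where "B = S - A - nb A"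
    have B: "B \<noteq> {}" "B \<subseteq> S" "card B < card S"
    proof -
      show "B \<noteq> {}" "B \<subseteq> S" using A by (auto simp: good_def B_def nb_def)
      have "B \<subset> S" using A by (auto simp: good_def B_def)
      then show "card B < card S" using less.prems(1) by (simp add: psubset_card_mono)
    qed
    have AB: "(b, a) \<notin> G" "(a, b) \<notin> G" if "a \<in> A" "b \<in> B" for a b
      using that sym by (auto simp: B_def nb_def)
    \<comment> \<open>If \<open>x\<close> missed some \<open>b\<close> in \<open>B\<close>, then
      \<open>insert x A\<close> would still be connected and still fail to dominate
      \<open>b\<close>, against the maximality of \<open>A\<close>.\<close>
    have full: "(x, b) \<in> G" if x: "x \<in> nb A" and b: "b \<in> B" for x b
    proof (rule ccontr)
      assume nxb: "(x, b) \<notin> G"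
      obtain a0 where a0: "a0 \<in> A" "(a0, x) \<in> G" using x by (auto simp: nb_def)
      let ?R = "(G \<inter> insert x A \<times> insert x A)\<^sup>*"
      have conn: "(a, c) \<in> ?R" if "a \<in> A" "c \<in> A" for a c
      proof -
        have "(a, c) \<in> (G \<inter> A \<times> A)\<^sup>*"
          using A that by (auto simp: good_def)
        then show ?thesis
          by (rule rtrancl_mono[THEN subsetD, rotated]) auto
      qed
      have x1: "(x, a) \<in> ?R" if "a \<in> A" for a
        by (rule converse_rtrancl_into_rtrancl[OF _ conn[OF a0(1) that]])
          (use a0 sym[OF a0(2)] in simp)
      have x2: "(a, x) \<in> ?R" if "a \<in> A" for a
        by (rule rtrancl_into_rtrancl[OF conn[OF that a0(1)]]) (use a0 in simp)
      have "b \<notin> insert x A \<union> nb (insert x A)"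
        using b x nxb AB(2)[OF _ b] by (auto simp: nb_def B_def)
      then have "insert x A \<union> nb (insert x A) \<noteq> S"
        using b by (auto simp: B_def)
      moreover have "insert x A \<subseteq> S"
        using A x by (auto simp: good_def nb_def)
      moreover have "\<forall>a\<in>insert x A. \<forall>c\<in>insert x A. (a, c) \<in> ?R"
        using conn x1 x2 by simp
      ultimately have "good (insert x A)"
        unfolding good_def by simp
      then show False using max[of "insert x A"] x by (auto simp: nb_def)
    qed
    have cl: "clique G (nb A)"
      unfolding clique_def
    proof (intro ballI impI)
      fix x y assume xy: "x \<in> nb A" "y \<in> nb A" "x \<noteq> y"
      obtain b where b: "b \<in> B" using B by auto
      obtain a c where ac: "a \<in> A" "(a, x) \<in> G" "c \<in> A" "(c, y) \<in> G"
        using xy by (auto simp: nb_def)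
      let ?R = "(G \<inter> insert x (insert y A) \<times> insert x (insert y A))"
      have "(a, c) \<in> (G \<inter> A \<times> A)\<^sup>*"
        using A ac by (auto simp: good_def)
      then have "(a, c) \<in> ?R\<^sup>*"
        by (rule rtrancl_mono[THEN subsetD, rotated]) auto
      moreover have "(x, a) \<in> ?R" "(c, y) \<in> ?R" using ac sym[OF ac(2)] by simp_all
      ultimately have path: "(x, y) \<in> ?R\<^sup>*"
        by (meson converse_rtrancl_into_rtrancl rtrancl.rtrancl_into_rtrancl)
      \<comment> \<open>Any vertex \<open>b\<close> of \<open>B\<close> serves as the common
        neighbour: it sees all of \<open>nb A\<close> and nothing of \<open>A\<close>, while
        \<open>x\<close> and \<open>y\<close> are joined through \<open>A\<close>.\<close>
      show "(x, y) \<in> G"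
        by (rule chordal_common_neighbors[OF G path, of b])
          (use full xy b AB B_def in auto)
    qed
    obtain v where v: "v \<in> B" "clique G {u \<in> B. (v, u) \<in> G}"
      using less.hyps[OF B(3)] B finite_subset[OF B(2) less.prems(1)] by blast
    have "{u \<in> S. (v, u) \<in> G} \<subseteq> {u \<in> B. (v, u) \<in> G} \<union> nb A"
      using AB[OF _ v(1)] by (auto simp: B_def)
    moreover have "clique G ({u \<in> B. (v, u) \<in> G} \<union> nb A)"
      using v(2) cl full sym unfolding clique_def by blast
    ultimately have "clique G {u \<in> S. (v, u) \<in> G}"
      unfolding clique_def by blast
    then show ?thesis using v(1) B(2) by blast
  qed
qed

lemma chordal_elimination_induct [consumes 3, case_names empty insert]:
  fixes G :: "'v rel"
  assumes "simple_graph G" "chordal G" "finite S"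
    and "P {}"
    and "\<And>v S. \<lbrakk>finite S; v \<notin> S; clique G {u \<in> S. (v, u) \<in> G}; P S\<rbrakk> \<Longrightarrow> P (insert v S)"
  shows "P S"
  using assms(3)
proof (induction "card S" arbitrary: S rule: less_induct)
  case (less S)
  show ?case
  proof (cases "S = {}")
    case False
    then obtain v where v: "v \<in> S" "clique G {u \<in> S. (v, u) \<in> G}"
      using chordal_simplicial_vertex[OF assms(1,2) less.prems] by blast
    then have "card (S - {v}) < card S"
      using less.prems by (simp add: card_gt_0_iff False)
    then have "P (S - {v})"
      using less by simp
    then have "P (insert v (S - {v}))"
      using v less.prems by (intro assms(5)) (auto simp: clique_def)
    then show ?thesis using v(1) by (simp add: insert_absorb)
  qed (simp add: assms(4))
qed

section \<open>Components and cliques along an elimination ordering\<close>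

text \<open>The removed set is written as a complement from here on, so that the recursion can run
  over induced subgraphs on \<open>U\<close>.\<close>

lemma num_components_minus_eq:
  "num_components_minus G (- U) = card (U // (G \<inter> U \<times> U)\<^sup>*)"
  by (simp add: num_components_minus_def components_minus_def)

lemma rtrancl_Restr_sym:
  assumes "simple_graph G" "(x, y) \<in> (G \<inter> U \<times> U)\<^sup>*"
  shows "(y, x) \<in> (G \<inter> U \<times> U)\<^sup>*"
proof -
  have "sym (G \<inter> U \<times> U)" using assms(1) by (auto simp: simple_graph_def sym_def)
  then show ?thesis using assms(2) by (meson sym_rtrancl symD)
qed

lemma component_eq_iff:
  assumes "simple_graph G"
  shows "(G \<inter> U \<times> U)\<^sup>* `` {x} = (G \<inter> U \<times> U)\<^sup>* `` {y} \<longleftrightarrow> (x, y) \<in> (G \<inter> U \<times> U)\<^sup>*"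
  using rtrancl_Restr_sym[OF assms] by (auto intro: rtrancl_trans)

text \<open>Adding a vertex changes the component classes as sets. They are therefore counted
  through the equivalence that they induce on representatives.\<close>

lemma card_image_cong_eq:
  assumes "\<And>x y. x \<in> A \<Longrightarrow> y \<in> A \<Longrightarrow> f x = f y \<longleftrightarrow> g x = g y"
  shows "card (f ` A) = card (g ` A)"
proof (rule bij_betw_same_card)
  let ?h = "\<lambda>z. g (SOME x. x \<in> A \<and> f x = z)"
  have h: "?h (f x) = g x" if "x \<in> A" for x
  proof -
    have "\<exists>y. y \<in> A \<and> f y = f x" using that by blast
    from someI_ex[OF this] show ?thesis using assms that by blast
  qed
  show "bij_betw ?h (f ` A) (g ` A)"
    by (rule bij_betw_imageI) (use h assms in \<open>auto simp: inj_on_def image_iff\<close>)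
qed

text \<open>A walk that passes through \<open>v\<close> enters and leaves by neighbours of
  \<open>v\<close>, which are equal or adjacent, so the detour can be cut out. Hence
  \<open>v\<close> never merges two components: it joins the component of its neighbours, or forms a
  new one if it has none.\<close>

lemma num_components_insert_simplicial:
  assumes G: "simple_graph G" and "finite U" "v \<notin> U" and cl: "clique G {u \<in> U. (v, u) \<in> G}"
  shows "num_components_minus G (- insert v U) =
    num_components_minus G (- U) + (if {u \<in> U. (v, u) \<in> G} = {} then 1 else 0)"
proof -
  let ?r = "(G \<inter> U \<times> U)\<^sup>*" and ?r' = "(G \<inter> insert v U \<times> insert v U)\<^sup>*"
  have sym: "(x, y) \<in> G \<Longrightarrow> (y, x) \<in> G" and irr: "(x, x) \<notin> G" for x y
    using G by (auto simp: simple_graph_def irrefl_def dest: symD)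
  have quot: "A // s = (\<lambda>x. s `` {x}) ` A" for A :: "'a set" and s
    by (auto simp: quotient_def)
  have mono: "?r \<subseteq> ?r'" by (intro rtrancl_mono) auto
  \<comment> \<open>Both claims are proved in one induction along the walk. The second records,
    while the walk stands at \<open>v\<close>, a neighbour of \<open>v\<close> already reached
    inside \<open>U\<close>, from which the walk can continue.\<close>
  have "y \<in> U \<longrightarrow> (x, y) \<in> ?r" and "y = v \<longrightarrow> (\<exists>u\<in>U. (x, u) \<in> ?r \<and> (v, u) \<in> G)"
    if "(x, y) \<in> ?r'" "x \<in> U" for x y
    using that(1)
  proof (induction rule: rtrancl_induct)
    case base
    { case 1 then show ?case by simp }
    { case 2 then show ?case using that(2) \<open>v \<notin> U\<close> by blast }
  next
    case (step y z)
    { case 1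
      show ?case
      proof
        assume "z \<in> U"
        show "(x, z) \<in> ?r"
        proof (cases "y = v")
          case True
          then obtain u where u: "u \<in> U" "(x, u) \<in> ?r" "(v, u) \<in> G" using step.IH by blast
          have "(v, z) \<in> G" using step.hyps True by blast
          then have "u = z \<or> (u, z) \<in> G"
            using cl u \<open>z \<in> U\<close> by (auto simp: clique_def)
          then show ?thesis using u \<open>z \<in> U\<close> by (auto intro: rtrancl_into_rtrancl)
        next
          case False
          then have "y \<in> U" "(y, z) \<in> G" using step.hyps by auto
          then show ?thesis using step.IH \<open>z \<in> U\<close> by (auto intro: rtrancl_into_rtrancl)
        qed
      qed }
    { case 2
      show ?case
      proof
        assume "z = v"
        then have "y \<in> U" "(v, y) \<in> G" using step.hyps irr sym by auto
        then show "\<exists>u\<in>U. (x, u) \<in> ?r \<and> (v, u) \<in> G" using step.IH by blast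
      qed }
  qed
  note reach = this
  have agree: "?r' `` {x} = ?r' `` {y} \<longleftrightarrow> ?r `` {x} = ?r `` {y}" if "x \<in> U" "y \<in> U" for x y
    using reach(1)[of x y] that mono unfolding component_eq_iff[OF G] by blast
  have card: "card ((\<lambda>x. ?r' `` {x}) ` U) = card ((\<lambda>x. ?r `` {x}) ` U)"
    by (rule card_image_cong_eq) (rule agree)
  show ?thesis
  proof (cases "{u \<in> U. (v, u) \<in> G} = {}")
    case True
    have "?r' `` {v} \<noteq> ?r' `` {x}" if "x \<in> U" for x
      using reach(2)[of x v] that True rtrancl_Restr_sym[OF G] unfolding component_eq_iff[OF G] by blast
    then have "?r' `` {v} \<notin> (\<lambda>x. ?r' `` {x}) ` U" by blast
    then show ?thesis
      using True card \<open>finite U\<close> by (simp add: num_components_minus_eq quot)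
  next
    case False
    then obtain u where u: "u \<in> U" "(v, u) \<in> G" by blast
    then have "?r' `` {v} = ?r' `` {u}"
      unfolding component_eq_iff[OF G] by (intro r_into_rtrancl) simp
    then have "(\<lambda>x. ?r' `` {x}) ` insert v U = (\<lambda>x. ?r' `` {x}) ` U"
      using u(1) by auto
    then show ?thesis
      using False card by (simp add: num_components_minus_eq quot)
  qed
qed

section \<open>Generating polynomials of components and of cliques\<close>

lemma num_components_minus_UNIV: "num_components_minus G UNIV = 0"
  by (simp add: num_components_minus_def components_minus_def)

lemma num_components_minus_pos:
  fixes G :: "'v::finite rel"
  assumes "Y \<noteq> UNIV"
  shows "num_components_minus G Y \<ge> 1"
  using assms by (auto simp: num_components_minus_def components_minus_def card_gt_0_iff Suc_le_eq)

text \<open>For nonempty \<open>U\<close> the number W(G[U]) - 1 is the rank of the reduced degree 0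
  homology of the clique complex on \<open>U\<close>, so the coefficients at X^s for s >= 2 are the
  sums in Hochster's formula for the linear strand. The empty \<open>U\<close> has no components and
  contributes -1.\<close>

definition component_poly :: "'v rel \<Rightarrow> 'v set \<Rightarrow> int poly" where
  "component_poly G S =
     (\<Sum>U\<in>Pow S. Polynomial.smult (int (num_components_minus G (- U)) - 1) ([:0, 1:] ^ card U))"

text \<open>The empty clique has to be excluded explicitly, because the truncated exponent 0 - 1 = 0
  would count it as a vertex.\<close>

definition clique_poly :: "'v rel \<Rightarrow> 'v set \<Rightarrow> int poly" where
  "clique_poly G S = (\<Sum>C | C \<subseteq> S \<and> clique G C \<and> C \<noteq> {}. [:0, 1:] ^ (card C - 1))"

definition clique_number_on :: "'v rel \<Rightarrow> 'v set \<Rightarrow> nat" where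
  "clique_number_on G S = Max (card ` {C. C \<subseteq> S \<and> clique G C})"

lemma sum_Pow_power_card:
  fixes x :: "'a::comm_semiring_1"
  assumes "finite A"
  shows "(\<Sum>C\<in>Pow A. x ^ card C) = (1 + x) ^ card A"
  using prod_add[OF assms, of "\<lambda>_. x" "\<lambda>_. 1"] by (simp add: add.commute)

lemma sum_Pow_insert:
  assumes "finite S" "v \<notin> S"
  shows "(\<Sum>U\<in>Pow (insert v S). f U) = (\<Sum>U\<in>Pow S. f U) + (\<Sum>U\<in>Pow S. f (insert v U))"
proof -
  have "inj_on (insert v) (Pow S)" using assms(2) by (auto simp: inj_on_def)
  moreover have "Pow S \<inter> insert v ` Pow S = {}" using assms(2) by auto
  ultimately show ?thesis
    using assms by (simp add: Pow_insert sum.union_disjoint sum.reindex)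
qed

lemma component_poly_empty: "component_poly G {} = - 1"
  by (simp add: component_poly_def num_components_minus_UNIV one_pCons)

text \<open>Each subset \<open>U\<close> of \<open>S\<close> occurs once alone and once together
  with \<open>v\<close>, which gives the factor 1 + X. The second occurrence has an additional
  component exactly when \<open>U\<close> avoids the neighbours of \<open>v\<close>, and those
  \<open>U\<close> sum to a power of 1 + X.\<close>

lemma component_poly_insert:
  assumes G: "simple_graph G" and S: "finite S" "v \<notin> S" and cl: "clique G {u \<in> S. (v, u) \<in> G}"
  shows "component_poly G (insert v S) = [:1, 1:] * component_poly G S +
    [:0, 1:] * [:1, 1:] ^ (card S - card {u \<in> S. (v, u) \<in> G})"
proof -
  let ?N = "{u \<in> S. (v, u) \<in> G}" and ?X = "[:0, 1:] :: int poly"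
  let ?c = "\<lambda>U. int (num_components_minus G (- U)) - 1"
  have c: "?c (insert v U) = ?c U + (if U \<in> Pow (S - ?N) then 1 else 0)" if "U \<in> Pow S" for U
  proof -
    have "clique G {u \<in> U. (v, u) \<in> G}" "finite U" "v \<notin> U"
      using that cl S by (auto simp: clique_def finite_subset)
    moreover have "{u \<in> U. (v, u) \<in> G} = {} \<longleftrightarrow> U \<in> Pow (S - ?N)" using that by auto
    ultimately show ?thesis
      using num_components_insert_simplicial[OF G] by simp
  qed
  have "(\<Sum>U\<in>Pow S. Polynomial.smult (?c (insert v U)) (?X ^ card (insert v U))) =
     (\<Sum>U\<in>Pow S. ?X * Polynomial.smult (?c U) (?X ^ card U) +
        (if U \<in> Pow (S - ?N) then ?X * ?X ^ card U else 0))"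
  proof (rule sum.cong)
    fix U assume U: "U \<in> Pow S"
    then have "card (insert v U) = Suc (card U)" using S by (auto simp: finite_subset card_insert_if)
    then show "Polynomial.smult (?c (insert v U)) (?X ^ card (insert v U)) =
      ?X * Polynomial.smult (?c U) (?X ^ card U) +
        (if U \<in> Pow (S - ?N) then ?X * ?X ^ card U else 0)"
      unfolding c[OF U] by (simp add: smult_add_left)
  qed simp
  also have "\<dots> = ?X * component_poly G S + ?X * (\<Sum>U\<in>Pow (S - ?N). ?X ^ card U)"
  proof -
    have "(\<Sum>U\<in>Pow S. if U \<in> Pow (S - ?N) then ?X * ?X ^ card U else 0) =
       (\<Sum>U\<in>Pow S \<inter> Pow (S - ?N). ?X * ?X ^ card U)"
      using S by (simp only: sum.inter_restrict[OF finite_Pow_iff[THEN iffD2]])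
    moreover have "Pow S \<inter> Pow (S - ?N) = Pow (S - ?N)" by auto
    ultimately show ?thesis
      by (simp only: sum.distrib sum_distrib_left component_poly_def)
  qed
  also have "(\<Sum>U\<in>Pow (S - ?N). ?X ^ card U) = [:1, 1:] ^ (card S - card ?N)"
  proof -
    have "card (S - ?N) = card S - card ?N" using S by (intro card_Diff_subset) auto
    moreover have "1 + ?X = [:1, 1:]" by (simp add: one_pCons)
    ultimately show ?thesis using S by (simp only: sum_Pow_power_card finite_Diff)
  qed
  finally have *: "component_poly G (insert v S) = component_poly G S + (?X * component_poly G S +
      ?X * [:1, 1:] ^ (card S - card ?N))"
    unfolding component_poly_def sum_Pow_insert[OF S] by simp
  have "[:1, 1:] = 1 + ?X" by (simp add: one_pCons)
  then show ?thesis unfolding * by (simp only: distrib_right mult_1_left add.assoc)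
qed

lemma clique_insert_iff:
  assumes "simple_graph G" "v \<notin> C"
  shows "clique G (insert v C) \<longleftrightarrow> clique G C \<and> (\<forall>u\<in>C. (v, u) \<in> G)"
  using assms by (auto simp: clique_def simple_graph_def dest: symD)

lemma cliques_insert_simplicial:
  assumes G: "simple_graph G" and "v \<notin> S" and cl: "clique G {u \<in> S. (v, u) \<in> G}"
  shows "{C. C \<subseteq> insert v S \<and> clique G C} =
    {C. C \<subseteq> S \<and> clique G C} \<union> insert v ` Pow {u \<in> S. (v, u) \<in> G}"
proof (intro equalityI subsetI)
  fix C assume "C \<in> {C. C \<subseteq> insert v S \<and> clique G C}"
  then have C: "C \<subseteq> insert v S" "clique G C" by auto
  show "C \<in> {C. C \<subseteq> S \<and> clique G C} \<union> insert v ` Pow {u \<in> S. (v, u) \<in> G}"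
  proof (cases "v \<in> C")
    case True
    then have "C = insert v (C - {v})" by auto
    moreover have "C - {v} \<in> Pow {u \<in> S. (v, u) \<in> G}" using C True by (auto simp: clique_def)
    ultimately show ?thesis by blast
  qed (use C in auto)
next
  fix C assume "C \<in> {C. C \<subseteq> S \<and> clique G C} \<union> insert v ` Pow {u \<in> S. (v, u) \<in> G}"
  then show "C \<in> {C. C \<subseteq> insert v S \<and> clique G C}"
  proof
    assume "C \<in> insert v ` Pow {u \<in> S. (v, u) \<in> G}"
    then obtain D where D: "C = insert v D" "D \<subseteq> {u \<in> S. (v, u) \<in> G}" by auto
    then have "clique G D" "v \<notin> D" using cl \<open>v \<notin> S\<close> by (auto simp: clique_def)
    then show ?thesis using D clique_insert_iff[OF G] by auto
  qed auto
qed

text \<open>The new cliques are \<open>v\<close> together with an arbitrary subset of its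
  neighbourhood, because that neighbourhood is a clique. Discounting \<open>v\<close> in the
  exponent leaves the binomial expansion of (1 + X)^k.\<close>

lemma clique_poly_insert:
  assumes G: "simple_graph G" and S: "finite S" "v \<notin> S" and cl: "clique G {u \<in> S. (v, u) \<in> G}"
  shows "clique_poly G (insert v S) = clique_poly G S + [:1, 1:] ^ card {u \<in> S. (v, u) \<in> G}"
proof -
  let ?N = "{u \<in> S. (v, u) \<in> G}" and ?X = "[:0, 1:] :: int poly"
  have "{C. C \<subseteq> insert v S \<and> clique G C \<and> C \<noteq> {}} =
      {C. C \<subseteq> S \<and> clique G C \<and> C \<noteq> {}} \<union> insert v ` Pow ?N"
    using cliques_insert_simplicial[OF G S(2) cl] by blast
  moreover have "{C. C \<subseteq> S \<and> clique G C \<and> C \<noteq> {}} \<inter> insert v ` Pow ?N = {}"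
    using S(2) by auto
  moreover have "inj_on (insert v) (Pow ?N)" using S(2) by (auto simp: inj_on_def)
  moreover have "finite {C. C \<subseteq> S \<and> clique G C \<and> C \<noteq> {}}" "finite (Pow ?N)"
    using S(1) by auto
  ultimately have "clique_poly G (insert v S) =
      clique_poly G S + (\<Sum>C\<in>Pow ?N. ?X ^ (card (insert v C) - 1))"
    unfolding clique_poly_def by (simp add: sum.union_disjoint sum.reindex)
  also have "(\<Sum>C\<in>Pow ?N. ?X ^ (card (insert v C) - 1)) = (\<Sum>C\<in>Pow ?N. ?X ^ card C)"
  proof (rule sum.cong)
    fix C assume "C \<in> Pow ?N"
    then have "finite C" "v \<notin> C" using S by (auto intro: finite_subset)
    then show "?X ^ (card (insert v C) - 1) = ?X ^ card C" by simp
  qed simp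
  also have "\<dots> = [:1, 1:] ^ card ?N"
    using S(1) by (subst sum_Pow_power_card) (auto simp: one_pCons)
  finally show ?thesis .
qed

lemma clique_number_on_insert:
  assumes G: "simple_graph G" and S: "finite S" "v \<notin> S" and cl: "clique G {u \<in> S. (v, u) \<in> G}"
  shows "clique_number_on G (insert v S) = max (clique_number_on G S) (Suc (card {u \<in> S. (v, u) \<in> G}))"
proof -
  let ?N = "{u \<in> S. (v, u) \<in> G}" and ?A = "{C. C \<subseteq> S \<and> clique G C}"
  have "{} \<in> ?A" by (simp add: clique_def)
  then have ne: "?A \<noteq> {}" by blast
  have fin: "finite (card ` ?A)" "finite (card ` insert v ` Pow ?N)" using S(1) by auto
  have "Max (card ` insert v ` Pow ?N) = Suc (card ?N)"
  proof (rule Max_eqI[OF fin(2)])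
    show "Suc (card ?N) \<in> card ` insert v ` Pow ?N"
      using S by (auto simp: image_image intro!: image_eqI[of _ _ ?N])
    fix k assume "k \<in> card ` insert v ` Pow ?N"
    then obtain D where D: "D \<subseteq> ?N" "k = card (insert v D)" by auto
    moreover have "card D \<le> card ?N" using D S by (intro card_mono) auto
    ultimately show "k \<le> Suc (card ?N)"
      using card_insert_le_m1[of "Suc (card ?N)" D v] by simp
  qed
  moreover have "Pow ?N \<noteq> {}" by blast
  ultimately show ?thesis
    unfolding clique_number_on_def cliques_insert_simplicial[OF G S(2) cl] image_Un
    using Max_Un[OF fin(1) _ fin(2)] ne by simp
qed

lemma clique_number_on_ge:
  assumes "finite S" "C \<subseteq> S" "clique G C"
  shows "card C \<le> clique_number_on G S"
  unfolding clique_number_on_def using assms by (intro Max_ge) auto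

lemma clique_number_on_le_card:
  assumes "finite S"
  shows "clique_number_on G S \<le> card S"
  unfolding clique_number_on_def
proof (rule Max.boundedI)
  have "{} \<in> {C. C \<subseteq> S \<and> clique G C}" by (simp add: clique_def)
  then show "card ` {C. C \<subseteq> S \<and> clique G C} \<noteq> {}" by blast
qed (use assms in \<open>auto intro: card_mono\<close>)

text \<open>\<open>K\<close> is the multiset of the numbers of earlier neighbours of the vertices, in the order in
  which a perfect elimination ordering rebuilds the graph.\<close>

lemma chordal_degree_multiset:
  assumes G: "simple_graph G" "chordal G" and "finite S"
  shows "\<exists>K. set_mset K = {..<clique_number_on G S} \<and>
    clique_poly G S = (\<Sum>k\<in>#K. [:1, 1:] ^ k) \<and>
    component_poly G S = - ([:1, 1:] ^ card S) + [:0, 1:] * (\<Sum>k\<in>#K. [:1, 1:] ^ (card S - 1 - k))"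
  using assms
proof (induction rule: chordal_elimination_induct)
  case empty
  have "{C. C \<subseteq> {} \<and> clique G C} = {{}}" by (auto simp: clique_def)
  then have "clique_number_on G {} = 0" by (simp add: clique_number_on_def)
  moreover have "{C. C \<subseteq> {} \<and> clique G C \<and> C \<noteq> {}} = {}" by auto
  then have "clique_poly G {} = 0" by (simp only: clique_poly_def sum.empty)
  ultimately show ?case
    by (intro exI[of _ "{#}"]) (simp add: component_poly_empty)
next
  case (insert v S)
  let ?k = "card {u \<in> S. (v, u) \<in> G}"
  obtain K where K: "set_mset K = {..<clique_number_on G S}"
      "clique_poly G S = (\<Sum>k\<in>#K. [:1, 1:] ^ k)"
      "component_poly G S = - ([:1, 1:] ^ card S) + [:0, 1:] * (\<Sum>k\<in>#K. [:1, 1:] ^ (card S - 1 - k))"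
    using insert.IH by blast
  \<comment> \<open>The earlier neighbours form a clique of \<open>S\<close>. So the new entry of
    \<open>K\<close> is at most one beyond the old range, and the entries keep filling an initial
    segment; this is the source of b_i >= 1.\<close>
  have "?k \<le> clique_number_on G S"
    by (rule clique_number_on_ge[OF insert.hyps(1) _ insert.hyps(3)]) blast
  then have "insert ?k {..<clique_number_on G S} = {..<max (clique_number_on G S) (Suc ?k)}"
    by (cases "?k = clique_number_on G S") (simp_all add: lessThan_Suc insert_absorb max_def)
  then have "set_mset (add_mset ?k K) = {..<clique_number_on G (insert v S)}"
    by (simp only: clique_number_on_insert[OF G(1) insert.hyps(1-3)] K(1) set_mset_add_mset_insert)
  moreover have "clique_poly G (insert v S) = (\<Sum>k\<in>#add_mset ?k K. [:1, 1:] ^ k)"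
    by (simp only: clique_poly_insert[OF G(1) insert.hyps(1-3)] K(2) image_mset_add_mset
        sum_mset.add_mset add.commute)
  moreover have "component_poly G (insert v S) = - ([:1, 1:] ^ card (insert v S)) +
      [:0, 1:] * (\<Sum>k\<in>#add_mset ?k K. [:1, 1:] ^ (card (insert v S) - 1 - k))"
  proof -
    have "(\<Sum>k\<in>#K. [:1, 1:] ^ (card S - k)) =
        [:1, 1:] * (\<Sum>k\<in>#K. [:1, 1 :: int:] ^ (card S - 1 - k))"
      unfolding sum_mset_distrib_left
    proof (rule arg_cong[of _ _ sum_mset], rule image_mset_cong)
      fix k assume "k \<in># K"
      \<comment> \<open>The strict bound makes the truncated exponent really drop by one, so that
        the old sum can absorb the factor 1 + X.\<close>
      then have "k < card S"
        using K(1) clique_number_on_le_card[OF insert.hyps(1), of G] by auto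
      then have "card S - k = Suc (card S - 1 - k)" by simp
      then show "[:1, 1 :: int:] ^ (card S - k) = [:1, 1:] * [:1, 1:] ^ (card S - 1 - k)"
        by (simp only: power_Suc)
    qed
    moreover have "card (insert v S) = Suc (card S)" using insert.hyps by simp
    moreover have "l * (- p + x * m) + x * q = - (l * p) + x * (q + l * m)" for l x p m q :: "int poly"
      by (simp add: algebra_simps)
    ultimately show ?thesis
      unfolding component_poly_insert[OF G(1) insert.hyps(1-3)] K(3)
      by (simp only: diff_Suc_1 image_mset_add_mset sum_mset.add_mset power_Suc)
  qed
  ultimately show ?case by blast
qed

section \<open>From the polynomials to the b-vector and the separator sums\<close>

lemma coeff_component_poly:
  fixes G :: "'v::finite rel"
  shows "coeff (component_poly G S) s =
    (\<Sum>U | U \<subseteq> S \<and> card U = s. int (num_components_minus G (- U)) - 1)"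
proof -
  have "coeff ([:0, 1 :: int:] ^ m) s = (if m = s then 1 else 0)" for m
    by (simp flip: monom_altdef[of 1, simplified])
  then have "coeff (component_poly G S) s =
      (\<Sum>U\<in>Pow S. if card U = s then int (num_components_minus G (- U)) - 1 else 0)"
    by (auto simp: component_poly_def coeff_sum intro!: sum.cong)
  also have "\<dots> = (\<Sum>U\<in>Pow S \<inter> {U. card U = s}. int (num_components_minus G (- U)) - 1)"
    by (subst sum.inter_restrict) auto
  also have "Pow S \<inter> {U. card U = s} = {U. U \<subseteq> S \<and> card U = s}" by auto
  finally show ?thesis .
qed

lemma clique_poly_UNIV:
  fixes G :: "'v::finite rel"
  shows "clique_poly G UNIV =
    (\<Sum>i = 1..clique_number G. Polynomial.smult (int (clique_count G i)) ([:0, 1:] ^ (i - 1)))"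
proof -
  let ?A = "{C. clique G C \<and> C \<noteq> {}}" and ?X = "[:0, 1:] :: int poly"
  have d: "card C \<le> clique_number G" if "clique G C" for C
    unfolding clique_number_def using that by (intro Max_ge) auto
  have "card ` ?A \<subseteq> {1..clique_number G}"
  proof clarify
    fix C assume "clique G C" "C \<noteq> {}"
    then show "card C \<in> {1..clique_number G}"
      using d[of C] by (simp add: Suc_le_eq card_gt_0_iff)
  qed
  then have "(\<Sum>i = 1..clique_number G. \<Sum>C | C \<in> ?A \<and> card C = i. ?X ^ (card C - 1)) =
      (\<Sum>C\<in>?A. ?X ^ (card C - 1))"
    by (intro sum.group) auto
  moreover have "(\<Sum>C | C \<in> ?A \<and> card C = i. ?X ^ (card C - 1)) =
      Polynomial.smult (int (clique_count G i)) (?X ^ (i - 1))" if "i \<in> {1..clique_number G}" for i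
  proof -
    have "{C. C \<in> ?A \<and> card C = i} = {C. clique G C \<and> card C = i}" using that by auto
    then show ?thesis by (simp add: clique_count_def of_nat_poly)
  qed
  ultimately show ?thesis by (simp add: clique_poly_def)
qed

lemma clique_number_on_UNIV:
  fixes G :: "'v::finite rel"
  shows "clique_number_on G UNIV = clique_number G"
  unfolding clique_number_on_def clique_number_def by (rule arg_cong[of _ _ Max]) auto

lemma sum_mset_eq_sum_lessThan:
  fixes f :: "nat \<Rightarrow> 'a::comm_semiring_1"
  assumes "set_mset K \<subseteq> {..<n}"
  shows "(\<Sum>k\<in>#K. f k) = (\<Sum>k<n. of_nat (count K k) * f k)"
  using assms
proof (induction K)
  case (add x K)
  then have "x < n" by simp
  have "(\<Sum>k<n. of_nat (count (add_mset x K) k) * f k) =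
      (\<Sum>k<n. of_nat (count K k) * f k + (if k = x then f k else 0))"
    by (rule sum.cong) (auto simp: algebra_simps)
  then show ?case
    using add \<open>x < n\<close> by (simp add: sum.distrib add.commute)
qed simp

lemma of_nat_mult_poly: "of_nat n * p = Polynomial.smult (of_nat n) p"
  by (simp add: of_nat_poly)

text \<open>Substituting X - 1 for X turns the powers of 1 + X into powers of X, whose coefficients
  can be compared. This recovers \<open>b\<close>, which is given only implicitly by a polynomial
  identity.\<close>

lemma shifted_power_basis_unique:
  fixes a b :: "nat \<Rightarrow> int"
  assumes "(\<Sum>k<d. Polynomial.smult (a k) ([:1, 1:] ^ k)) = (\<Sum>k<d. Polynomial.smult (b k) ([:1, 1:] ^ k))"
    and "k < d"
  shows "a k = b k"
proof -
  have pow: "([:1, 1 :: int:] ^ k) \<circ>\<^sub>p [:-1, 1:] = [:0, 1:] ^ k" for k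
  proof (induction k)
    case (Suc k)
    then show ?case by (simp only: power_Suc pcompose_mult) (simp add: pcompose_pCons)
  qed (simp add: pcompose_1)
  have "(\<Sum>k<d. Polynomial.smult (c k) ([:1, 1:] ^ k)) \<circ>\<^sub>p [:-1, 1:] =
      (\<Sum>k<d. Polynomial.monom (c k) k)" for c :: "nat \<Rightarrow> int"
    by (simp add: pcompose_sum pcompose_smult pow monom_altdef)
  then have "(\<Sum>k<d. Polynomial.monom (a k) k) = (\<Sum>k<d. Polynomial.monom (b k) k)"
    using assms(1) by metis
  then have "coeff (\<Sum>k<d. Polynomial.monom (a k) k) k = coeff (\<Sum>k<d. Polynomial.monom (b k) k) k"
    by simp
  then show ?thesis using assms(2) by (simp add: coeff_sum)
qed

lemma coeff_linear_one_power: "coeff ([:1, 1 :: int:] ^ m) s = int (m choose s)"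
proof (induction m arbitrary: s)
  case 0
  then show ?case by (cases s) auto
next
  case (Suc m)
  then show ?case by (cases s) (simp_all add: mult_pCons_left)
qed

text \<open>Passing from \<open>Y\<close> to its complement: i - 1 removed vertices leave n - i + 1.
  The range of \<open>i\<close> keeps the truncated subtractions exact.\<close>

lemma sum_separators:
  fixes G :: "'v::finite rel"
  assumes "i \<in> {1..card (UNIV :: 'v set)}"
  shows "(\<Sum>Y | card Y = i - 1. int (num_components_minus G Y) - 1) =
    coeff (component_poly G UNIV) (card (UNIV :: 'v set) - i + 1)"
proof -
  have *: "card (- Y) = card (UNIV :: 'v set) - i + 1 \<longleftrightarrow> card Y = i - 1" for Y :: "'v set"
  proof -
    have "card Y \<le> card (UNIV :: 'v set)" by (rule card_mono) auto
    then show ?thesis using assms by (auto simp: Compl_eq_Diff_UNIV card_Diff_subset)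
  qed
  have "bij_betw uminus {Y :: 'v set. card Y = i - 1} {U. card U = card (UNIV :: 'v set) - i + 1}"
  proof (rule bij_betw_imageI)
    show "uminus ` {Y :: 'v set. card Y = i - 1} = {U. card U = card (UNIV :: 'v set) - i + 1}"
    proof (intro equalityI subsetI)
      fix U assume "U \<in> {U :: 'v set. card U = card (UNIV :: 'v set) - i + 1}"
      then have "- U \<in> {Y :: 'v set. card Y = i - 1}" using *[of "- U"] by simp
      then show "U \<in> uminus ` {Y :: 'v set. card Y = i - 1}"
        by (rule rev_image_eqI) simp
    next
      fix U assume "U \<in> uminus ` {Y :: 'v set. card Y = i - 1}"
      then show "U \<in> {U. card U = card (UNIV :: 'v set) - i + 1}"
        using * by (elim imageE) (simp only: mem_Collect_eq)
    qed
  qed (auto simp: inj_on_def)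
  from sum.reindex_bij_betw[OF this, of "\<lambda>U. int (num_components_minus G (- U)) - 1"]
  show ?thesis by (simp add: coeff_component_poly)
qed

text \<open>The hockey-stick identity turns the leading \<open>(1 + x) ^ n\<close> of the component polynomial
  into the subtraction of \<open>1\<close> from every multiplicity.\<close>

lemma chordal_b_vector:
  fixes G :: "'v::finite rel" and b :: "nat \<Rightarrow> int"
  assumes G: "simple_graph G" "chordal G" and b: "is_b_vector G b"
  obtains a :: "nat \<Rightarrow> int" where "\<And>i. i \<in> {1..clique_number G} \<Longrightarrow> a i = b i \<and> a i \<ge> 1"
    and "\<And>i. i > clique_number G \<Longrightarrow> a i = 0"
    and "\<And>i. i \<in> {1..card (UNIV :: 'v set)} \<Longrightarrow>
      (\<Sum>Y | card Y = i - 1. int (num_components_minus G Y) - 1) =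
      a i - 1 + (\<Sum>l = 1..<i. (a l - 1) * int ((card (UNIV :: 'v set) - l) choose (i - l)))"
proof -
  let ?n = "card (UNIV :: 'v set)" and ?d = "clique_number G" and ?L = "[:1, 1:] :: int poly"
  obtain K where K: "set_mset K = {..<?d}" "clique_poly G UNIV = (\<Sum>k\<in>#K. ?L ^ k)"
     "component_poly G UNIV = - (?L ^ ?n) + [:0, 1:] * (\<Sum>k\<in>#K. ?L ^ (?n - 1 - k))"
    using chordal_degree_multiset[OF G, of UNIV] by (auto simp: clique_number_on_UNIV)
  have dn: "?d \<le> ?n"
    using clique_number_on_le_card[of UNIV G] by (simp add: clique_number_on_UNIV)
  \<comment> \<open>The formula for the sums is needed for all i up to n, whereas \<open>b\<close>
    is constrained only up to the clique number. The multiplicities in \<open>K\<close> agree with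
    \<open>b\<close> there and vanish beyond.\<close>
  define a where "a i = int (count K (i - 1))" for i
  have "(\<Sum>k<?d. Polynomial.smult (b (Suc k)) (?L ^ k)) =
      (\<Sum>i = 1..?d. Polynomial.smult (b i) (?L ^ (i - 1)))"
    by (rule sum.reindex_bij_witness[of _ "\<lambda>i. i - 1" Suc]) auto
  also have "\<dots> = (\<Sum>k\<in>#K. ?L ^ k)"
    using b K(2) by (simp add: is_b_vector_def clique_poly_UNIV)
  also have "\<dots> = (\<Sum>k<?d. Polynomial.smult (int (count K k)) (?L ^ k))"
    by (simp only: sum_mset_eq_sum_lessThan[OF eq_refl[OF K(1)]] of_nat_mult_poly)
  finally have eq: "(\<Sum>k<?d. Polynomial.smult (b (Suc k)) (?L ^ k)) =
      (\<Sum>k<?d. Polynomial.smult (int (count K k)) (?L ^ k))" .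
  have bK: "b (Suc k) = int (count K k)" if "k < ?d" for k
    by (rule shifted_power_basis_unique[OF eq that])
  show thesis
  proof (rule that[of a])
    fix i assume "i \<in> {1..?d}"
    moreover from this have "i - 1 < ?d" by auto
    moreover from this have "i - 1 \<in># K" using K(1) by simp
    ultimately show "a i = b i \<and> a i \<ge> 1"
      using bK[of "i - 1"] by (simp add: a_def Suc_le_eq)
  next
    fix i assume "i > ?d"
    then have "i - 1 \<notin># K" unfolding K(1) lessThan_iff by arith
    then show "a i = 0" by (simp add: a_def count_eq_zero_iff)
  next
    fix i assume i: "i \<in> {1..?n}"
    define r where "r = ?n - i"
    have "set_mset K \<subseteq> {..<?n}" unfolding K(1) using dn by simp
    then have "(\<Sum>k\<in>#K. ?L ^ (?n - 1 - k)) = (\<Sum>k<?n. Polynomial.smult (int (count K k)) (?L ^ (?n - 1 - k)))"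
      by (simp only: sum_mset_eq_sum_lessThan of_nat_mult_poly)
    then have "coeff (component_poly G UNIV) (Suc r) =
        - int (?n choose Suc r) + (\<Sum>k<?n. int (count K k) * int ((?n - 1 - k) choose r))"
      by (simp add: K(3) coeff_sum coeff_linear_one_power)
    also have "int (?n choose Suc r) = (\<Sum>k<?n. int ((?n - 1 - k) choose r))"
    proof -
      obtain m where m: "?n = Suc m" using i by (cases ?n) auto
      have "(\<Sum>k<?n. (?n - 1 - k) choose r) = (\<Sum>k = 0..m. k choose r)"
        unfolding m by (rule sum.reindex_bij_witness[of _ "\<lambda>k. m - k" "\<lambda>k. m - k"]) auto
      also have "\<dots> = ?n choose Suc r"
        unfolding m by (simp only: sum_choose_upper atLeast0AtMost)
      finally show ?thesis by (simp flip: of_nat_sum)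
    qed
    also have "- (\<Sum>k<?n. int ((?n - 1 - k) choose r)) +
        (\<Sum>k<?n. int (count K k) * int ((?n - 1 - k) choose r)) =
        (\<Sum>k<?n. (int (count K k) - 1) * int ((?n - 1 - k) choose r))"
      by (simp add: algebra_simps sum_subtractf)
    \<comment> \<open>For k >= i the upper index n - 1 - k is below r = n - i, so these binomial
      coefficients vanish.\<close>
    also have "\<dots> = (\<Sum>k<i. (int (count K k) - 1) * int ((?n - 1 - k) choose r))"
      using i by (intro sum.mono_neutral_right) (auto simp: r_def)
    also have "\<dots> = (\<Sum>l = 1..<Suc i. (a l - 1) * int ((?n - l) choose r))"
      by (rule sum.reindex_bij_witness[of _ "\<lambda>l. l - 1" Suc]) (auto simp: a_def)
    also have "\<dots> = a i - 1 + (\<Sum>l = 1..<i. (a l - 1) * int ((?n - l) choose r))"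
      using i by (simp add: r_def)
    also have "(\<Sum>l = 1..<i. (a l - 1) * int ((?n - l) choose r)) =
        (\<Sum>l = 1..<i. (a l - 1) * int ((?n - l) choose (i - l)))"
    proof (rule sum.cong)
      fix l assume "l \<in> {1..<i}"
      then have "?n - l - (i - l) = r" "i - l \<le> ?n - l" using i by (auto simp: r_def)
      then show "(a l - 1) * int ((?n - l) choose r) = (a l - 1) * int ((?n - l) choose (i - l))"
        by (metis binomial_symmetric)
    qed simp
    finally show "(\<Sum>Y | card Y = i - 1. int (num_components_minus G Y) - 1) =
      a i - 1 + (\<Sum>l = 1..<i. (a l - 1) * int ((?n - l) choose (i - l)))"
      using sum_separators[OF i, of G] by (simp add: r_def)
  qed
qed

section \<open>Vertex connectivity and its effect on the b-vector\<close>

lemma vertex_connectivity_separator: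
  fixes G :: "'v::finite rel"
  assumes "simple_graph G" "\<not> complete_graph G"
  obtains Y where "2 \<le> num_components_minus G Y" "card Y = vertex_connectivity G"
    "vertex_connectivity G + 2 \<le> card (UNIV :: 'v set)"
proof -
  obtain u v where uv: "u \<noteq> v" "(u, v) \<notin> G"
    using assms(2) by (auto simp: complete_graph_def clique_def)
  let ?A = "{card Y | Y. 2 \<le> num_components_minus G Y}"
  \<comment> \<open>Keeping only two non-adjacent vertices disconnects the graph, so the minimum
    defining the connectivity is taken over a nonempty set and is attained.\<close>
  have "num_components_minus G (- {u, v}) = 2"
  proof -
    have "{w \<in> {v}. (u, w) \<in> G} = {}" using uv by auto
    moreover from this have "clique G {w \<in> {v}. (u, w) \<in> G}" by (simp only:) (simp add: clique_def)
    moreover have "{w \<in> {}. (v, w) \<in> G} = {}" by simp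
    moreover have "clique G {w \<in> {}. (v, w) \<in> G}" by (simp add: clique_def)
    ultimately show ?thesis
      using num_components_insert_simplicial[OF assms(1), of "{v}" u]
        num_components_insert_simplicial[OF assms(1), of "{}" v] uv
      by (simp add: num_components_minus_UNIV)
  qed
  then have "?A \<noteq> {}"
    using order_refl[of 2] by (metis (mono_tags, lifting) empty_iff mem_Collect_eq)
  moreover have "finite ?A" by simp
  ultimately have "vertex_connectivity G \<in> ?A"
    unfolding vertex_connectivity_def by (intro Min_in)
  then obtain Y where Y: "2 \<le> num_components_minus G Y" "card Y = vertex_connectivity G" by auto
  \<comment> \<open>Each component contains a vertex, so at least two vertices survive the removal
    of \<open>Y\<close>.\<close>
  have "num_components_minus G Y \<le> card (- Y)"
    unfolding num_components_minus_def components_minus_def quotient_def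
    by (rule order.trans[OF card_UN_le]) auto
  then have "vertex_connectivity G + 2 \<le> card (UNIV :: 'v set)"
    using Y by (simp add: Compl_eq_Diff_UNIV card_Diff_subset)
  then show thesis using that Y by blast
qed

lemma num_components_minus_below_connectivity:
  fixes G :: "'v::finite rel"
  assumes "card Y < vertex_connectivity G" "vertex_connectivity G \<le> card (UNIV :: 'v set)"
  shows "num_components_minus G Y = 1"
proof -
  have "\<not> 2 \<le> num_components_minus G Y"
  proof
    assume "2 \<le> num_components_minus G Y"
    then have "vertex_connectivity G \<le> card Y"
      unfolding vertex_connectivity_def
      by (intro Min_le) auto
    then show False using assms(1) by simp
  qed
  moreover have "Y \<noteq> UNIV" using assms by auto
  then have "num_components_minus G Y \<ge> 1" by (rule num_components_minus_pos)
  ultimately show ?thesis by simp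
qed

lemma chordal_b_vector_bounds:
  fixes G :: "'v::finite rel" and b :: "nat \<Rightarrow> int"
  assumes G: "simple_graph G" "\<not> complete_graph G" "chordal G" and b: "is_b_vector G b"
  shows "i \<in> {1..vertex_connectivity G + 1} \<Longrightarrow>
      b i = (\<Sum>Y | card Y = i - 1. int (num_components_minus G Y) - 1) + 1"
    and "i \<in> {vertex_connectivity G + 2..clique_number G} \<Longrightarrow>
      b i < (\<Sum>Y | card Y = i - 1. int (num_components_minus G Y) - 1) + 1"
    and "clique_number G < card (UNIV :: 'v set)"
proof -
  let ?n = "card (UNIV :: 'v set)" and ?d = "clique_number G" and ?\<kappa> = "vertex_connectivity G"
  let ?T = "\<lambda>i. \<Sum>Y | card Y = i - 1. int (num_components_minus G Y) - 1"
  obtain a where a: "\<And>i. i \<in> {1..?d} \<Longrightarrow> a i = b i \<and> a i \<ge> 1" "\<And>i. i > ?d \<Longrightarrow> a i = 0"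
    and T: "\<And>i. i \<in> {1..?n} \<Longrightarrow>
      ?T i = a i - 1 + (\<Sum>l = 1..<i. (a l - 1) * int ((?n - l) choose (i - l)))"
    by (rule chordal_b_vector[OF G(1,3) b]) blast
  obtain Y where Y: "2 \<le> num_components_minus G Y" "card Y = ?\<kappa>" "?\<kappa> + 2 \<le> ?n"
    by (rule vertex_connectivity_separator[OF G(1,2)]) blast
  have "clique G {}" by (simp add: clique_def)
  then have "?d \<in> {card S | S. clique G S}"
    unfolding clique_number_def by (intro Max_in) auto
  then obtain S where S: "clique G S" "card S = ?d" by auto
  have "S \<noteq> UNIV" using S G(2) by (auto simp: complete_graph_def)
  then have "S \<subset> UNIV" by auto
  then show dn: "?d < ?n" using S(2) by (metis finite psubset_card_mono)
  \<comment> \<open>Strong induction: the left side of the formula vanishes below the connectivity,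
    and the terms with smaller l vanish by induction, which leaves a_i - 1 = 0.\<close>
  have one: "a i = 1" if "1 \<le> i" "i \<le> ?\<kappa>" for i
    using that
  proof (induction i rule: less_induct)
    case (less i)
    have "?T i = 0"
    proof (rule sum.neutral, clarify)
      fix Y :: "'v set" assume "card Y = i - 1"
      then have "num_components_minus G Y = 1"
        using less.prems \<open>?\<kappa> + 2 \<le> ?n\<close> by (intro num_components_minus_below_connectivity) auto
      then show "int (num_components_minus G Y) - 1 = 0" by simp
    qed
    moreover have "(\<Sum>l = 1..<i. (a l - 1) * int ((?n - l) choose (i - l))) = 0"
    proof (rule sum.neutral, clarify)
      fix l assume "l \<in> {1..<i}"
      then have "a l = 1" using less.prems by (intro less.IH) simp_all
      then show "(a l - 1) * int ((?n - l) choose (i - l)) = 0" by simp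
    qed
    ultimately show "a i = 1" using T[of i] less.prems Y(3) by simp
  qed
  have T_small: "?T i = a i - 1" if "i \<in> {1..?\<kappa> + 1}" for i
  proof -
    have "(\<Sum>l = 1..<i. (a l - 1) * int ((?n - l) choose (i - l))) = 0"
    proof (rule sum.neutral, clarify)
      fix l assume "l \<in> {1..<i}"
      then have "a l = 1" using that by (intro one) simp_all
      then show "(a l - 1) * int ((?n - l) choose (i - l)) = 0" by simp
    qed
    then show ?thesis using T[of i] that Y(3) by simp
  qed
  \<comment> \<open>The minimum separator contributes a positive summand. No summand is negative,
    because a set of \<kappa> vertices never exhausts the graph.\<close>
  have pos: "?T (?\<kappa> + 1) > 0"
  proof (rule sum_pos2[of _ Y])
    fix Z :: "'v set" assume "Z \<in> {Y. card Y = ?\<kappa> + 1 - 1}"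
    then have "Z \<noteq> UNIV" using Y(3) by auto
    then show "0 \<le> int (num_components_minus G Z) - 1"
      using num_components_minus_pos[of Z G] by simp
  qed (use Y in auto)
  have a2: "a (?\<kappa> + 1) \<ge> 2" using pos T_small[of "?\<kappa> + 1"] by simp
  \<comment> \<open>A nonzero value of \<open>a\<close> forces its index into the range of the
    clique number, so \<open>b\<close> is determined on the whole range of the equality.\<close>
  then have \<kappa>d: "?\<kappa> + 1 \<le> ?d" using a(2)[of "?\<kappa> + 1"] by (metis not_le not_numeral_le_zero)
  show "b i = ?T i + 1" if "i \<in> {1..?\<kappa> + 1}"
    using T_small[OF that] a(1)[of i] that \<kappa>d by simp
  show "b i < ?T i + 1" if "i \<in> {?\<kappa> + 2..?d}"
  proof -
    \<comment> \<open>The term l = \<kappa> + 1 is positive: its first factor is at least 1, and its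
      binomial coefficient is nonzero because i <= d < n. The remaining terms are nonnegative, as
      a_l >= 1 for l up to d.\<close>
    have "(\<Sum>l = 1..<i. (a l - 1) * int ((?n - l) choose (i - l))) > 0"
    proof (rule sum_pos2[of _ "?\<kappa> + 1"])
      show "0 < (a (?\<kappa> + 1) - 1) * int (?n - (?\<kappa> + 1) choose (i - (?\<kappa> + 1)))"
        using a2 that dn by (intro mult_pos_pos) auto
      show "0 \<le> (a l - 1) * int ((?n - l) choose (i - l))" if "l \<in> {1..<i}" for l
        using a(1)[of l] that \<open>i \<in> {?\<kappa> + 2..?d}\<close> by (intro mult_nonneg_nonneg) auto
    qed (use that in auto)
    then show ?thesis using T[of i] a(1)[of i] that dn by simp
  qed
qed

section \<open>Uniqueness of the ranks of a minimal free resolution\<close>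

lemma mult_mat_unit_vec:
  fixes A :: "'a::semiring_1 mat"
  assumes "A \<in> carrier_mat r p" "j < p"
  shows "A *\<^sub>v unit_vec p j = col A j"
  using assms by (intro eq_vecI) (auto simp: row_def)

lemma zero_mult_mat_vec:
  "v \<in> carrier_vec p \<Longrightarrow> 0\<^sub>m r p *\<^sub>v v = 0\<^sub>v r"
  by (intro eq_vecI) auto

lemma mult_mat_vec_zero:
  "A \<in> carrier_mat r p \<Longrightarrow> A *\<^sub>v 0\<^sub>v p = 0\<^sub>v r"
  by (intro eq_vecI) (auto simp: carrier_vecI)

lemma eq_matI_mult_vec:
  fixes A B :: "'a::semiring_1 mat"
  assumes "A \<in> carrier_mat r p" "B \<in> carrier_mat r p"
    and "\<And>v. v \<in> carrier_vec p \<Longrightarrow> A *\<^sub>v v = B *\<^sub>v v"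
  shows "A = B"
proof (rule eq_matI)
  fix i j assume "i < dim_row B" "j < dim_col B"
  then have ij: "i < r" "j < p" using assms(2) by auto
  then have "col A j = col B j"
    using assms mult_mat_unit_vec by (metis unit_vec_carrier)
  then have "col A j $ i = col B j $ i" by simp
  then show "A $$ (i, j) = B $$ (i, j)" using ij assms(1,2) by auto
qed (use assms in auto)

lemma mat_image_carrier:
  assumes "A \<in> carrier_mat r q"
  shows "mat_image A = {A *\<^sub>v v | v. v \<in> carrier_vec q}"
  using assms by (auto simp: mat_image_def)

text \<open>A preimage is chosen for each column separately. The predicate \<open>P\<close> carries
  along a further property of the chosen columns, later their homogeneity.\<close>

lemma mat_image_factor_on:
  fixes A Z :: "'a::comm_ring_1 mat"
  assumes A: "A \<in> carrier_mat r q" and Z: "Z \<in> carrier_mat r p"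
    and P: "\<And>j. j < p \<Longrightarrow> \<exists>w\<in>carrier_vec q. col Z j = A *\<^sub>v w \<and> P j w"
  obtains X where "X \<in> carrier_mat q p" "A * X = Z" "\<And>j. j < p \<Longrightarrow> P j (col X j)"
proof -
  obtain f where f: "\<And>j. j < p \<Longrightarrow> f j \<in> carrier_vec q \<and> col Z j = A *\<^sub>v f j \<and> P j (f j)"
    using P by metis
  define X where "X = mat q p (\<lambda>(i, j). f j $ i)"
  have X: "X \<in> carrier_mat q p" by (simp add: X_def)
  have col: "col X j = f j" if "j < p" for j
    using f[OF that] that by (intro eq_vecI) (auto simp: X_def)
  have "A * X = Z"
  proof (rule eq_matI)
    fix i j assume "i < dim_row Z" "j < dim_col Z"
    then have ij: "i < r" "j < p" using Z by auto
    then have "(A * X) $$ (i, j) = (A *\<^sub>v f j) $ i" using A X col by auto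
    also have "\<dots> = col Z j $ i" using f[OF ij(2)] by simp
    finally show "(A * X) $$ (i, j) = Z $$ (i, j)" using ij Z by simp
  qed (use A X Z in auto)
  moreover have "P j (col X j)" if "j < p" for j
    using f[OF that] col[OF that] by simp
  ultimately show thesis using that X by blast
qed

lemma mat_image_factor:
  fixes A Z :: "'a::comm_ring_1 mat"
  assumes A: "A \<in> carrier_mat r q" and Z: "Z \<in> carrier_mat r p"
    and im: "\<And>w. w \<in> carrier_vec p \<Longrightarrow> Z *\<^sub>v w \<in> mat_image A"
  obtains X where "X \<in> carrier_mat q p" "A * X = Z"
proof -
  have "\<exists>w\<in>carrier_vec q. col Z j = A *\<^sub>v w \<and> True" if "j < p" for j
    using im[of "unit_vec p j"] mult_mat_unit_vec[OF Z that] mat_image_carrier[OF A] by auto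
  then show thesis using mat_image_factor_on[OF A Z, of "\<lambda>_ _. True"] that by metis
qed

section \<open>Free resolutions, chain maps and homotopies\<close>

definition is_ideal :: "'a::comm_ring_1 set \<Rightarrow> bool" where
  "is_ideal I \<longleftrightarrow> 0 \<in> I \<and> (\<forall>x\<in>I. \<forall>y\<in>I. x + y \<in> I) \<and> (\<forall>c. \<forall>x\<in>I. c * x \<in> I)"

lemma is_ideal_sum:
  assumes "is_ideal I" "\<And>i. i \<in> A \<Longrightarrow> f i \<in> I"
  shows "sum f A \<in> I"
  using assms(2) by (induction A rule: infinite_finite_induct) (use assms(1) in \<open>auto simp: is_ideal_def\<close>)

text \<open>\<open>minimal_free_resolution\<close> stripped of grading and minimality: lifting and
  homotopy arguments rest on exactness alone.\<close>

definition free_resolution ::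
  "'a::comm_ring_1 set \<Rightarrow> (nat \<Rightarrow> nat) \<Rightarrow> 'a vec \<Rightarrow> (nat \<Rightarrow> 'a mat) \<Rightarrow> bool" where
  "free_resolution I rk e \<phi> \<longleftrightarrow> e \<in> carrier_vec (rk 0) \<and>
     (\<forall>j. \<phi> j \<in> carrier_mat (rk j) (rk (Suc j))) \<and>
     (\<forall>f. \<exists>v \<in> carrier_vec (rk 0). f - e \<bullet> v \<in> I) \<and>
     {v \<in> carrier_vec (rk 0). e \<bullet> v \<in> I} = mat_image (\<phi> 0) \<and>
     (\<forall>j. mat_kernel (\<phi> j) = mat_image (\<phi> (Suc j)))"

lemma free_resolutionD:
  assumes "free_resolution I rk e \<phi>"
  shows "e \<in> carrier_vec (rk 0)" "\<phi> j \<in> carrier_mat (rk j) (rk (Suc j))"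
    "\<exists>v \<in> carrier_vec (rk 0). f - e \<bullet> v \<in> I"
    "v \<in> carrier_vec (rk 0) \<Longrightarrow> e \<bullet> v \<in> I \<longleftrightarrow> v \<in> mat_image (\<phi> 0)"
    "mat_image (\<phi> (Suc j)) = mat_kernel (\<phi> j)"
    "\<phi> j * \<phi> (Suc j) = 0\<^sub>m (rk j) (rk (Suc (Suc j)))"
proof -
  show c: "\<phi> j \<in> carrier_mat (rk j) (rk (Suc j))" for j
    using assms by (simp add: free_resolution_def)
  show "mat_image (\<phi> (Suc j)) = mat_kernel (\<phi> j)"
    using assms by (simp add: free_resolution_def)
  then have "\<phi> (Suc j) *\<^sub>v w \<in> mat_kernel (\<phi> j)" if "w \<in> carrier_vec (rk (Suc (Suc j)))" for w
    using that mat_image_carrier[OF c] by blast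
  then have "\<phi> j *\<^sub>v (\<phi> (Suc j) *\<^sub>v w) = 0\<^sub>v (rk j)" if "w \<in> carrier_vec (rk (Suc (Suc j)))" for w
    using that mat_kernelD[OF c] by blast
  then show "\<phi> j * \<phi> (Suc j) = 0\<^sub>m (rk j) (rk (Suc (Suc j)))"
    by (intro eq_matI_mult_vec[of _ "rk j" "rk (Suc (Suc j))"])
      (use c[of j] c[of "Suc j"] in \<open>auto simp: assoc_mult_mat_vec[OF c c]\<close>)
qed (use assms in \<open>auto simp: free_resolution_def\<close>)

text \<open>The identity of R/I is lifted step by step along the second resolution, using that the
  modules of the first are free. The augmentations take values in R/I, so compatibility in degree 0
  holds only modulo \<open>I\<close>.\<close>

lemma comparison_map:
  fixes I :: "'a::comm_ring_1 set"
  assumes I: "is_ideal I"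
    and F: "free_resolution I rk e \<phi>" and F': "free_resolution I rk' e' \<phi>'"
  obtains A where "\<And>j. A j \<in> carrier_mat (rk' j) (rk j)"
    and "\<And>v. v \<in> carrier_vec (rk 0) \<Longrightarrow> e' \<bullet> (A 0 *\<^sub>v v) - e \<bullet> v \<in> I"
    and "\<And>j. \<phi>' j * A (Suc j) = A j * \<phi> j"
proof -
  note c = free_resolutionD(2)[OF F] and c' = free_resolutionD(2)[OF F']
    and e = free_resolutionD(1)[OF F] and e' = free_resolutionD(1)[OF F']
  obtain w where w: "\<And>p. w p \<in> carrier_vec (rk' 0)" "\<And>p. e $ p - e' \<bullet> w p \<in> I"
  proof -
    have "\<forall>p. \<exists>v. v \<in> carrier_vec (rk' 0) \<and> e $ p - e' \<bullet> v \<in> I"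
      using free_resolutionD(3)[OF F'] by blast
    then show thesis using that by (elim choice[THEN exE]) blast
  qed
  define A0 where "A0 = mat (rk' 0) (rk 0) (\<lambda>(i, p). w p $ i)"
  have A0: "A0 \<in> carrier_mat (rk' 0) (rk 0)" by (simp add: A0_def)
  have col: "col A0 p = w p" if "p < rk 0" for p
    using w(1)[of p] that by (intro eq_vecI) (auto simp: A0_def)
  have aug: "e' \<bullet> (A0 *\<^sub>v v) - e \<bullet> v \<in> I" if v: "v \<in> carrier_vec (rk 0)" for v
  proof -
    have "e' \<bullet> (A0 *\<^sub>v v) = (\<Sum>p<rk 0. v $ p * (e' \<bullet> w p))"
    proof -
      have "e' \<bullet> (A0 *\<^sub>v v) = (\<Sum>i<rk' 0. \<Sum>p<rk 0. e' $ i * (w p $ i * v $ p))"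
        using v A0 by (simp add: scalar_prod_def A0_def sum_distrib_left atLeast0LessThan)
      also have "\<dots> = (\<Sum>p<rk 0. \<Sum>i<rk' 0. e' $ i * (w p $ i * v $ p))"
        by (rule sum.swap)
      also have "\<dots> = (\<Sum>p<rk 0. v $ p * (e' \<bullet> w p))"
        by (intro sum.cong) (simp_all add: scalar_prod_def sum_distrib_left atLeast0LessThan
          w(1)[THEN carrier_vecD] mult_ac)
      finally show ?thesis .
    qed
    moreover have "e \<bullet> v = (\<Sum>p<rk 0. v $ p * e $ p)"
      using v by (simp add: scalar_prod_def atLeast0LessThan mult.commute)
    ultimately have "e' \<bullet> (A0 *\<^sub>v v) - e \<bullet> v = (\<Sum>p<rk 0. - v $ p * (e $ p - e' \<bullet> w p))"
      by (simp add: sum_subtractf[symmetric] algebra_simps)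
    also have "\<dots> \<in> I"
    proof (rule is_ideal_sum[OF I])
      show "- v $ p * (e $ p - e' \<bullet> w p) \<in> I" for p
        using I w(2)[of p] unfolding is_ideal_def by blast
    qed
    finally show ?thesis .
  qed
  \<comment> \<open>The last conjunct is the invariant that makes the next lift possible:
    \<open>A\<close> carries the image of one differential into the image of the other.\<close>
  let ?P = "\<lambda>j A. A \<in> carrier_mat (rk' j) (rk j) \<and> (j = 0 \<longrightarrow> A = A0) \<and>
    (\<forall>u\<in>carrier_vec (rk (Suc j)). A *\<^sub>v (\<phi> j *\<^sub>v u) \<in> mat_image (\<phi>' j))"
  have "\<exists>A. \<forall>j. ?P j (A j) \<and> \<phi>' j * A (Suc j) = A j * \<phi> j"
  proof (rule dependent_nat_choice)
    have "A0 *\<^sub>v (\<phi> 0 *\<^sub>v u) \<in> mat_image (\<phi>' 0)" if u: "u \<in> carrier_vec (rk (Suc 0))" for u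
    proof -
      have v: "\<phi> 0 *\<^sub>v u \<in> carrier_vec (rk 0)" using c u by (metis mult_mat_vec_carrier)
      have "e \<bullet> (\<phi> 0 *\<^sub>v u) \<in> I"
        using free_resolutionD(4)[OF F v] u mat_image_carrier[OF c] by blast
      then have "e' \<bullet> (A0 *\<^sub>v (\<phi> 0 *\<^sub>v u)) \<in> I"
        using aug[OF v] I unfolding is_ideal_def by (metis diff_add_cancel)
      then show ?thesis
        using free_resolutionD(4)[OF F'] A0 v by (metis mult_mat_vec_carrier)
    qed
    then show "\<exists>A. ?P 0 A" using A0 by auto
  next
    fix A j assume A: "?P j A"
    have Z: "A * \<phi> j \<in> carrier_mat (rk' j) (rk (Suc j))" using A c by (metis mult_carrier_mat)
    obtain B where B: "B \<in> carrier_mat (rk' (Suc j)) (rk (Suc j))" "\<phi>' j * B = A * \<phi> j"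
    proof (rule mat_image_factor[OF c' Z])
      fix u :: "'a vec" assume "u \<in> carrier_vec (rk (Suc j))"
      then show "A * \<phi> j *\<^sub>v u \<in> mat_image (\<phi>' j)"
        using A assoc_mult_mat_vec[OF _ c] by metis
    qed
    have "B *\<^sub>v (\<phi> (Suc j) *\<^sub>v u) \<in> mat_image (\<phi>' (Suc j))"
      if u: "u \<in> carrier_vec (rk (Suc (Suc j)))" for u
      unfolding free_resolutionD(5)[OF F']
    proof (rule mat_kernelI[OF c'])
      have v: "\<phi> (Suc j) *\<^sub>v u \<in> carrier_vec (rk (Suc j))" using c u by (metis mult_mat_vec_carrier)
      then show "B *\<^sub>v (\<phi> (Suc j) *\<^sub>v u) \<in> carrier_vec (rk' (Suc j))"
        using B by (metis mult_mat_vec_carrier)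
      have "\<phi>' j *\<^sub>v (B *\<^sub>v (\<phi> (Suc j) *\<^sub>v u)) = A *\<^sub>v (\<phi> j *\<^sub>v (\<phi> (Suc j) *\<^sub>v u))"
        using A B c' c v by (metis assoc_mult_mat_vec)
      also have "\<phi> j *\<^sub>v (\<phi> (Suc j) *\<^sub>v u) = 0\<^sub>v (rk j)"
        using free_resolutionD(6)[OF F] c u by (metis assoc_mult_mat_vec zero_mult_mat_vec)
      also have "A *\<^sub>v 0\<^sub>v (rk j) = 0\<^sub>v (rk' j)"
        using A by (auto simp: mult_mat_vec_zero)
      finally show "\<phi>' j *\<^sub>v (B *\<^sub>v (\<phi> (Suc j) *\<^sub>v u)) = 0\<^sub>v (rk' j)" .
    qed
    then show "\<exists>B. ?P (Suc j) B \<and> \<phi>' j * B = A * \<phi> j" using B by auto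
  qed
  then obtain A where "\<And>j. ?P j (A j)" "\<And>j. \<phi>' j * A (Suc j) = A j * \<phi> j" by blast
  then show thesis using that[of A] aug by metis
qed

text \<open>A chain endomorphism inducing zero on R/I lands, in degree 0, in the image of
  \<open>\<phi> 0\<close>. From there on, the part not yet explained by the homotopy is a cycle,
  hence a boundary by exactness.\<close>

lemma null_homotopy:
  fixes C \<phi> :: "nat \<Rightarrow> 'a::comm_ring_1 mat" and I :: "'a set" and e :: "'a vec"
  assumes F: "free_resolution I rk e \<phi>"
    and C: "\<And>j. C j \<in> carrier_mat (rk j) (rk j)" "\<And>j. \<phi> j * C (Suc j) = C j * \<phi> j"
    and aug: "\<And>v. v \<in> carrier_vec (rk 0) \<Longrightarrow> e \<bullet> (C 0 *\<^sub>v v) \<in> I"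
  obtains h where "\<And>j. h j \<in> carrier_mat (rk (Suc j)) (rk j)" "C 0 = \<phi> 0 * h 0"
    "\<And>j. C (Suc j) = \<phi> (Suc j) * h (Suc j) + h j * \<phi> j"
proof -
  note c = free_resolutionD(2)[OF F]
  \<comment> \<open>The last conjunct says that \<open>C (Suc j) - h * \<phi> j\<close> is
    annihilated by \<open>\<phi> j\<close>, since \<open>C\<close> is a chain map; exactness then
    supplies the next \<open>h\<close>.\<close>
  let ?P = "\<lambda>j h. h \<in> carrier_mat (rk (Suc j)) (rk j) \<and> (j = 0 \<longrightarrow> C 0 = \<phi> 0 * h) \<and>
    \<phi> j * h * \<phi> j = C j * \<phi> j"
  have "\<exists>h. \<forall>j. ?P j (h j) \<and> C (Suc j) = \<phi> (Suc j) * h (Suc j) + h j * \<phi> j"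
  proof (rule dependent_nat_choice)
    obtain X where X: "X \<in> carrier_mat (rk (Suc 0)) (rk 0)" "\<phi> 0 * X = C 0"
    proof (rule mat_image_factor[OF c C(1)])
      fix v :: "'a vec" assume v: "v \<in> carrier_vec (rk 0)"
      then have "C 0 *\<^sub>v v \<in> carrier_vec (rk 0)" using C(1) by (metis mult_mat_vec_carrier)
      then show "C 0 *\<^sub>v v \<in> mat_image (\<phi> 0)"
        using free_resolutionD(4)[OF F] aug[OF v] by metis
    qed
    then show "\<exists>h. ?P 0 h" by auto
  next
    fix h j assume h: "?P j h"
    have hc: "h \<in> carrier_mat (rk (Suc j)) (rk j)" using h by blast
    have hp: "h * \<phi> j \<in> carrier_mat (rk (Suc j)) (rk (Suc j))" using hc c by (metis mult_carrier_mat)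
    have Z: "C (Suc j) - h * \<phi> j \<in> carrier_mat (rk (Suc j)) (rk (Suc j))"
      using hp by (metis minus_carrier_mat)
    have "\<phi> j * (C (Suc j) - h * \<phi> j) = \<phi> j * C (Suc j) - \<phi> j * (h * \<phi> j)"
      by (rule mult_minus_distrib_mat[OF c C(1) hp])
    also have "\<phi> j * (h * \<phi> j) = \<phi> j * h * \<phi> j"
      using assoc_mult_mat[OF c hc c] by simp
    also have "\<dots> = \<phi> j * C (Suc j)" using h C(2) by simp
    finally have zero: "\<phi> j * (C (Suc j) - h * \<phi> j) = 0\<^sub>m (rk j) (rk (Suc j))"
      using minus_r_inv_mat mult_carrier_mat[OF c C(1)] by metis
    obtain X where X: "X \<in> carrier_mat (rk (Suc (Suc j))) (rk (Suc j))"
      "\<phi> (Suc j) * X = C (Suc j) - h * \<phi> j"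
    proof (rule mat_image_factor[OF c Z])
      fix v :: "'a vec" assume v: "v \<in> carrier_vec (rk (Suc j))"
      show "(C (Suc j) - h * \<phi> j) *\<^sub>v v \<in> mat_image (\<phi> (Suc j))"
        unfolding free_resolutionD(5)[OF F]
      proof (rule mat_kernelI[OF c])
        show "(C (Suc j) - h * \<phi> j) *\<^sub>v v \<in> carrier_vec (rk (Suc j))"
          using Z v by (metis mult_mat_vec_carrier)
        show "\<phi> j *\<^sub>v ((C (Suc j) - h * \<phi> j) *\<^sub>v v) = 0\<^sub>v (rk j)"
          using zero v c Z by (metis assoc_mult_mat_vec zero_mult_mat_vec)
      qed
    qed
    have eq: "C (Suc j) = \<phi> (Suc j) * X + h * \<phi> j"
      unfolding X(2) using C(1)[of "Suc j"] hp by (intro eq_matI) auto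
    have "\<phi> (Suc j) * X * \<phi> (Suc j) = C (Suc j) * \<phi> (Suc j) - h * \<phi> j * \<phi> (Suc j)"
      unfolding X(2) by (rule minus_mult_distrib_mat[OF C(1) hp c])
    also have "h * \<phi> j * \<phi> (Suc j) = 0\<^sub>m (rk (Suc j)) (rk (Suc (Suc j)))"
      using assoc_mult_mat[OF hc c c] free_resolutionD(6)[OF F] right_mult_zero_mat[OF hc] by metis
    also have "C (Suc j) * \<phi> (Suc j) - 0\<^sub>m (rk (Suc j)) (rk (Suc (Suc j))) = C (Suc j) * \<phi> (Suc j)"
      using C(1)[of "Suc j"] c[of "Suc j"] by (intro eq_matI) auto
    finally show "\<exists>X. ?P (Suc j) X \<and> C (Suc j) = \<phi> (Suc j) * X + h * \<phi> j"
      using X(1) eq by auto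
  qed
  then obtain h where "\<And>j. ?P j (h j)" "\<And>j. C (Suc j) = \<phi> (Suc j) * h (Suc j) + h j * \<phi> j" by blast
  then show thesis using that[of h] by blast
qed

text \<open>If n > m, padding \<open>A\<close> with zero columns and \<open>B\<close> with zero rows
  makes both square without changing the product. Then the product in the other order is also the
  identity, but its row m is zero.\<close>

lemma left_inverse_dim_le:
  fixes A :: "'k::field mat"
  assumes A: "A \<in> carrier_mat n m" and B: "B \<in> carrier_mat m n" and AB: "A * B = 1\<^sub>m n"
  shows "n \<le> m"
proof (rule ccontr)
  assume "\<not> n \<le> m"
  then have n: "n = m + (n - m)" "0 < n - m" by auto
  define k where "k = n - m"
  let ?A = "four_block_mat A (0\<^sub>m n k) (0\<^sub>m 0 m) (0\<^sub>m 0 k)"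
    and ?B = "four_block_mat B (0\<^sub>m m 0) (0\<^sub>m k n) (0\<^sub>m k 0)"
  have dims: "?A \<in> carrier_mat n n" "?B \<in> carrier_mat n n"
    using A B n by (auto simp: k_def)
  have "?A * ?B = four_block_mat (A * B + 0\<^sub>m n k * 0\<^sub>m k n) (A * 0\<^sub>m m 0 + 0\<^sub>m n k * 0\<^sub>m k 0)
      (0\<^sub>m 0 m * B + 0\<^sub>m 0 k * 0\<^sub>m k n) (0\<^sub>m 0 m * 0\<^sub>m m 0 + 0\<^sub>m 0 k * 0\<^sub>m k 0)"
    by (rule mult_four_block_mat[OF A _ _ _ B]) auto
  also have "\<dots> = 1\<^sub>m n"
    using A B by (intro eq_matI) (auto simp: AB)
  finally have "?B * ?A = 1\<^sub>m n" by (rule mat_mult_left_right_inverse[OF dims])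
  then have "(?B * ?A) $$ (m, m) = 1" using n by simp
  moreover have "row ?B m = 0\<^sub>v n"
    using B n by (intro eq_vecI) (auto simp: k_def)
  moreover have "(?B * ?A) $$ (m, m) = row ?B m \<bullet> col ?A m"
    using A B n by (intro index_mult_mat(1)) (auto simp: k_def)
  moreover have "col ?A m \<in> carrier_vec n" using dims(1) by (rule col_carrier_vec[rotated]) (use n in simp)
  ultimately show False by simp
qed

text \<open>Comparison maps in both directions compose to a map homotopic to the identity. Applying
  \<open>ev\<close>, which kills the differentials of the minimal resolution, removes the homotopy
  and leaves a one-sided inverse over a field. Minimality of \<open>F\<close> gives one inequality;
  exchanging the roles of the two resolutions gives the other.\<close>

lemma minimal_resolution_ranks_unique:
  fixes ev :: "'a::comm_ring_1 \<Rightarrow> 'k::field"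
  assumes hom: "semiring_hom ev" and I: "is_ideal I"
    and F: "free_resolution I rk e \<phi>" and F': "free_resolution I rk' e' \<phi>'"
    and m: "\<And>j. map_mat ev (\<phi> j) = 0\<^sub>m (rk j) (rk (Suc j))"
  shows "rk j \<le> rk' j"
proof -
  interpret ev: semiring_hom ev by (rule hom)
  have map_add: "map_mat ev (M + N) = map_mat ev M + map_mat ev N"
    if "M \<in> carrier_mat p q" "N \<in> carrier_mat p q" for M N p q
    using that by (intro eq_matI) (auto simp: ev.hom_add)
  note c = free_resolutionD(2)[OF F] and c' = free_resolutionD(2)[OF F']
    and e = free_resolutionD(1)[OF F] and e' = free_resolutionD(1)[OF F']
  obtain A where A: "\<And>j. A j \<in> carrier_mat (rk' j) (rk j)"
      "\<And>v. v \<in> carrier_vec (rk 0) \<Longrightarrow> e' \<bullet> (A 0 *\<^sub>v v) - e \<bullet> v \<in> I"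
      "\<And>j. \<phi>' j * A (Suc j) = A j * \<phi> j"
    by (rule comparison_map[OF I F F']) blast
  obtain B where B: "\<And>j. B j \<in> carrier_mat (rk j) (rk' j)"
      "\<And>v. v \<in> carrier_vec (rk' 0) \<Longrightarrow> e \<bullet> (B 0 *\<^sub>v v) - e' \<bullet> v \<in> I"
      "\<And>j. \<phi> j * B (Suc j) = B j * \<phi>' j"
    by (rule comparison_map[OF I F' F]) blast
  define C where "C j = B j * A j - 1\<^sub>m (rk j)" for j
  have BA: "B j * A j \<in> carrier_mat (rk j) (rk j)" for j
    using A(1) B(1) by (metis mult_carrier_mat)
  have C: "C j \<in> carrier_mat (rk j) (rk j)" for j
    by (simp add: C_def minus_carrier_mat)
  have comm: "\<phi> j * C (Suc j) = C j * \<phi> j" for j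
  proof -
    have "\<phi> j * C (Suc j) = \<phi> j * (B (Suc j) * A (Suc j)) - \<phi> j * 1\<^sub>m (rk (Suc j))"
      unfolding C_def by (rule mult_minus_distrib_mat[OF c BA]) simp
    also have "\<phi> j * (B (Suc j) * A (Suc j)) = B j * A j * \<phi> j"
      by (simp only: assoc_mult_mat[OF c B(1) A(1), symmetric] B(3) assoc_mult_mat[OF B(1) c' A(1)] A(3)
          assoc_mult_mat[OF B(1) A(1) c])
    also have "\<phi> j * 1\<^sub>m (rk (Suc j)) = 1\<^sub>m (rk j) * \<phi> j"
      using c[of j] by simp
    also have "B j * A j * \<phi> j - 1\<^sub>m (rk j) * \<phi> j = C j * \<phi> j"
      unfolding C_def by (rule minus_mult_distrib_mat[OF BA _ c, symmetric]) simp
    finally show ?thesis .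
  qed
  have aug: "e \<bullet> (C 0 *\<^sub>v v) \<in> I" if v: "v \<in> carrier_vec (rk 0)" for v
  proof -
    have Av: "A 0 *\<^sub>v v \<in> carrier_vec (rk' 0)" using A(1) v by (metis mult_mat_vec_carrier)
    have BAv: "B 0 *\<^sub>v (A 0 *\<^sub>v v) \<in> carrier_vec (rk 0)" using B(1) Av by (metis mult_mat_vec_carrier)
    have "C 0 *\<^sub>v v = B 0 *\<^sub>v (A 0 *\<^sub>v v) - v"
      unfolding C_def using v minus_mult_distrib_mat_vec[OF BA _ v, of "1\<^sub>m (rk 0)"]
        assoc_mult_mat_vec[OF B(1) A(1) v] by simp
    then have "e \<bullet> (C 0 *\<^sub>v v) = (e \<bullet> (B 0 *\<^sub>v (A 0 *\<^sub>v v)) - e' \<bullet> (A 0 *\<^sub>v v)) +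
        (e' \<bullet> (A 0 *\<^sub>v v) - e \<bullet> v)"
      using scalar_prod_minus_distrib[OF e BAv v] by simp
    then show ?thesis
      using A(2)[OF v] B(2)[OF Av] I unfolding is_ideal_def by metis
  qed
  obtain h where h: "\<And>j. h j \<in> carrier_mat (rk (Suc j)) (rk j)" "C 0 = \<phi> 0 * h 0"
    "\<And>j. C (Suc j) = \<phi> (Suc j) * h (Suc j) + h j * \<phi> j"
    by (rule null_homotopy[OF F C comm aug]) (assumption | rule that)+
  have hc: "map_mat ev (h j) \<in> carrier_mat (rk (Suc j)) (rk j)" for j
    using h(1)[of j] by simp
  have l: "map_mat ev (\<phi> j * h j) = 0\<^sub>m (rk j) (rk j)" for j
    using left_mult_zero_mat[OF hc] by (simp add: ev.mat_hom_mult[OF c h(1)] m)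
  have r: "map_mat ev (h j * \<phi> j) = 0\<^sub>m (rk (Suc j)) (rk (Suc j))" for j
    using right_mult_zero_mat[OF hc] by (simp add: ev.mat_hom_mult[OF h(1) c] m)
  have zero: "map_mat ev (C j) = 0\<^sub>m (rk j) (rk j)"
  proof (cases j)
    case 0
    then show ?thesis using l[of 0] h(2) by simp
  next
    case (Suc i)
    have "map_mat ev (C j) = map_mat ev (\<phi> j * h j) + map_mat ev (h i * \<phi> i)"
      unfolding Suc h(3)
      by (rule map_add[OF mult_carrier_mat[OF c h(1)] mult_carrier_mat[OF h(1) c]])
    then show ?thesis using l r Suc by simp
  qed
  have "B j * A j = C j + 1\<^sub>m (rk j)"
    unfolding C_def using BA[of j] by (intro eq_matI) auto
  then have "map_mat ev (B j * A j) = map_mat ev (C j) + map_mat ev (1\<^sub>m (rk j))"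
    using map_add[OF C one_carrier_mat] by simp
  then have "map_mat ev (B j) * map_mat ev (A j) = 1\<^sub>m (rk j)"
    using zero by (simp add: ev.mat_hom_mult[OF B(1) A(1)] ev.mat_hom_one)
  then show ?thesis
    using A(1)[of j] B(1)[of j]
    by (intro left_inverse_dim_le[of "map_mat ev (B j)" _ _ "map_mat ev (A j)"]) auto
qed

section \<open>Monomial ideals and homogeneous components\<close>

lemma poly_mapping_sum_single:
  "f = (\<Sum>m\<in>Poly_Mapping.keys f. Poly_Mapping.single m (Poly_Mapping.lookup f m))"
proof (rule poly_mapping_eqI)
  fix k
  show "Poly_Mapping.lookup f k =
      Poly_Mapping.lookup (\<Sum>m\<in>Poly_Mapping.keys f. Poly_Mapping.single m (Poly_Mapping.lookup f m)) k"
    by (simp add: lookup_sum lookup_single when_def in_keys_iff)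
qed

lemma poly_mapping_single_induct [case_names zero single add]:
  fixes f :: "'a \<Rightarrow>\<^sub>0 'b::comm_monoid_add"
  assumes "P 0" "\<And>m c. P (Poly_Mapping.single m c)" "\<And>f g. P f \<Longrightarrow> P g \<Longrightarrow> P (f + g)"
  shows "P f"
proof -
  have "P (\<Sum>m\<in>A. Poly_Mapping.single m (Poly_Mapping.lookup f m))" for A
    by (induction A rule: infinite_finite_induct) (auto intro: assms)
  then show ?thesis by (subst poly_mapping_sum_single)
qed

lemma keys_times_subset:
  assumes "m \<in> Poly_Mapping.keys (f * g)"
  obtains a b where "m = a + b" "a \<in> Poly_Mapping.keys f" "b \<in> Poly_Mapping.keys g"
  using keys_mult[of f g] assms by blast

lemma lookup_single_times:
  fixes f :: "('v \<Rightarrow>\<^sub>0 nat) \<Rightarrow>\<^sub>0 'k::comm_ring_1"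
  shows "Poly_Mapping.lookup (Poly_Mapping.single m c * f) (m + k) = c * Poly_Mapping.lookup f k"
proof (induction f rule: poly_mapping_single_induct)
  case (single a d)
  then show ?case by (simp add: mult_single lookup_single when_def)
qed (simp_all add: distrib_left lookup_add)

lemma sum_nat_poly_mapping_eq_0:
  fixes a b :: "'v \<Rightarrow>\<^sub>0 nat"
  assumes "a + b = 0"
  shows "a = 0" "b = 0"
proof -
  have "Poly_Mapping.lookup a v + Poly_Mapping.lookup b v = 0" for v
    using assms by (metis lookup_add lookup_zero)
  then show "a = 0" "b = 0" by (auto intro!: poly_mapping_eqI)
qed

lemma const_coeff_mult:
  fixes f g :: "('v \<Rightarrow>\<^sub>0 nat) \<Rightarrow>\<^sub>0 'k::comm_ring_1"
  shows "Poly_Mapping.lookup (f * g) 0 = Poly_Mapping.lookup f 0 * Poly_Mapping.lookup g 0"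
proof (induction f rule: poly_mapping_single_induct)
  case (single m c)
  show ?case
  proof (cases "m = 0")
    case True
    then show ?thesis using lookup_single_times[of 0 c g 0] by simp
  next
    case False
    then have "0 \<notin> Poly_Mapping.keys (Poly_Mapping.single m c * g)"
      by (auto elim!: keys_times_subset split: if_splits dest!: sum_nat_poly_mapping_eq_0(1)[OF sym])
    then show ?thesis using False by (simp add: in_keys_iff lookup_single)
  qed
qed (simp_all add: distrib_right lookup_add)

text \<open>The constant coefficient is the residue map from R to R/\<open>max_ideal\<close> = K,
  and plays the part of \<open>ev\<close> in the comparison of ranks.\<close>

lemma semiring_hom_const_coeff:
  "semiring_hom (\<lambda>f :: ('v \<Rightarrow>\<^sub>0 nat) \<Rightarrow>\<^sub>0 'k::comm_ring_1. Poly_Mapping.lookup f 0)"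
  by unfold_locales (simp_all add: lookup_add const_coeff_mult)

section \<open>Ideals described by their monomials\<close>

lemma module_mult: "Modules.module ((*) :: 'a::comm_ring_1 \<Rightarrow> 'a \<Rightarrow> 'a)"
  by unfold_locales (simp_all add: algebra_simps)

lemma is_ideal_span: "is_ideal (ideal_gen S)"
  using Modules.module.span_zero[OF module_mult] Modules.module.span_add[OF module_mult]
    Modules.module.span_scale[OF module_mult] by (auto simp: is_ideal_def)

lemma is_idealD:
  assumes "is_ideal I"
  shows "0 \<in> I" "x \<in> I \<Longrightarrow> y \<in> I \<Longrightarrow> x + y \<in> I" "x \<in> I \<Longrightarrow> c * x \<in> I"
  using assms by (auto simp: is_ideal_def)

lemma ideal_gen_minimal:
  assumes "S \<subseteq> I" "is_ideal I"
  shows "ideal_gen S \<subseteq> I"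
  using assms by (intro Modules.module.span_minimal[OF module_mult])
    (auto simp: is_ideal_def Modules.module.subspace_def[OF module_mult])

text \<open>Membership is decided monomial by monomial. This is an ideal once \<open>Q\<close> is
  closed under multiplication of monomials; ideal sums and colons by a variable become statements
  about exponent vectors.\<close>

definition mon_ideal :: "(('v \<Rightarrow>\<^sub>0 nat) \<Rightarrow> bool) \<Rightarrow> ('v, 'k::field) mpoly set" where
  "mon_ideal Q = {f. \<forall>m\<in>Poly_Mapping.keys f. Q m}"

lemma mon_ideal_0: "0 \<in> mon_ideal Q"
  by (simp add: mon_ideal_def)

lemma mon_ideal_add: "f \<in> mon_ideal Q \<Longrightarrow> g \<in> mon_ideal Q \<Longrightarrow> f + g \<in> mon_ideal Q"
  using keys_add[of f g] by (auto simp: mon_ideal_def)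

lemma mon_ideal_mult:
  assumes "\<And>a m. Q m \<Longrightarrow> Q (a + m)" "f \<in> mon_ideal Q"
  shows "g * f \<in> mon_ideal Q"
  using assms by (auto simp: mon_ideal_def elim!: keys_times_subset)

lemma is_ideal_mon_ideal:
  assumes "\<And>a m. Q m \<Longrightarrow> Q (a + m)"
  shows "is_ideal (mon_ideal Q :: ('v, 'k::field) mpoly set)"
  unfolding is_ideal_def by (intro conjI ballI allI mon_ideal_0 mon_ideal_add mon_ideal_mult assms)

lemma mon_ideal_induct [consumes 1, case_names zero single add]:
  assumes "f \<in> mon_ideal Q"
    and "P 0" "\<And>m c. Q m \<Longrightarrow> P (Poly_Mapping.single m c)" "\<And>f g. P f \<Longrightarrow> P g \<Longrightarrow> P (f + g)"
  shows "P f"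
proof -
  have "P (\<Sum>m\<in>A. Poly_Mapping.single m (Poly_Mapping.lookup f m))" if "A \<subseteq> Poly_Mapping.keys f" for A
    using that by (induction A rule: infinite_finite_induct)
      (use assms in \<open>auto simp: mon_ideal_def\<close>)
  then show ?thesis by (subst poly_mapping_sum_single) blast
qed

lemma prod_Var: "(\<Prod>k\<in>A. Var k) =
    (Poly_Mapping.single (\<Sum>k\<in>A. Poly_Mapping.single k 1) 1 :: ('v, 'k::field) mpoly)"
  by (induction A rule: infinite_finite_induct) (simp_all add: Var_def mult_single)

lemma lookup_sum_single:
  fixes A :: "'v::finite set"
  shows "Poly_Mapping.lookup (\<Sum>k\<in>A. Poly_Mapping.single k (1::nat)) v = (if v \<in> A then 1 else 0)"
  by (simp add: lookup_sum lookup_single when_def)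

lemma nat_poly_mapping_split:
  fixes m m' :: "'v \<Rightarrow>\<^sub>0 nat"
  assumes "\<And>v. Poly_Mapping.lookup m' v \<le> Poly_Mapping.lookup m v"
  shows "m = (m - m') + m'"
  using assms by (intro poly_mapping_eqI) (simp add: lookup_add lookup_minus)

text \<open>Supersets of non-cliques are non-cliques, and a monomial is divisible by the squarefree
  one on its own support. The ideal belonging to a vertex subset is then obtained by intersecting
  the support with that subset.\<close>

lemma sr_ideal_eq:
  "sr_ideal G = (mon_ideal (\<lambda>m. \<not> clique G (Poly_Mapping.keys m)) :: ('v::finite, 'k::field) mpoly set)"
proof (intro equalityI subsetI)
  fix f :: "('v, 'k) mpoly" assume "f \<in> sr_ideal G"
  moreover have "sr_ideal G \<subseteq> (mon_ideal (\<lambda>m. \<not> clique G (Poly_Mapping.keys m)) :: ('v, 'k) mpoly set)"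
    unfolding sr_ideal_def
  proof (rule ideal_gen_minimal)
    have "Poly_Mapping.keys m \<subseteq> Poly_Mapping.keys (a + m)" for a m :: "'v \<Rightarrow>\<^sub>0 nat"
      by (auto simp: in_keys_iff lookup_add)
    then show "is_ideal (mon_ideal (\<lambda>m. \<not> clique G (Poly_Mapping.keys m)) :: ('v, 'k) mpoly set)"
      unfolding clique_def by (intro is_ideal_mon_ideal) blast
    have "Poly_Mapping.keys (\<Sum>k\<in>\<sigma>. Poly_Mapping.single k (1::nat)) = \<sigma>" for \<sigma> :: "'v set"
      by (intro equalityI subsetI) (simp_all add: in_keys_iff lookup_sum_single split: if_splits del: One_nat_def)
    then show "{\<Prod>k\<in>\<sigma>. Var k | \<sigma>. \<not> clique G \<sigma>} \<subseteq>
        (mon_ideal (\<lambda>m. \<not> clique G (Poly_Mapping.keys m)) :: ('v, 'k) mpoly set)"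
      by (auto simp: mon_ideal_def prod_Var)
  qed
  ultimately show "f \<in> mon_ideal (\<lambda>m. \<not> clique G (Poly_Mapping.keys m))" by blast
next
  fix f :: "('v, 'k) mpoly" assume "f \<in> mon_ideal (\<lambda>m. \<not> clique G (Poly_Mapping.keys m))"
  then show "f \<in> sr_ideal G"
  proof (induction rule: mon_ideal_induct)
    case (single m c)
    let ?s = "\<Sum>k\<in>Poly_Mapping.keys m. Poly_Mapping.single k (1::nat)"
    have "m = (m - ?s) + ?s"
      by (rule nat_poly_mapping_split, unfold lookup_sum_single in_keys_iff) (simp add: Suc_le_eq)
    then have "Poly_Mapping.single m c =
        (Poly_Mapping.single (m - ?s) c :: ('v, 'k) mpoly) * (\<Prod>k\<in>Poly_Mapping.keys m. Var k)"
      by (simp add: prod_Var mult_single)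
    moreover have "(\<Prod>k\<in>Poly_Mapping.keys m. Var k) \<in> (sr_ideal G :: ('v, 'k) mpoly set)"
      unfolding sr_ideal_def by (rule Modules.module.span_base[OF module_mult]) (use single in blast)
    ultimately show ?case by (simp only: sr_ideal_def is_idealD(3)[OF is_ideal_span])
  qed (simp_all only: sr_ideal_def is_idealD[OF is_ideal_span])
qed

lemma max_ideal_eq: "max_ideal = (mon_ideal (\<lambda>m. m \<noteq> 0) :: ('v, 'k::field) mpoly set)"
proof (intro equalityI subsetI)
  fix f :: "('v, 'k) mpoly" assume "f \<in> max_ideal"
  moreover have "max_ideal \<subseteq> (mon_ideal (\<lambda>m. m \<noteq> 0) :: ('v, 'k) mpoly set)"
    unfolding max_ideal_def
  proof (rule ideal_gen_minimal)
    show "is_ideal (mon_ideal (\<lambda>m. m \<noteq> 0) :: ('v, 'k) mpoly set)"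
      by (rule is_ideal_mon_ideal) (auto dest: sum_nat_poly_mapping_eq_0)
    show "range Var \<subseteq> (mon_ideal (\<lambda>m. m \<noteq> 0) :: ('v, 'k) mpoly set)"
      by (auto simp: mon_ideal_def Var_def) (metis lookup_single_eq lookup_zero nat.distinct(1))
  qed
  ultimately show "f \<in> mon_ideal (\<lambda>m. m \<noteq> 0)" by blast
next
  fix f :: "('v, 'k) mpoly" assume "f \<in> mon_ideal (\<lambda>m. m \<noteq> 0)"
  then show "f \<in> max_ideal"
  proof (induction rule: mon_ideal_induct)
    case (single m c)
    then obtain v where "Poly_Mapping.lookup m v \<noteq> 0"
      by (metis lookup_zero poly_mapping_eqI)
    then have "m = (m - Poly_Mapping.single v 1) + Poly_Mapping.single v 1"
      by (intro nat_poly_mapping_split) (auto simp: lookup_single when_def)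
    then have "Poly_Mapping.single m c =
        (Poly_Mapping.single (m - Poly_Mapping.single v 1) c :: ('v, 'k) mpoly) * Var v"
      by (simp add: Var_def mult_single)
    moreover have "Var v \<in> (max_ideal :: ('v, 'k) mpoly set)"
      unfolding max_ideal_def by (rule Modules.module.span_base[OF module_mult]) blast
    ultimately show ?case by (simp only: max_ideal_def is_idealD(3)[OF is_ideal_span])
  qed (simp_all only: max_ideal_def is_idealD[OF is_ideal_span])
qed

lemma keys_Var_times:
  "Poly_Mapping.keys (Var v * f) = (+) (Poly_Mapping.single v 1) ` Poly_Mapping.keys (f :: ('v, 'k::field) mpoly)"
proof (intro equalityI subsetI)
  fix m assume "m \<in> Poly_Mapping.keys (Var v * f)"
  then show "m \<in> (+) (Poly_Mapping.single v 1) ` Poly_Mapping.keys f"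
    by (auto simp: Var_def elim!: keys_times_subset split: if_splits)
next
  fix m assume "m \<in> (+) (Poly_Mapping.single v 1) ` Poly_Mapping.keys f"
  then show "m \<in> Poly_Mapping.keys (Var v * f)"
    by (auto simp: in_keys_iff Var_def lookup_single_times)
qed

lemma Var_times_eq_0: "Var v * f = 0 \<Longrightarrow> f = (0 :: ('v, 'k::field) mpoly)"
  using keys_Var_times[of v f] by simp

lemma Var_times_mon_ideal:
  assumes "Var v * f \<in> mon_ideal Q" "\<And>m. Q (Poly_Mapping.single v 1 + m) \<Longrightarrow> Q m"
  shows "f \<in> mon_ideal Q"
  using assms by (auto simp: mon_ideal_def keys_Var_times)

lemma mon_ideal_Var_decomposition:
  assumes up: "\<And>a m. Q a \<Longrightarrow> Q'' a" "\<And>a. Q' a \<Longrightarrow> Q'' (Poly_Mapping.single v 1 + a)"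
    and split: "\<And>m. Q'' m \<Longrightarrow> Q m \<or> Poly_Mapping.lookup m v \<noteq> 0 \<and> Q' (m - Poly_Mapping.single v 1)"
  shows "f \<in> mon_ideal Q'' \<longleftrightarrow>
    (\<exists>g\<in>mon_ideal Q. \<exists>p\<in>mon_ideal Q'. f = g + Var v * (p :: ('v, 'k::field) mpoly))"
proof
  assume "f \<in> mon_ideal Q''"
  then show "\<exists>g\<in>mon_ideal Q. \<exists>p\<in>mon_ideal Q'. f = g + Var v * p"
  proof (induction rule: mon_ideal_induct)
    case zero
    show ?case using mon_ideal_0[of Q] mon_ideal_0[of Q'] by force
  next
    case (single m c)
    from split[OF single] show ?case
    proof
      assume "Q m"
      then have "Poly_Mapping.single m c \<in> mon_ideal Q" by (simp add: mon_ideal_def)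
      then show ?thesis using mon_ideal_0[of Q'] by force
    next
      let ?m = "m - Poly_Mapping.single v 1"
      assume m: "Poly_Mapping.lookup m v \<noteq> 0 \<and> Q' ?m"
      then have "m = ?m + Poly_Mapping.single v 1"
        by (intro nat_poly_mapping_split) (auto simp: lookup_single when_def)
      then have "Poly_Mapping.single m c = 0 + Var v * (Poly_Mapping.single ?m c :: ('v, 'k) mpoly)"
        by (simp add: Var_def mult_single add.commute)
      moreover have "Poly_Mapping.single ?m c \<in> mon_ideal Q'" using m by (simp add: mon_ideal_def)
      ultimately show ?thesis using mon_ideal_0[of Q] by blast
    qed
  next
    case (add f f')
    then obtain g p g' p' where "g \<in> mon_ideal Q" "p \<in> mon_ideal Q'" "f = g + Var v * p"
      "g' \<in> mon_ideal Q" "p' \<in> mon_ideal Q'" "f' = g' + Var v * p'" by blast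
    then have "g + g' \<in> mon_ideal Q" "p + p' \<in> mon_ideal Q'" "f + f' = (g + g') + Var v * (p + p')"
      by (simp_all add: mon_ideal_add algebra_simps)
    then show ?case by blast
  qed
next
  assume "\<exists>g\<in>mon_ideal Q. \<exists>p\<in>mon_ideal Q'. f = g + Var v * p"
  then obtain g p where gp: "g \<in> mon_ideal Q" "p \<in> mon_ideal Q'" "f = g + Var v * p" by blast
  have "g \<in> mon_ideal Q''" "Var v * p \<in> mon_ideal Q''"
    using gp up by (auto simp: mon_ideal_def keys_Var_times)
  then show "f \<in> mon_ideal Q''" unfolding gp(3) by (rule mon_ideal_add)
qed

section \<open>Total degree and homogeneous components\<close>

definition tdeg :: "('v::finite \<Rightarrow>\<^sub>0 nat) \<Rightarrow> int" where
  "tdeg m = int (\<Sum>v\<in>UNIV. Poly_Mapping.lookup m v)"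

lemma tdeg_add: "tdeg (a + b) = tdeg a + tdeg b"
  by (simp add: tdeg_def lookup_add sum.distrib)

lemma homogeneous_iff: "homogeneous_of_deg t f \<longleftrightarrow> (\<forall>m\<in>Poly_Mapping.keys f. tdeg m = t)"
  by (simp add: homogeneous_of_deg_def tdeg_def)

lemma homogeneous_0: "homogeneous_of_deg t 0"
  by (simp add: homogeneous_iff)

lemma homogeneous_1: "homogeneous_of_deg 0 1"
  by (simp add: homogeneous_iff tdeg_def)

lemma homogeneous_Var: "homogeneous_of_deg 1 (Var v)"
  by (simp add: homogeneous_iff tdeg_def Var_def lookup_single when_def flip: of_nat_sum)

lemma homogeneous_add:
  "homogeneous_of_deg t f \<Longrightarrow> homogeneous_of_deg t g \<Longrightarrow> homogeneous_of_deg t (f + g)"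
  using keys_add[of f g] by (auto simp: homogeneous_iff)

lemma homogeneous_uminus: "homogeneous_of_deg t f \<Longrightarrow> homogeneous_of_deg t (- f)"
  by (simp add: homogeneous_iff in_keys_iff)

lemma homogeneous_mult:
  "homogeneous_of_deg s f \<Longrightarrow> homogeneous_of_deg t g \<Longrightarrow> homogeneous_of_deg (s + t) (f * g)"
  by (auto simp: homogeneous_iff tdeg_add elim!: keys_times_subset)

lemma homogeneous_sum:
  "(\<And>i. i \<in> A \<Longrightarrow> homogeneous_of_deg t (f i)) \<Longrightarrow> homogeneous_of_deg t (sum f A)"
  by (induction A rule: infinite_finite_induct) (auto simp: homogeneous_0 homogeneous_add)

definition hcomp :: "int \<Rightarrow> ('v::finite, 'k::field) mpoly \<Rightarrow> ('v, 'k) mpoly" where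
  "hcomp t f = Poly_Mapping.mapp (\<lambda>m c. if tdeg m = t then c else 0) f"

lemma lookup_hcomp:
  "Poly_Mapping.lookup (hcomp t f) m = (if tdeg m = t then Poly_Mapping.lookup f m else 0)"
  by (auto simp: hcomp_def lookup_mapp when_def in_keys_iff)

lemma hcomp_add: "hcomp t (f + g) = hcomp t f + hcomp t g"
  by (rule poly_mapping_eqI) (simp add: lookup_hcomp lookup_add)

lemma hcomp_0: "hcomp t 0 = 0"
  by (rule poly_mapping_eqI) (simp add: lookup_hcomp)

lemma hcomp_sum: "hcomp t (sum f A) = (\<Sum>i\<in>A. hcomp t (f i))"
  by (induction A rule: infinite_finite_induct) (simp_all add: hcomp_0 hcomp_add)

lemma homogeneous_hcomp: "homogeneous_of_deg t (hcomp t f)"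
  by (auto simp: homogeneous_iff in_keys_iff lookup_hcomp split: if_splits)

lemma hcomp_homogeneous:
  assumes "homogeneous_of_deg s f"
  shows "hcomp t f = (if s = t then f else 0)"
proof (rule poly_mapping_eqI)
  fix m
  show "Poly_Mapping.lookup (hcomp t f) m = Poly_Mapping.lookup (if s = t then f else 0) m"
    using assms by (cases "m \<in> Poly_Mapping.keys f")
      (auto simp: lookup_hcomp homogeneous_iff in_keys_iff)
qed

text \<open>Multiplication by a homogeneous element shifts degree components. Thus a homogeneous
  linear equation stays true when each unknown is replaced by its component of the right
  degree.\<close>

lemma hcomp_times:
  assumes "homogeneous_of_deg s c"
  shows "hcomp (s + t) (c * f) = c * hcomp t f"
proof (induction f rule: poly_mapping_single_induct)
  case (single m d)
  have h: "homogeneous_of_deg (tdeg m) (Poly_Mapping.single m d)" by (simp add: homogeneous_iff)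
  show ?case
    using hcomp_homogeneous[OF h, of t] hcomp_homogeneous[OF homogeneous_mult[OF assms h], of "s + t"]
    by simp
qed (simp_all add: hcomp_0 hcomp_add distrib_left)

section \<open>The mapping cone\<close>

text \<open>A resolution of R/J with F_0 = R and the quotient map as augmentation: the single row of
  \<open>M 0\<close> lists generators of \<open>J\<close>.\<close>

definition ideal_resolution ::
  "'a::comm_ring_1 set \<Rightarrow> (nat \<Rightarrow> nat) \<Rightarrow> (nat \<Rightarrow> 'a mat) \<Rightarrow> bool" where
  "ideal_resolution J q M \<longleftrightarrow> q 0 = 1 \<and> (\<forall>j. M j \<in> carrier_mat (q j) (q (Suc j))) \<and>
     mat_image (M 0) = {v \<in> carrier_vec 1. v $ 0 \<in> J} \<and>
     (\<forall>j. mat_kernel (M j) = mat_image (M (Suc j)))"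

lemma ideal_resolutionD:
  assumes "ideal_resolution J q M"
  shows "q 0 = 1" "M j \<in> carrier_mat (q j) (q (Suc j))"
    and "v \<in> carrier_vec (q 0) \<Longrightarrow> (\<exists>w\<in>carrier_vec (q (Suc 0)). v = M 0 *\<^sub>v w) \<longleftrightarrow> v $ 0 \<in> J"
    and "v \<in> carrier_vec (q (Suc j)) \<Longrightarrow>
      M j *\<^sub>v v = 0\<^sub>v (q j) \<longleftrightarrow> (\<exists>w\<in>carrier_vec (q (Suc (Suc j))). v = M (Suc j) *\<^sub>v w)"
proof -
  show q0: "q 0 = 1" and c: "M j \<in> carrier_mat (q j) (q (Suc j))" for j
    using assms by (simp_all add: ideal_resolution_def)
  show "(\<exists>w\<in>carrier_vec (q (Suc 0)). v = M 0 *\<^sub>v w) \<longleftrightarrow> v $ 0 \<in> J" if "v \<in> carrier_vec (q 0)"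
  proof -
    have "v \<in> mat_image (M 0) \<longleftrightarrow> v $ 0 \<in> J"
      using assms that q0 by (simp add: ideal_resolution_def)
    then show ?thesis unfolding mat_image_carrier[OF c] by blast
  qed
  show "M j *\<^sub>v v = 0\<^sub>v (q j) \<longleftrightarrow> (\<exists>w\<in>carrier_vec (q (Suc (Suc j))). v = M (Suc j) *\<^sub>v w)"
    if "v \<in> carrier_vec (q (Suc j))"
  proof -
    have "v \<in> mat_kernel (M j) \<longleftrightarrow> v \<in> mat_image (M (Suc j))"
      using assms by (simp add: ideal_resolution_def)
    then show ?thesis unfolding mat_image_carrier[OF c] mat_kernel[OF c] using that by blast
  qed
qed

lemma ideal_resolutionI:
  assumes "q 0 = 1" and c: "\<And>j. M j \<in> carrier_mat (q j) (q (Suc j))"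
    and "\<And>v. v \<in> carrier_vec (q 0) \<Longrightarrow> v $ 0 \<in> J \<Longrightarrow> \<exists>w\<in>carrier_vec (q (Suc 0)). v = M 0 *\<^sub>v w"
    and "\<And>w. w \<in> carrier_vec (q (Suc 0)) \<Longrightarrow> (M 0 *\<^sub>v w) $ 0 \<in> J"
    and "\<And>j v. v \<in> carrier_vec (q (Suc j)) \<Longrightarrow> M j *\<^sub>v v = 0\<^sub>v (q j) \<Longrightarrow>
      \<exists>w\<in>carrier_vec (q (Suc (Suc j))). v = M (Suc j) *\<^sub>v w"
    and "\<And>j w. w \<in> carrier_vec (q (Suc (Suc j))) \<Longrightarrow> M j *\<^sub>v (M (Suc j) *\<^sub>v w) = 0\<^sub>v (q j)"
  shows "ideal_resolution J q M"
  unfolding ideal_resolution_def mat_image_carrier[OF c] mat_kernel[OF c]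
proof (intro conjI allI equalityI subsetI)
  fix v assume "v \<in> {M 0 *\<^sub>v w |w. w \<in> carrier_vec (q (Suc 0))}"
  then show "v \<in> {v \<in> carrier_vec 1. v $ 0 \<in> J}"
    using assms(1,4) c[of 0] mult_mat_vec_carrier[OF c[of 0]] by auto
next
  fix v assume "v \<in> {v \<in> carrier_vec 1. v $ 0 \<in> J}"
  then show "v \<in> {M 0 *\<^sub>v w |w. w \<in> carrier_vec (q (Suc 0))}"
    using assms(1) assms(3)[of v] by auto
next
  fix j v assume "v \<in> {v. v \<in> carrier_vec (q (Suc j)) \<and> M j *\<^sub>v v = 0\<^sub>v (q j)}"
  then show "v \<in> {M (Suc j) *\<^sub>v w |w. w \<in> carrier_vec (q (Suc (Suc j)))}"
    using assms(5)[of v j] by auto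
next
  fix j v assume "v \<in> {M (Suc j) *\<^sub>v w |w. w \<in> carrier_vec (q (Suc (Suc j)))}"
  then show "v \<in> {v. v \<in> carrier_vec (q (Suc j)) \<and> M j *\<^sub>v v = 0\<^sub>v (q j)}"
    using assms(6) mult_mat_vec_carrier[OF c[of "Suc j"]] by auto
qed (use assms(1) c in auto)

lemma mult_mat_smult_vec:
  fixes A :: "'a::comm_ring_1 mat"
  assumes "A \<in> carrier_mat r p" "v \<in> carrier_vec p"
  shows "A *\<^sub>v (k \<cdot>\<^sub>v v) = k \<cdot>\<^sub>v (A *\<^sub>v v)"
  using assms by (intro eq_vecI) auto

lemma smult_mat_mult_vec:
  fixes A :: "'a::comm_ring_1 mat"
  assumes "A \<in> carrier_mat r p" "v \<in> carrier_vec p"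
  shows "(k \<cdot>\<^sub>m A) *\<^sub>v v = k \<cdot>\<^sub>v (A *\<^sub>v v)"
  using assms by (intro eq_vecI) auto

lemma mult_mat_uminus_vec:
  fixes A :: "'a::comm_ring_1 mat"
  assumes "A \<in> carrier_mat r p" "v \<in> carrier_vec p"
  shows "A *\<^sub>v (- v) = - (A *\<^sub>v v)"
  using assms by (intro eq_vecI) auto

lemma append_zero_vec: "0\<^sub>v n @\<^sub>v 0\<^sub>v m = (0\<^sub>v (n + m) :: 'a::zero vec)"
  by (intro eq_vecI) auto

lemma carrier_vec_append_cases:
  assumes "v \<in> carrier_vec (n + m)"
  obtains a b where "a \<in> carrier_vec n" "b \<in> carrier_vec m" "v = a @\<^sub>v b"
  using assms vec_first_last_append[OF assms] vec_first_carrier vec_last_carrier by metis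

lemma vec_minus_eq_0:
  fixes u :: "'a::ab_group_add vec"
  assumes "u \<in> carrier_vec n" "w \<in> carrier_vec n" "u - w = 0\<^sub>v n"
  shows "u = w"
proof (rule eq_vecI)
  fix i assume "i < dim_vec w"
  then have "(u - w) $ i = 0" using assms by auto
  then show "u $ i = w $ i" using \<open>i < dim_vec w\<close> by simp
qed (use assms in auto)

lemma vec_add_eq_0:
  fixes u :: "'a::ab_group_add vec"
  assumes "u \<in> carrier_vec n" "w \<in> carrier_vec n" "u + w = 0\<^sub>v n"
  shows "u = - w"
proof (rule eq_vecI)
  fix i assume "i < dim_vec (- w)"
  then have "(u + w) $ i = 0" using assms by auto
  then show "u $ i = (- w) $ i" using \<open>i < dim_vec (- w)\<close> by (simp add: eq_neg_iff_add_eq_0)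
qed (use assms in auto)

text \<open>The mapping cone of multiplication by \<open>x\<close> and a lift \<open>L\<close> of the inclusion \<open>I \<subseteq> P\<close>,
  without its unit part in degree 0.  A vector of the \<open>j\<close>-th free module splits as
  \<open>a @ b @ c\<close>, the last block being empty for \<open>j = 1\<close>.\<close>

definition cone_rank :: "(nat \<Rightarrow> nat) \<Rightarrow> (nat \<Rightarrow> nat) \<Rightarrow> nat \<Rightarrow> nat" where
  "cone_rank q s j = (if j = 0 then 1 else q j + (s j + (if j = 1 then 0 else q (j - 1))))"

text \<open>Multiplication by x gives the exact sequence 0 -> P/I -> R/I -> R/J -> 0, and P/I is
  resolved by the cone of \<open>L\<close>. In positive degrees the differential is (a, b, c) |-> (M
  a - x c, N b + L c, - M c). The unit \<open>L 0\<close> joins the rank one modules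
  \<open>q 0\<close> and \<open>s 0\<close> of that cone, which are cancelled; hence the empty
  blocks at the bottom.\<close>

definition cone_mat ::
  "'a::comm_ring_1 \<Rightarrow> (nat \<Rightarrow> nat) \<Rightarrow> (nat \<Rightarrow> nat) \<Rightarrow> (nat \<Rightarrow> 'a mat) \<Rightarrow> (nat \<Rightarrow> 'a mat) \<Rightarrow>
   (nat \<Rightarrow> 'a mat) \<Rightarrow> nat \<Rightarrow> 'a mat" where
  "cone_mat x q s M N L j = (case j of
     0 \<Rightarrow> four_block_mat (M 0) (x \<cdot>\<^sub>m N 0) (0\<^sub>m 0 (q 1)) (0\<^sub>m 0 (s 1))
   | Suc i \<Rightarrow>
       let k = (if i = 0 then 0 else q i) in
       four_block_mat (M j)
         (four_block_mat (0\<^sub>m (q j) (s (Suc j))) ((- x) \<cdot>\<^sub>m 1\<^sub>m (q j)) (0\<^sub>m 0 (s (Suc j))) (0\<^sub>m 0 (q j)))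
         (0\<^sub>m (s j + k) (q (Suc j)))
         (four_block_mat (N j) (L j) (0\<^sub>m k (s (Suc j))) (if i = 0 then 0\<^sub>m 0 (q j) else - M i)))"

context
  fixes x :: "'a::comm_ring_1" and q s :: "nat \<Rightarrow> nat" and M N L :: "nat \<Rightarrow> 'a mat"
  assumes q0: "q 0 = 1" and s0: "s 0 = 1"
    and M: "\<And>j. M j \<in> carrier_mat (q j) (q (Suc j))"
    and N: "\<And>j. N j \<in> carrier_mat (s j) (s (Suc j))"
    and L: "\<And>j. L j \<in> carrier_mat (s j) (q j)"
begin

lemma cone_mat_carrier: "cone_mat x q s M N L j \<in> carrier_mat (cone_rank q s j) (cone_rank q s (Suc j))"
proof (cases j)
  case 0
  have "four_block_mat (M 0) (x \<cdot>\<^sub>m N 0) (0\<^sub>m 0 (q 1)) (0\<^sub>m 0 (s 1)) \<in> carrier_mat (q 0 + 0) (q 1 + s 1)"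
    using M[of 0] by (intro four_block_carrier_mat) auto
  then show ?thesis using 0 by (simp add: cone_mat_def cone_rank_def q0)
next
  case (Suc i)
  have T: "(if i = 0 then 0\<^sub>m 0 (q j) else - M i) \<in> carrier_mat (if i = 0 then 0 else q i) (q j)"
    using M[of i] Suc by auto
  have "cone_mat x q s M N L j \<in>
      carrier_mat (q j + (s j + (if i = 0 then 0 else q i))) (q (Suc j) + (s (Suc j) + q j))"
    unfolding cone_mat_def Suc nat.case Let_def
    by (rule four_block_carrier_mat[OF M four_block_carrier_mat[OF N T[unfolded Suc]]])
  then show ?thesis using Suc by (cases "i = 0") (simp_all add: cone_rank_def)
qed

lemma cone_mat_0_mult:
  assumes a: "a \<in> carrier_vec (q (Suc 0))" and b: "b \<in> carrier_vec (s (Suc 0))"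
  shows "cone_mat x q s M N L 0 *\<^sub>v (a @\<^sub>v b) = M 0 *\<^sub>v a + x \<cdot>\<^sub>v (N 0 *\<^sub>v b)"
proof -
  have "cone_mat x q s M N L 0 *\<^sub>v (a @\<^sub>v b) =
      (M 0 *\<^sub>v a + (x \<cdot>\<^sub>m N 0) *\<^sub>v b) @\<^sub>v (0\<^sub>m 0 (q 1) *\<^sub>v a + 0\<^sub>m 0 (s 1) *\<^sub>v b)"
    unfolding cone_mat_def nat.case
    by (rule four_block_mat_mult_vec[OF M]) (use a b N[of 0] q0 s0 in auto)
  also have "\<dots> = M 0 *\<^sub>v a + x \<cdot>\<^sub>v (N 0 *\<^sub>v b)"
    unfolding smult_mat_mult_vec[OF N b] by (intro eq_vecI) auto
  finally show ?thesis .
qed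

lemma cone_mat_Suc_mult:
  assumes a: "a \<in> carrier_vec (q (Suc (Suc i)))" and b: "b \<in> carrier_vec (s (Suc (Suc i)))"
    and c: "c \<in> carrier_vec (q (Suc i))"
  shows "cone_mat x q s M N L (Suc i) *\<^sub>v (a @\<^sub>v (b @\<^sub>v c)) =
    (M (Suc i) *\<^sub>v a - x \<cdot>\<^sub>v c) @\<^sub>v
      ((N (Suc i) *\<^sub>v b + L (Suc i) *\<^sub>v c) @\<^sub>v (if i = 0 then 0\<^sub>v 0 else - (M i *\<^sub>v c)))"
proof -
  let ?j = "Suc i" and ?k = "if i = 0 then 0 else q i"
  let ?T = "if i = 0 then 0\<^sub>m 0 (q ?j) else - M i"
  let ?B = "four_block_mat (0\<^sub>m (q ?j) (s (Suc ?j))) ((- x) \<cdot>\<^sub>m 1\<^sub>m (q ?j)) (0\<^sub>m 0 (s (Suc ?j))) (0\<^sub>m 0 (q ?j))"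
  let ?D = "four_block_mat (N ?j) (L ?j) (0\<^sub>m ?k (s (Suc ?j))) ?T"
  have T: "?T \<in> carrier_mat ?k (q ?j)" using M[of i] by auto
  have bc: "b @\<^sub>v c \<in> carrier_vec (s (Suc ?j) + q ?j)" using b c by (rule append_carrier_vec)
  have B: "?B \<in> carrier_mat (q ?j) (s (Suc ?j) + q ?j)"
    using four_block_carrier_mat[of "0\<^sub>m (q ?j) (s (Suc ?j))" "q ?j" "s (Suc ?j)" "0\<^sub>m 0 (q ?j)" 0 "q ?j"]
    by simp
  have D: "?D \<in> carrier_mat (s ?j + ?k) (s (Suc ?j) + q ?j)"
    by (rule four_block_carrier_mat[OF N T])
  have Bbc: "?B *\<^sub>v (b @\<^sub>v c) = (- x) \<cdot>\<^sub>v c"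
  proof -
    have "?B *\<^sub>v (b @\<^sub>v c) = (0\<^sub>m (q ?j) (s (Suc ?j)) *\<^sub>v b + (- x) \<cdot>\<^sub>m 1\<^sub>m (q ?j) *\<^sub>v c) @\<^sub>v
        (0\<^sub>m 0 (s (Suc ?j)) *\<^sub>v b + 0\<^sub>m 0 (q ?j) *\<^sub>v c)"
      by (rule four_block_mat_mult_vec[OF _ _ _ _ b c]) auto
    also have "\<dots> = (- x) \<cdot>\<^sub>v c"
      unfolding smult_mat_mult_vec[OF one_carrier_mat c] zero_mult_mat_vec[OF b] zero_mult_mat_vec[OF c]
      using c by (intro eq_vecI) auto
    finally show ?thesis .
  qed
  have Tc: "?T *\<^sub>v c = (if i = 0 then 0\<^sub>v 0 else - (M i *\<^sub>v c))"
    using c M[of i] zero_mult_mat_vec[OF c, of 0] by auto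
  have Dbc: "?D *\<^sub>v (b @\<^sub>v c) = (N ?j *\<^sub>v b + L ?j *\<^sub>v c) @\<^sub>v (if i = 0 then 0\<^sub>v 0 else - (M i *\<^sub>v c))"
  proof -
    have "?D *\<^sub>v (b @\<^sub>v c) = (N ?j *\<^sub>v b + L ?j *\<^sub>v c) @\<^sub>v (0\<^sub>m ?k (s (Suc ?j)) *\<^sub>v b + ?T *\<^sub>v c)"
      by (rule four_block_mat_mult_vec[OF N L zero_carrier_mat T b c])
    also have "0\<^sub>m ?k (s (Suc ?j)) *\<^sub>v b + ?T *\<^sub>v c = ?T *\<^sub>v c"
      unfolding zero_mult_mat_vec[OF b]
      by (rule left_zero_vec) (rule mult_mat_vec_carrier[OF T c])
    finally show ?thesis unfolding Tc .
  qed
  have Z: "0\<^sub>m (s ?j + ?k) (q (Suc ?j)) *\<^sub>v a + ?D *\<^sub>v (b @\<^sub>v c) = ?D *\<^sub>v (b @\<^sub>v c)"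
    unfolding zero_mult_mat_vec[OF a] by (rule left_zero_vec) (rule mult_mat_vec_carrier[OF D bc])
  have "cone_mat x q s M N L (Suc i) *\<^sub>v (a @\<^sub>v (b @\<^sub>v c)) =
      (M ?j *\<^sub>v a + ?B *\<^sub>v (b @\<^sub>v c)) @\<^sub>v (0\<^sub>m (s ?j + ?k) (q (Suc ?j)) *\<^sub>v a + ?D *\<^sub>v (b @\<^sub>v c))"
    unfolding cone_mat_def nat.case Let_def
    by (rule four_block_mat_mult_vec[OF M B zero_carrier_mat D a bc])
  also have "M ?j *\<^sub>v a + ?B *\<^sub>v (b @\<^sub>v c) = M ?j *\<^sub>v a - x \<cdot>\<^sub>v c"
    unfolding Bbc using M[of ?j] a c by (intro eq_vecI) (auto simp del: index_mult_mat_vec)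
  finally show ?thesis unfolding Z unfolding Dbc .
qed

end

lemma cone_resolution:
  fixes x :: "'a::comm_ring_1"
  assumes I: "ideal_resolution I q M" and P: "ideal_resolution P s N"
    and L: "\<And>j. L j \<in> carrier_mat (s j) (q j)" "L 0 = 1\<^sub>m 1" "\<And>j. N j * L (Suc j) = L j * M j"
    and reg: "\<And>f. x * f = 0 \<Longrightarrow> f = 0" "\<And>f. x * f \<in> I \<Longrightarrow> f \<in> I"
    and J: "\<And>f. f \<in> J \<longleftrightarrow> (\<exists>g\<in>I. \<exists>p\<in>P. f = g + x * p)"
  shows "ideal_resolution J (cone_rank q s) (cone_mat x q s M N L)"
proof -
  note q0 = ideal_resolutionD(1)[OF I] and s0 = ideal_resolutionD(1)[OF P]
    and M = ideal_resolutionD(2)[OF I] and N = ideal_resolutionD(2)[OF P]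
  note Mv = mult_mat_vec_carrier[OF M] and Nv = mult_mat_vec_carrier[OF N]
    and Lv = mult_mat_vec_carrier[OF L(1)]
  note cone0 = cone_mat_0_mult[OF q0 s0 M N L(1), of _ _ x]
    and coneS = cone_mat_Suc_mult[OF q0 s0 M N L(1), of _ _ _ _ x]
  let ?D = "cone_mat x q s M N L" and ?r = "cone_rank q s"
  have MM: "M j *\<^sub>v (M (Suc j) *\<^sub>v v) = 0\<^sub>v (q j)" if "v \<in> carrier_vec (q (Suc (Suc j)))" for j v
    using ideal_resolutionD(4)[OF I Mv[OF that]] that by blast
  have NN: "N j *\<^sub>v (N (Suc j) *\<^sub>v v) = 0\<^sub>v (s j)" if "v \<in> carrier_vec (s (Suc (Suc j)))" for j v
    using ideal_resolutionD(4)[OF P Nv[OF that]] that by blast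
  have NL: "N j *\<^sub>v (L (Suc j) *\<^sub>v v) = L j *\<^sub>v (M j *\<^sub>v v)" if "v \<in> carrier_vec (q (Suc j))" for j v
    using that by (metis L(1,3) M N assoc_mult_mat_vec)
  have L0: "L 0 *\<^sub>v v = v" if "v \<in> carrier_vec (q 0)" for v
    using that q0 by (simp add: L(2))
  have x_cancel: "v = 0\<^sub>v n" if "v \<in> carrier_vec n" "x \<cdot>\<^sub>v v = 0\<^sub>v n" for v n
  proof (rule eq_vecI)
    fix i assume i: "i < dim_vec (0\<^sub>v n :: 'a vec)"
    then have "(x \<cdot>\<^sub>v v) $ i = 0" using that(2) by simp
    then show "v $ i = 0\<^sub>v n $ i" using i that(1) reg(1) by simp
  qed (use that in auto)
  have dims: "?r (Suc 0) = q (Suc 0) + s (Suc 0)"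
    "?r (Suc (Suc i)) = q (Suc (Suc i)) + (s (Suc (Suc i)) + q (Suc i))" for i
    by (simp_all add: cone_rank_def)
  show ?thesis
  proof (rule ideal_resolutionI)
    show "?r 0 = 1" by (simp add: cone_rank_def)
    show "?D j \<in> carrier_mat (?r j) (?r (Suc j))" for j
      by (rule cone_mat_carrier[OF q0 s0 M N L(1)])
  next
    fix v :: "'a vec" assume v: "v \<in> carrier_vec (?r 0)" "v $ 0 \<in> J"
    then obtain g p where gp: "g \<in> I" "p \<in> P" "v $ 0 = g + x * p" using J by blast
    obtain a where a: "a \<in> carrier_vec (q (Suc 0))" "vec (q 0) (\<lambda>_. g) = M 0 *\<^sub>v a"
      using ideal_resolutionD(3)[OF I, of "vec (q 0) (\<lambda>_. g)"] gp q0 by auto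
    obtain b where b: "b \<in> carrier_vec (s (Suc 0))" "vec (s 0) (\<lambda>_. p) = N 0 *\<^sub>v b"
      using ideal_resolutionD(3)[OF P, of "vec (s 0) (\<lambda>_. p)"] gp s0 by auto
    have "v = ?D 0 *\<^sub>v (a @\<^sub>v b)"
      unfolding cone0[OF a(1) b(1)] a(2)[symmetric] b(2)[symmetric]
      using v gp q0 s0 by (intro eq_vecI) (auto simp: cone_rank_def)
    moreover have "a @\<^sub>v b \<in> carrier_vec (?r (Suc 0))"
      unfolding dims by (rule append_carrier_vec[OF a(1) b(1)])
    ultimately show "\<exists>w\<in>carrier_vec (?r (Suc 0)). v = ?D 0 *\<^sub>v w" by blast
  next
    fix w :: "'a vec" assume "w \<in> carrier_vec (?r (Suc 0))"
    then obtain a b where ab: "a \<in> carrier_vec (q (Suc 0))" "b \<in> carrier_vec (s (Suc 0))" "w = a @\<^sub>v b"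
      unfolding dims by (rule carrier_vec_append_cases)
    have "(M 0 *\<^sub>v a) $ 0 \<in> I" using ideal_resolutionD(3)[OF I Mv[OF ab(1)]] ab(1) by blast
    moreover have "(N 0 *\<^sub>v b) $ 0 \<in> P" using ideal_resolutionD(3)[OF P Nv[OF ab(2)]] ab(2) by blast
    moreover have "(?D 0 *\<^sub>v w) $ 0 = (M 0 *\<^sub>v a) $ 0 + x * (N 0 *\<^sub>v b) $ 0"
      unfolding ab(3) cone0[OF ab(1,2)]
      using M[of 0] N[of 0] q0 s0 by (simp del: index_mult_mat_vec)
    ultimately show "(?D 0 *\<^sub>v w) $ 0 \<in> J" unfolding J by blast
  next
    fix j and v :: "'a vec" assume v: "v \<in> carrier_vec (?r (Suc j))" "?D j *\<^sub>v v = 0\<^sub>v (?r j)"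
    show "\<exists>w\<in>carrier_vec (?r (Suc (Suc j))). v = ?D (Suc j) *\<^sub>v w"
    proof (cases j)
      case 0
      obtain a b where ab: "a \<in> carrier_vec (q (Suc 0))" "b \<in> carrier_vec (s (Suc 0))" "v = a @\<^sub>v b"
        using v(1) unfolding 0 dims by (rule carrier_vec_append_cases)
      have "?D 0 *\<^sub>v v = M 0 *\<^sub>v a + x \<cdot>\<^sub>v (N 0 *\<^sub>v b)" unfolding ab(3) by (rule cone0[OF ab(1,2)])
      then have sum0: "M 0 *\<^sub>v a + x \<cdot>\<^sub>v (N 0 *\<^sub>v b) = 0\<^sub>v (q 0)"
        using v(2) 0 q0 by (simp add: cone_rank_def)
      have xN: "x \<cdot>\<^sub>v (N 0 *\<^sub>v b) \<in> carrier_vec (q 0)" using Nv[OF ab(2)] q0 s0 by simp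
      have Ma: "M 0 *\<^sub>v a = - (x \<cdot>\<^sub>v (N 0 *\<^sub>v b))" by (rule vec_add_eq_0[OF Mv[OF ab(1)] xN sum0])
      then have "M 0 *\<^sub>v (- a) = x \<cdot>\<^sub>v (N 0 *\<^sub>v b)"
        by (simp add: mult_mat_uminus_vec[OF M ab(1)])
      moreover have "- a \<in> carrier_vec (q (Suc 0))" using ab(1) by simp
      ultimately have "(x \<cdot>\<^sub>v (N 0 *\<^sub>v b)) $ 0 \<in> I"
        using ideal_resolutionD(3)[OF I xN] by metis
      \<comment> \<open>The colon condition: x times this element lies in \<open>I\<close>, hence so
        does the element. Writing it as \<open>M 0 *\<^sub>v c\<close> provides the third block,
        which corrects \<open>b\<close> through \<open>L\<close> and \<open>a\<close> through
        x.\<close>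
      then have "(N 0 *\<^sub>v b) $ 0 \<in> I"
        using reg(2) N[of 0] s0 by (simp del: index_mult_mat_vec)
      moreover have Nb: "N 0 *\<^sub>v b \<in> carrier_vec (q 0)" using Nv[OF ab(2)] q0 s0 by simp
      ultimately obtain c where c: "c \<in> carrier_vec (q (Suc 0))" "N 0 *\<^sub>v b = M 0 *\<^sub>v c"
        using ideal_resolutionD(3)[OF I Nb] by blast
      have xc: "x \<cdot>\<^sub>v c \<in> carrier_vec (q (Suc 0))" using c(1) by simp
      have "M 0 *\<^sub>v (a + x \<cdot>\<^sub>v c) = 0\<^sub>v (q 0)"
        using sum0 by (simp add: mult_add_distrib_mat_vec[OF M ab(1) xc] mult_mat_smult_vec[OF M c(1)] c(2))
      moreover have "a + x \<cdot>\<^sub>v c \<in> carrier_vec (q (Suc 0))" using ab(1) xc by simp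
      ultimately obtain a' where a': "a' \<in> carrier_vec (q (Suc (Suc 0)))" "a + x \<cdot>\<^sub>v c = M (Suc 0) *\<^sub>v a'"
        using ideal_resolutionD(4)[OF I] by blast
      have Lc: "L (Suc 0) *\<^sub>v c \<in> carrier_vec (s (Suc 0))" by (rule Lv[OF c(1)])
      have "N 0 *\<^sub>v (b - L (Suc 0) *\<^sub>v c) = N 0 *\<^sub>v b - L 0 *\<^sub>v (M 0 *\<^sub>v c)"
        by (simp add: mult_minus_distrib_mat_vec[OF N ab(2) Lc] NL[OF c(1)])
      also have "\<dots> = 0\<^sub>v (s 0)"
        using Mv[OF c(1)] q0 s0 by (simp add: L0[OF Mv[OF c(1)]] c(2))
      finally have "N 0 *\<^sub>v (b - L (Suc 0) *\<^sub>v c) = 0\<^sub>v (s 0)" .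
      moreover have "b - L (Suc 0) *\<^sub>v c \<in> carrier_vec (s (Suc 0))" using ab(2) Lc by simp
      ultimately obtain b' where b': "b' \<in> carrier_vec (s (Suc (Suc 0)))"
          "b - L (Suc 0) *\<^sub>v c = N (Suc 0) *\<^sub>v b'"
        using ideal_resolutionD(4)[OF P] by blast
      have "a = M (Suc 0) *\<^sub>v a' - x \<cdot>\<^sub>v c"
        unfolding a'(2)[symmetric] using ab(1) c(1) by (intro eq_vecI) auto
      moreover have "b = N (Suc 0) *\<^sub>v b' + L (Suc 0) *\<^sub>v c"
        unfolding b'(2)[symmetric] using ab(2) L(1)[of "Suc 0"]
        by (intro eq_vecI) (auto simp del: index_mult_mat_vec)
      moreover have "u @\<^sub>v 0\<^sub>v 0 = u" for u :: "'a vec" by (intro eq_vecI) auto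
      ultimately have "v = ?D (Suc 0) *\<^sub>v (a' @\<^sub>v (b' @\<^sub>v c))"
        unfolding coneS[OF a'(1) b'(1) c(1)] ab(3) by simp
      moreover have "a' @\<^sub>v (b' @\<^sub>v c) \<in> carrier_vec (?r (Suc (Suc 0)))"
        unfolding dims by (intro append_carrier_vec a' b' c)
      ultimately show ?thesis unfolding 0 by blast
    next
      case (Suc i)
      obtain a b c where abc: "a \<in> carrier_vec (q (Suc (Suc i)))" "b \<in> carrier_vec (s (Suc (Suc i)))"
          "c \<in> carrier_vec (q (Suc i))" "v = a @\<^sub>v (b @\<^sub>v c)"
        using v(1) unfolding Suc dims by (metis carrier_vec_append_cases)
      have xc: "x \<cdot>\<^sub>v c \<in> carrier_vec (q (Suc i))" using abc(3) by simp
      let ?k = "if i = 0 then 0 else q i"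
      have r: "?r (Suc i) = q (Suc i) + (s (Suc i) + ?k)" by (simp add: cone_rank_def)
      have "(M (Suc i) *\<^sub>v a - x \<cdot>\<^sub>v c) @\<^sub>v
          ((N (Suc i) *\<^sub>v b + L (Suc i) *\<^sub>v c) @\<^sub>v (if i = 0 then 0\<^sub>v 0 else - (M i *\<^sub>v c))) =
          0\<^sub>v (q (Suc i)) @\<^sub>v (0\<^sub>v (s (Suc i)) @\<^sub>v 0\<^sub>v ?k)"
        using v(2) coneS[OF abc(1-3)] by (simp only: Suc abc(4) r append_zero_vec)
      moreover have "M (Suc i) *\<^sub>v a - x \<cdot>\<^sub>v c \<in> carrier_vec (q (Suc i))"
        "N (Suc i) *\<^sub>v b + L (Suc i) *\<^sub>v c \<in> carrier_vec (s (Suc i))"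
        using xc Mv[OF abc(1)] Nv[OF abc(2)] Lv[OF abc(3)] by simp_all
      ultimately have "M (Suc i) *\<^sub>v a - x \<cdot>\<^sub>v c = 0\<^sub>v (q (Suc i))"
        and Nb: "N (Suc i) *\<^sub>v b + L (Suc i) *\<^sub>v c = 0\<^sub>v (s (Suc i))"
        by (metis append_vec_eq zero_carrier_vec)+
      then have Ma: "M (Suc i) *\<^sub>v a = x \<cdot>\<^sub>v c"
        using vec_minus_eq_0[OF Mv[OF abc(1)] xc] by blast
      \<comment> \<open>Applying \<open>M i\<close> to M a = x c annihilates the left side; as x is
        a nonzerodivisor, c is a cycle and therefore a boundary.\<close>
      have "x \<cdot>\<^sub>v (M i *\<^sub>v c) = 0\<^sub>v (q i)"
        using MM[OF abc(1)] by (simp add: mult_mat_smult_vec[OF M abc(3), symmetric] Ma)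
      then have "M i *\<^sub>v c = 0\<^sub>v (q i)" by (rule x_cancel[OF Mv[OF abc(3)]])
      then obtain c' where c': "c' \<in> carrier_vec (q (Suc (Suc i)))" "c = M (Suc i) *\<^sub>v c'"
        using ideal_resolutionD(4)[OF I abc(3)] by blast
      have xc': "x \<cdot>\<^sub>v c' \<in> carrier_vec (q (Suc (Suc i)))" using c'(1) by simp
      have "M (Suc i) *\<^sub>v (a - x \<cdot>\<^sub>v c') = x \<cdot>\<^sub>v c - x \<cdot>\<^sub>v c"
        by (simp add: mult_minus_distrib_mat_vec[OF M abc(1) xc'] mult_mat_smult_vec[OF M c'(1)]
            Ma c'(2)[symmetric])
      then have "M (Suc i) *\<^sub>v (a - x \<cdot>\<^sub>v c') = 0\<^sub>v (q (Suc i))" using xc by simp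
      moreover have "a - x \<cdot>\<^sub>v c' \<in> carrier_vec (q (Suc (Suc i)))" using abc(1) xc' by simp
      ultimately obtain a' where a': "a' \<in> carrier_vec (q (Suc (Suc (Suc i))))"
          "a - x \<cdot>\<^sub>v c' = M (Suc (Suc i)) *\<^sub>v a'"
        using ideal_resolutionD(4)[OF I] by blast
      have Lc': "L (Suc (Suc i)) *\<^sub>v c' \<in> carrier_vec (s (Suc (Suc i)))" by (rule Lv[OF c'(1)])
      have "N (Suc i) *\<^sub>v (b + L (Suc (Suc i)) *\<^sub>v c') = 0\<^sub>v (s (Suc i))"
        using Nb by (simp add: mult_add_distrib_mat_vec[OF N abc(2) Lc'] NL[OF c'(1)] c'(2)[symmetric])
      moreover have "b + L (Suc (Suc i)) *\<^sub>v c' \<in> carrier_vec (s (Suc (Suc i)))" using abc(2) Lc' by simp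
      ultimately obtain b' where b': "b' \<in> carrier_vec (s (Suc (Suc (Suc i))))"
          "b + L (Suc (Suc i)) *\<^sub>v c' = N (Suc (Suc i)) *\<^sub>v b'"
        using ideal_resolutionD(4)[OF P] by blast
      \<comment> \<open>The last block of the differential is - M, so the preimage carries - c' in
        that place.\<close>
      have mc: "- c' \<in> carrier_vec (q (Suc (Suc i)))" using c'(1) by simp
      have "a = M (Suc (Suc i)) *\<^sub>v a' - x \<cdot>\<^sub>v (- c')"
        unfolding a'(2)[symmetric] using abc(1) c'(1) by (intro eq_vecI) auto
      moreover have "b = N (Suc (Suc i)) *\<^sub>v b' + L (Suc (Suc i)) *\<^sub>v (- c')"
        unfolding b'(2)[symmetric] mult_mat_uminus_vec[OF L(1) c'(1)]
        using abc(2) L(1)[of "Suc (Suc i)"] by (intro eq_vecI) (auto simp del: index_mult_mat_vec)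
      moreover have "c = - (M (Suc i) *\<^sub>v (- c'))"
        unfolding mult_mat_uminus_vec[OF M c'(1)] c'(2) by simp
      ultimately have "v = ?D (Suc (Suc i)) *\<^sub>v (a' @\<^sub>v (b' @\<^sub>v (- c')))"
        unfolding coneS[OF a'(1) b'(1) mc] abc(4) by simp
      moreover have "a' @\<^sub>v (b' @\<^sub>v (- c')) \<in> carrier_vec (?r (Suc (Suc (Suc i))))"
        unfolding dims by (intro append_carrier_vec a' b' mc)
      ultimately show ?thesis unfolding Suc by blast
    qed
  next
    fix j and w :: "'a vec" assume "w \<in> carrier_vec (?r (Suc (Suc j)))"
    then obtain a b c where abc: "a \<in> carrier_vec (q (Suc (Suc j)))" "b \<in> carrier_vec (s (Suc (Suc j)))"
        "c \<in> carrier_vec (q (Suc j))" "w = a @\<^sub>v (b @\<^sub>v c)"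
      unfolding dims by (metis carrier_vec_append_cases)
    have xc: "x \<cdot>\<^sub>v c \<in> carrier_vec (q (Suc j))" using abc(3) by simp
    let ?a = "M (Suc j) *\<^sub>v a - x \<cdot>\<^sub>v c" and ?b = "N (Suc j) *\<^sub>v b + L (Suc j) *\<^sub>v c"
    have a: "?a \<in> carrier_vec (q (Suc j))" and b: "?b \<in> carrier_vec (s (Suc j))"
      using xc Mv[OF abc(1)] Nv[OF abc(2)] Lv[OF abc(3)] by simp_all
    have Ma: "M j *\<^sub>v ?a = - (x \<cdot>\<^sub>v (M j *\<^sub>v c))"
      using MM[OF abc(1)] M[of j] by (simp add: mult_minus_distrib_mat_vec[OF M Mv[OF abc(1)] xc]
        mult_mat_smult_vec[OF M abc(3)]) (auto intro!: eq_vecI simp del: index_mult_mat_vec)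
    have Nb: "N j *\<^sub>v ?b = L j *\<^sub>v (M j *\<^sub>v c)"
      using NN[OF abc(2)] Lv[OF Mv[OF abc(3)]]
      by (simp add: mult_add_distrib_mat_vec[OF N Nv[OF abc(2)] Lv[OF abc(3)]] NL[OF abc(3)])
    show "?D j *\<^sub>v (?D (Suc j) *\<^sub>v w) = 0\<^sub>v (?r j)"
    proof (cases j)
      case 0
      have "u @\<^sub>v 0\<^sub>v 0 = u" for u :: "'a vec" by (intro eq_vecI) auto
      then have "?D (Suc 0) *\<^sub>v w = ?a @\<^sub>v ?b"
        using coneS[OF abc(1-3)] 0 by (simp add: abc(4))
      then have "?D 0 *\<^sub>v (?D (Suc 0) *\<^sub>v w) = M 0 *\<^sub>v ?a + x \<cdot>\<^sub>v (N 0 *\<^sub>v ?b)"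
        using cone0 a b 0 by simp
      also have "\<dots> = 0\<^sub>v (?r 0)"
        using Ma Nb 0 L0[OF Mv] abc(3) M[of 0] q0
        by (intro eq_vecI) (auto simp: cone_rank_def simp del: index_mult_mat_vec)
      finally show ?thesis using 0 by simp
    next
      case (Suc i)
      let ?c = "- (M (Suc i) *\<^sub>v c)"
      have c': "c \<in> carrier_vec (q (Suc (Suc i)))" using abc(3) Suc by simp
      have Mc: "M (Suc i) *\<^sub>v c \<in> carrier_vec (q (Suc i))" by (rule Mv[OF c'])
      then have c: "?c \<in> carrier_vec (q (Suc i))" by simp
      have "?D (Suc j) *\<^sub>v w = ?a @\<^sub>v (?b @\<^sub>v ?c)"
        using coneS[OF abc(1-3)] Suc by (simp add: abc(4))
      then have "?D j *\<^sub>v (?D (Suc j) *\<^sub>v w) = (M (Suc i) *\<^sub>v ?a - x \<cdot>\<^sub>v ?c) @\<^sub>v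
          ((N (Suc i) *\<^sub>v ?b + L (Suc i) *\<^sub>v ?c) @\<^sub>v (if i = 0 then 0\<^sub>v 0 else - (M i *\<^sub>v ?c)))"
        using coneS[of ?a i ?b ?c] a b c Suc by simp
      also have "M (Suc i) *\<^sub>v ?a - x \<cdot>\<^sub>v ?c = 0\<^sub>v (q (Suc i))"
        using Ma Mc M[of "Suc i"] unfolding Suc by (intro eq_vecI) (auto simp del: index_mult_mat_vec)
      also have "N (Suc i) *\<^sub>v ?b + L (Suc i) *\<^sub>v ?c = 0\<^sub>v (s (Suc i))"
        using Nb Lv[OF Mc] L(1)[of "Suc i"] unfolding Suc mult_mat_uminus_vec[OF L(1) Mc]
        by (intro eq_vecI) (auto simp del: index_mult_mat_vec)
      also have "M i *\<^sub>v ?c = 0\<^sub>v (q i)"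
        using MM[OF c'] by (simp add: mult_mat_uminus_vec[OF M Mc])
      also have "(if i = 0 then 0\<^sub>v 0 else - 0\<^sub>v (q i)) = (0\<^sub>v (if i = 0 then 0 else q i) :: 'a vec)"
        by simp
      finally show ?thesis
        using Suc unfolding append_zero_vec by (cases "i = 0") (simp_all add: cone_rank_def)
    qed
  qed
qed

section \<open>Linear resolutions\<close>

definition hom_mat :: "int \<Rightarrow> ('v::finite, 'k::field) mpoly mat \<Rightarrow> bool" where
  "hom_mat t A \<longleftrightarrow> (\<forall>i<dim_row A. \<forall>j<dim_col A. homogeneous_of_deg t (A $$ (i, j)))"

lemma hom_mat_four_block:
  assumes "A \<in> carrier_mat r1 c1" "B \<in> carrier_mat r1 c2" "C \<in> carrier_mat r2 c1" "D \<in> carrier_mat r2 c2"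
    and "hom_mat t A" "hom_mat t B" "hom_mat t C" "hom_mat t D"
  shows "hom_mat t (four_block_mat A B C D)"
  using assms by (auto simp: hom_mat_def)

lemma hom_mat_zero: "hom_mat t (0\<^sub>m r c)"
  by (simp add: hom_mat_def homogeneous_0)

lemma hom_mat_one: "hom_mat 0 (1\<^sub>m r)"
  by (simp add: hom_mat_def homogeneous_0 homogeneous_1)

lemma hom_mat_uminus: "hom_mat t A \<Longrightarrow> hom_mat t (- A)"
  by (simp add: hom_mat_def homogeneous_uminus)

lemma hom_mat_smult: "homogeneous_of_deg s x \<Longrightarrow> hom_mat t A \<Longrightarrow> hom_mat (s + t) (x \<cdot>\<^sub>m A)"
  by (simp add: hom_mat_def homogeneous_mult)

lemma hom_mat_mult:
  assumes "A \<in> carrier_mat r p" "B \<in> carrier_mat p c" "hom_mat s A" "hom_mat t B"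
  shows "hom_mat (s + t) (A * B)"
  using assms by (auto simp: hom_mat_def scalar_prod_def intro!: homogeneous_sum homogeneous_mult)

definition linear_resolution ::
  "('v::finite, 'k::field) mpoly set \<Rightarrow> int \<Rightarrow> (nat \<Rightarrow> nat) \<Rightarrow> (nat \<Rightarrow> ('v, 'k) mpoly mat) \<Rightarrow> bool" where
  "linear_resolution J t q M \<longleftrightarrow>
     ideal_resolution J q M \<and> hom_mat t (M 0) \<and> (\<forall>j. hom_mat 1 (M (Suc j)))"

text \<open>An arbitrary lift is truncated to the degree 1 components of its entries. It remains a
  lift, because \<open>A\<close> raises degrees by d and \<open>Z\<close> is homogeneous of degree d
  + 1.\<close>

lemma linear_lift:
  fixes A Z :: "('v::finite, 'k::field) mpoly mat"
  assumes A: "A \<in> carrier_mat r p" and Z: "Z \<in> carrier_mat r c"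
    and hom: "hom_mat d A" "hom_mat (d + 1) Z"
    and im: "\<And>w. w \<in> carrier_vec c \<Longrightarrow> Z *\<^sub>v w \<in> mat_image A"
  obtains X where "X \<in> carrier_mat p c" "A * X = Z" "hom_mat 1 X"
proof -
  have "\<exists>w\<in>carrier_vec p. col Z j = A *\<^sub>v w \<and> (\<forall>i<p. homogeneous_of_deg 1 (w $ i))" if j: "j < c" for j
  proof -
    obtain w where w: "w \<in> carrier_vec p" "col Z j = A *\<^sub>v w"
      using im[of "unit_vec c j"] mult_mat_unit_vec[OF Z j] mat_image_carrier[OF A] by auto
    define w' where "w' = vec p (\<lambda>i. hcomp 1 (w $ i))"
    have "col Z j = A *\<^sub>v w'"
    proof (rule eq_vecI)
      fix i assume "i < dim_vec (A *\<^sub>v w')"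
      then have i: "i < r" using A by simp
      have "Z $$ (i, j) = (A *\<^sub>v w) $ i" using Z i j by (simp flip: w(2))
      also have "\<dots> = (\<Sum>k<p. A $$ (i, k) * w $ k)"
        using A w(1) i by (auto simp: scalar_prod_def atLeast0LessThan)
      finally have Zij: "Z $$ (i, j) = (\<Sum>k<p. A $$ (i, k) * w $ k)" .
      have "homogeneous_of_deg (d + 1) (Z $$ (i, j))" using hom(2) Z i j by (auto simp: hom_mat_def)
      then have "Z $$ (i, j) = hcomp (d + 1) (Z $$ (i, j))" by (simp add: hcomp_homogeneous)
      also have "\<dots> = hcomp (d + 1) (\<Sum>k<p. A $$ (i, k) * w $ k)" unfolding Zij ..
      also have "\<dots> = (\<Sum>k<p. A $$ (i, k) * hcomp 1 (w $ k))"
        unfolding hcomp_sum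
      proof (rule sum.cong)
        fix k assume "k \<in> {..<p}"
        then have "homogeneous_of_deg d (A $$ (i, k))" using hom(1) A i by (auto simp: hom_mat_def)
        then show "hcomp (d + 1) (A $$ (i, k) * w $ k) = A $$ (i, k) * hcomp 1 (w $ k)"
          by (rule hcomp_times)
      qed simp
      also have "\<dots> = (A *\<^sub>v w') $ i"
        using A i by (auto simp: scalar_prod_def atLeast0LessThan w'_def)
      finally show "col Z j $ i = (A *\<^sub>v w') $ i" using Z i j by simp
    qed (use A Z in auto)
    moreover have "w' \<in> carrier_vec p" "\<forall>i<p. homogeneous_of_deg 1 (w' $ i)"
      by (simp_all add: w'_def homogeneous_hcomp)
    ultimately show ?thesis by blast
  qed
  from mat_image_factor_on[OF A Z this]
  obtain X where X: "X \<in> carrier_mat p c" "A * X = Z"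
    "\<And>j. j < c \<Longrightarrow> \<forall>i<p. homogeneous_of_deg 1 (col X j $ i)" by metis
  have "hom_mat 1 X"
    unfolding hom_mat_def
  proof (intro allI impI)
    fix i j assume "i < dim_row X" "j < dim_col X"
    then show "homogeneous_of_deg 1 (X $$ (i, j))" using X(1) X(3)[of j] by auto
  qed
  then show thesis using that X by blast
qed

text \<open>The generators of \<open>I\<close> lie one degree above those of \<open>P\<close>. This
  offset is what makes the lift of the inclusion linear in every positive homological
  degree.\<close>

lemma linear_chain_map:
  fixes I P :: "('v::finite, 'k::field) mpoly set"
  assumes I: "linear_resolution I (t + 1) q M" and P: "linear_resolution P t s N" and sub: "I \<subseteq> P"
  obtains L where "\<And>j. L j \<in> carrier_mat (s j) (q j)" "L 0 = 1\<^sub>m 1"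
    "\<And>j. N j * L (Suc j) = L j * M j" "\<And>j. hom_mat 1 (L (Suc j))"
proof -
  have IR: "ideal_resolution I q M" and PR: "ideal_resolution P s N"
    using I P by (auto simp: linear_resolution_def)
  note q0 = ideal_resolutionD(1)[OF IR] and s0 = ideal_resolutionD(1)[OF PR]
    and M = ideal_resolutionD(2)[OF IR] and N = ideal_resolutionD(2)[OF PR]
  note Mv = mult_mat_vec_carrier[OF M] and Nv = mult_mat_vec_carrier[OF N]
  let ?Q = "\<lambda>j L. L \<in> carrier_mat (s j) (q j) \<and> (if j = 0 then L = 1\<^sub>m 1 else hom_mat 1 L) \<and>
    (\<forall>u\<in>carrier_vec (q (Suc j)). L *\<^sub>v (M j *\<^sub>v u) \<in> mat_image (N j))"
  have "\<exists>L. \<forall>j. ?Q j (L j) \<and> N j * L (Suc j) = L j * M j"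
  proof (rule dependent_nat_choice)
    have "1\<^sub>m 1 *\<^sub>v (M 0 *\<^sub>v u) \<in> mat_image (N 0)" if u: "u \<in> carrier_vec (q (Suc 0))" for u
    proof -
      have c: "M 0 *\<^sub>v u \<in> carrier_vec (s 0)" using Mv[OF u] q0 s0 by simp
      have "(M 0 *\<^sub>v u) $ 0 \<in> P"
        using ideal_resolutionD(3)[OF IR Mv[OF u]] u sub by blast
      then have "M 0 *\<^sub>v u \<in> mat_image (N 0)"
        using ideal_resolutionD(3)[OF PR c] unfolding mat_image_carrier[OF N] by blast
      moreover have "1\<^sub>m 1 *\<^sub>v (M 0 *\<^sub>v u) = M 0 *\<^sub>v u" using c s0 by simp
      ultimately show ?thesis by simp
    qed
    then show "\<exists>L. ?Q 0 L" using q0 s0 by (intro exI[of _ "1\<^sub>m 1"]) simp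
  next
    fix L j assume L: "?Q j L"
    have Z: "L * M j \<in> carrier_mat (s j) (q (Suc j))" using L M by (metis mult_carrier_mat)
    \<comment> \<open>For j = 0 the degrees of \<open>N j\<close> and \<open>L * M j\<close> are t
      and t + 1, later they are 1 and 2. In both cases they differ by one, as the lift
      requires.\<close>
    obtain d where d: "hom_mat d (N j)" "hom_mat (d + 1) (L * M j)"
    proof (cases "j = 0")
      case True
      have "hom_mat (0 + (t + 1)) (L * M j)"
        using L I True by (intro hom_mat_mult[OF _ M]) (auto simp: linear_resolution_def hom_mat_one)
      then show thesis using that[of t] P True by (simp add: linear_resolution_def)
    next
      case False
      then obtain i where i: "j = Suc i" by (cases j) auto
      have "hom_mat (1 + 1) (L * M j)"
        using L I i by (intro hom_mat_mult[OF _ M]) (auto simp: linear_resolution_def)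
      then show thesis using that[of 1] P i by (simp add: linear_resolution_def)
    qed
    obtain X where X: "X \<in> carrier_mat (s (Suc j)) (q (Suc j))" "N j * X = L * M j" "hom_mat 1 X"
    proof (rule linear_lift[OF N Z d])
      fix u :: "('v, 'k) mpoly vec" assume "u \<in> carrier_vec (q (Suc j))"
      then show "L * M j *\<^sub>v u \<in> mat_image (N j)"
        using L assoc_mult_mat_vec[OF _ M] by metis
    qed
    have "X *\<^sub>v (M (Suc j) *\<^sub>v u) \<in> mat_image (N (Suc j))" if u: "u \<in> carrier_vec (q (Suc (Suc j)))" for u
    proof -
      have c: "X *\<^sub>v (M (Suc j) *\<^sub>v u) \<in> carrier_vec (s (Suc j))"
        by (rule mult_mat_vec_carrier[OF X(1) Mv[OF u]])
      have "N j *\<^sub>v (X *\<^sub>v (M (Suc j) *\<^sub>v u)) = L *\<^sub>v (M j *\<^sub>v (M (Suc j) *\<^sub>v u))"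
        using assoc_mult_mat_vec[OF N X(1) Mv[OF u]] assoc_mult_mat_vec[OF _ M Mv[OF u], of L "s j"] L X(2)
        by simp
      also have "M j *\<^sub>v (M (Suc j) *\<^sub>v u) = 0\<^sub>v (q j)"
        using ideal_resolutionD(4)[OF IR Mv[OF u]] u by blast
      also have "L *\<^sub>v 0\<^sub>v (q j) = 0\<^sub>v (s j)" using L by (auto simp: mult_mat_vec_zero)
      finally show ?thesis
        using ideal_resolutionD(4)[OF PR c] unfolding mat_image_carrier[OF N] by blast
    qed
    then show "\<exists>X. ?Q (Suc j) X \<and> N j * X = L * M j" using X by auto
  qed
  then obtain L where L: "\<And>j. ?Q j (L j)" "\<And>j. N j * L (Suc j) = L j * M j" by blast
  show thesis
  proof (rule that[of L])
    show "L j \<in> carrier_mat (s j) (q j)" for j using L(1)[of j] by blast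
    show "L 0 = 1\<^sub>m 1" using L(1)[of 0] by simp
    show "hom_mat 1 (L (Suc j))" for j using L(1)[of "Suc j"] by simp
  qed (rule L(2))
qed

text \<open>In the first row x_v raises the degree of the generators of \<open>P\<close> to that of
  \<open>I\<close>; every other block is zero or linear. So the cone is again a linear
  resolution.\<close>

lemma linear_cone_resolution:
  fixes I P J :: "('v::finite, 'k::field) mpoly set"
  assumes I: "linear_resolution I (t + 1) q M" and P: "linear_resolution P t s N" and sub: "I \<subseteq> P"
    and reg: "\<And>f. Var v * f \<in> I \<Longrightarrow> f \<in> I"
    and J: "\<And>f. f \<in> J \<longleftrightarrow> (\<exists>g\<in>I. \<exists>p\<in>P. f = g + Var v * p)"
  shows "\<exists>D. linear_resolution J (t + 1) (cone_rank q s) D"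
proof -
  have IR: "ideal_resolution I q M" and PR: "ideal_resolution P s N"
    using I P by (auto simp: linear_resolution_def)
  note q0 = ideal_resolutionD(1)[OF IR] and s0 = ideal_resolutionD(1)[OF PR]
    and M = ideal_resolutionD(2)[OF IR] and N = ideal_resolutionD(2)[OF PR]
  obtain L where L: "\<And>j. L j \<in> carrier_mat (s j) (q j)" "L 0 = 1\<^sub>m 1"
    "\<And>j. N j * L (Suc j) = L j * M j" "\<And>j. hom_mat 1 (L (Suc j))"
    by (rule linear_chain_map[OF I P sub]) blast
  let ?D = "cone_mat (Var v) q s M N L"
  have "ideal_resolution J (cone_rank q s) ?D"
    by (rule cone_resolution[OF IR PR L(1-3) Var_times_eq_0 reg J])
  moreover have "hom_mat (t + 1) (?D 0)"
  proof -
    have "hom_mat (1 + t) (Var v \<cdot>\<^sub>m N 0)"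
      using P by (intro hom_mat_smult homogeneous_Var) (simp add: linear_resolution_def)
    then have "hom_mat (t + 1) (Var v \<cdot>\<^sub>m N 0)" by (simp add: add.commute)
    then show ?thesis
      unfolding cone_mat_def nat.case using I N[of 0] q0 s0
      by (intro hom_mat_four_block[OF M]) (auto simp: linear_resolution_def hom_mat_zero)
  qed
  moreover have "hom_mat 1 (?D (Suc i))" for i
  proof -
    let ?k = "if i = 0 then 0 else q i"
    have "hom_mat (1 + 0) ((- Var v) \<cdot>\<^sub>m 1\<^sub>m (q (Suc i)) :: ('v, 'k) mpoly mat)"
      by (intro hom_mat_smult homogeneous_uminus homogeneous_Var hom_mat_one)
    then have B: "hom_mat 1 (four_block_mat (0\<^sub>m (q (Suc i)) (s (Suc (Suc i)))) ((- Var v) \<cdot>\<^sub>m 1\<^sub>m (q (Suc i)))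
        (0\<^sub>m 0 (s (Suc (Suc i)))) (0\<^sub>m 0 (q (Suc i))) :: ('v, 'k) mpoly mat)"
      by (intro hom_mat_four_block[of _ "q (Suc i)" "s (Suc (Suc i))" _ "q (Suc i)" _ 0]) (auto simp: hom_mat_zero)
    have T: "(if i = 0 then 0\<^sub>m 0 (q (Suc i)) else - M i) \<in> carrier_mat ?k (q (Suc i))"
      using M[of i] by auto
    have T1: "hom_mat 1 (if i = 0 then 0\<^sub>m 0 (q (Suc i)) else - M i)"
      using I by (cases i) (auto simp: linear_resolution_def hom_mat_zero hom_mat_uminus)
    have D: "hom_mat 1 (four_block_mat (N (Suc i)) (L (Suc i)) (0\<^sub>m ?k (s (Suc (Suc i))))
        (if i = 0 then 0\<^sub>m 0 (q (Suc i)) else - M i))"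
      using P L(4) T1 by (intro hom_mat_four_block[OF N L(1) zero_carrier_mat T]) (auto simp: linear_resolution_def hom_mat_zero)
    have Bc: "four_block_mat (0\<^sub>m (q (Suc i)) (s (Suc (Suc i)))) ((- Var v) \<cdot>\<^sub>m 1\<^sub>m (q (Suc i)))
        (0\<^sub>m 0 (s (Suc (Suc i)))) (0\<^sub>m 0 (q (Suc i))) \<in> carrier_mat (q (Suc i)) (s (Suc (Suc i)) + q (Suc i))"
      using four_block_carrier_mat[of "0\<^sub>m (q (Suc i)) (s (Suc (Suc i)))" "q (Suc i)" "s (Suc (Suc i))"
        "0\<^sub>m 0 (q (Suc i))" 0 "q (Suc i)"] by simp
    have M1: "hom_mat 1 (M (Suc i))" using I by (simp add: linear_resolution_def)
    show ?thesis
      unfolding cone_mat_def nat.case Let_def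
      by (rule hom_mat_four_block[OF M Bc zero_carrier_mat four_block_carrier_mat[OF N T] M1 B hom_mat_zero D])
  qed
  ultimately show ?thesis unfolding linear_resolution_def by blast
qed

lemma linear_resolution_zero_ideal:
  "linear_resolution {0 :: ('v::finite, 'k::field) mpoly} t (\<lambda>j. if j = 0 then 1 else 0)
     (\<lambda>j. 0\<^sub>m (if j = 0 then 1 else 0) 0)"
proof -
  have z: "v = w" if "v \<in> carrier_vec 0" "w \<in> carrier_vec 0" for v w :: "('v, 'k) mpoly vec"
    using that by (intro eq_vecI) auto
  have "ideal_resolution {0 :: ('v, 'k) mpoly} (\<lambda>j. if j = 0 then 1 else 0)
      (\<lambda>j. 0\<^sub>m (if j = 0 then 1 else 0) 0)"
  proof (rule ideal_resolutionI)
    fix v :: "('v, 'k) mpoly vec"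
    assume "v \<in> carrier_vec (if 0 = (0::nat) then 1 else 0)" "v $ 0 \<in> {0}"
    then have "v = 0\<^sub>m 1 0 *\<^sub>v 0\<^sub>v 0" by (intro eq_vecI) auto
    then show "\<exists>w\<in>carrier_vec (if Suc 0 = 0 then 1 else 0). v = 0\<^sub>m (if 0 = (0::nat) then 1 else 0) 0 *\<^sub>v w"
      by (intro bexI[of _ "0\<^sub>v 0"]) simp_all
  next
    fix j and v :: "('v, 'k) mpoly vec"
    assume v: "v \<in> carrier_vec (if Suc j = 0 then 1 else 0)"
    have "0\<^sub>m 0 0 *\<^sub>v 0\<^sub>v 0 \<in> (carrier_vec 0 :: ('v, 'k) mpoly vec set)"
      by (rule mult_mat_vec_carrier[OF zero_carrier_mat zero_carrier_vec])
    then have "v = 0\<^sub>m 0 0 *\<^sub>v 0\<^sub>v 0"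
      using v by (intro z) simp_all
    then show "\<exists>w\<in>carrier_vec (if Suc (Suc j) = 0 then 1 else 0).
        v = 0\<^sub>m (if Suc j = 0 then 1 else 0) 0 *\<^sub>v w"
      by (intro bexI[of _ "0\<^sub>v 0"]) simp_all
  qed (auto simp: zero_mult_mat_vec)
  then show ?thesis by (simp add: linear_resolution_def hom_mat_zero)
qed

text \<open>R/R = 0 is resolved by the identity of R, which is linear with t = 0 but not minimal. It
  serves as the \<open>P\<close> when a whole variable is adjoined to an ideal.\<close>

lemma linear_resolution_unit_ideal:
  "linear_resolution (UNIV :: ('v::finite, 'k::field) mpoly set) 0 (\<lambda>j. if j \<le> 1 then 1 else 0)
     (\<lambda>j. if j = 0 then 1\<^sub>m 1 else 0\<^sub>m (if j = 1 then 1 else 0) 0)"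
proof -
  have z: "v = w" if "v \<in> carrier_vec 0" "w \<in> carrier_vec 0" for v w :: "('v, 'k) mpoly vec"
    using that by (intro eq_vecI) auto
  let ?q = "\<lambda>j::nat. if j \<le> 1 then 1 else 0 :: nat"
  let ?M = "\<lambda>j::nat. if j = 0 then 1\<^sub>m 1 else 0\<^sub>m (if j = 1 then 1 else 0) 0 :: ('v, 'k) mpoly mat"
  have "ideal_resolution (UNIV :: ('v, 'k) mpoly set) ?q ?M"
  proof (rule ideal_resolutionI)
    fix v :: "('v, 'k) mpoly vec"
    assume "v \<in> carrier_vec (?q 0)"
    then show "\<exists>w\<in>carrier_vec (?q (Suc 0)). v = ?M 0 *\<^sub>v w"
      by (intro bexI[of _ v]) auto
  next
    fix j and v :: "('v, 'k) mpoly vec"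
    assume v: "v \<in> carrier_vec (?q (Suc j))" "?M j *\<^sub>v v = 0\<^sub>v (?q j)"
    have w: "0\<^sub>v 0 \<in> carrier_vec (?q (Suc (Suc j)))" by simp
    have "v = 0\<^sub>v (?q (Suc j))"
    proof (cases "j = 0")
      case True
      then show ?thesis using v by simp
    next
      case False
      then show ?thesis using v(1) by (intro eq_vecI) auto
    qed
    also have "\<dots> = ?M (Suc j) *\<^sub>v 0\<^sub>v 0" by (intro eq_vecI) auto
    finally show "\<exists>w\<in>carrier_vec (?q (Suc (Suc j))). v = ?M (Suc j) *\<^sub>v w" using w by blast
  next
    fix j and w :: "('v, 'k) mpoly vec"
    assume "w \<in> carrier_vec (?q (Suc (Suc j)))"
    then have "w \<in> carrier_vec 0" by simp
    then have "?M (Suc j) *\<^sub>v w = 0\<^sub>v (?q (Suc j))"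
      by (cases "j = 0") (simp_all add: zero_mult_mat_vec)
    then show "?M j *\<^sub>v (?M (Suc j) *\<^sub>v w) = 0\<^sub>v (?q j)"
      by (cases "j = 0") (auto intro!: eq_vecI)
  qed auto
  then show ?thesis by (simp add: linear_resolution_def hom_mat_zero hom_mat_one)
qed

text \<open>These are the Koszul ranks: adjoining the variable v is the cone step with P = R, and
  the ranks add up by Pascal's rule.\<close>

lemma linear_resolution_variables:
  fixes S :: "'v::finite set"
  shows "\<exists>M. linear_resolution (mon_ideal (\<lambda>m. Poly_Mapping.keys m \<inter> S \<noteq> {}) :: ('v, 'k::field) mpoly set)
     1 (\<lambda>j. card S choose j) M"
proof -
  have "finite S" by simp
  then show ?thesis
  proof (induction S rule: finite_induct)
    case empty
    have "(mon_ideal (\<lambda>m. Poly_Mapping.keys m \<inter> {} \<noteq> {}) :: ('v, 'k) mpoly set) = {0}"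
      by (auto simp: mon_ideal_def)
    moreover have "(\<lambda>j. card ({} :: 'v set) choose j) = (\<lambda>j. if j = 0 then 1 else 0)"
    proof
      show "card ({} :: 'v set) choose j = (if j = 0 then 1 else 0)" for j by (cases j) simp_all
    qed
    ultimately show ?case by (simp only:) (rule exI, rule linear_resolution_zero_ideal)
  next
    case (insert v S)
    let ?Q = "(\<lambda>S m. Poly_Mapping.keys m \<inter> S \<noteq> {}) :: 'v set \<Rightarrow> ('v \<Rightarrow>\<^sub>0 nat) \<Rightarrow> bool"
    obtain M where M: "linear_resolution (mon_ideal (?Q S) :: ('v, 'k) mpoly set) (0 + 1) (\<lambda>j. card S choose j) M"
      using insert.IH unfolding add_0 by blast
    have "\<exists>D. linear_resolution (mon_ideal (?Q (insert v S)) :: ('v, 'k) mpoly set) (0 + 1)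
        (cone_rank (\<lambda>j. card S choose j) (\<lambda>j. if j \<le> 1 then 1 else 0)) D"
    proof (rule linear_cone_resolution[OF M linear_resolution_unit_ideal subset_UNIV, of v])
      fix f :: "('v, 'k) mpoly" assume "Var v * f \<in> mon_ideal (?Q S)"
      then show "f \<in> mon_ideal (?Q S)"
        by (rule Var_times_mon_ideal)
          (use insert.hyps in \<open>auto simp: in_keys_iff lookup_add lookup_single when_def split: if_splits\<close>)
    next
      fix f :: "('v, 'k) mpoly"
      have "(UNIV :: ('v, 'k) mpoly set) = mon_ideal (\<lambda>_. True)" by (simp add: mon_ideal_def)
      moreover have "f \<in> mon_ideal (?Q (insert v S)) \<longleftrightarrow>
          (\<exists>g\<in>mon_ideal (?Q S). \<exists>p\<in>mon_ideal (\<lambda>_. True). f = g + Var v * p)"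
        by (rule mon_ideal_Var_decomposition) (auto simp: in_keys_iff lookup_add lookup_single)
      ultimately show "f \<in> mon_ideal (?Q (insert v S)) \<longleftrightarrow>
          (\<exists>g\<in>mon_ideal (?Q S). \<exists>p\<in>UNIV. f = g + Var v * p)" by simp
    qed
    moreover have "cone_rank (\<lambda>j. card S choose j) (\<lambda>j. if j \<le> 1 then 1 else 0) =
        (\<lambda>j. card (insert v S) choose j)"
    proof
      fix j
      show "cone_rank (\<lambda>j. card S choose j) (\<lambda>j. if j \<le> 1 then 1 else 0) j = card (insert v S) choose j"
        using insert.hyps by (cases j) (auto simp: cone_rank_def)
    qed
    ultimately show ?case by simp
  qed
qed

text \<open>Both ideals \<open>I \<subseteq> P\<close> of the cone step are visible here: for a simplicial vertex \<open>v\<close> every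
  non-edge of \<open>S\<close> has an end outside the neighbourhood of \<open>v\<close>, and the new non-edges join \<open>v\<close> to
  the vertices outside its neighbourhood.\<close>

lemma linear_resolution_chordal:
  fixes G :: "'v::finite rel"
  assumes G: "simple_graph G" "chordal G"
  shows "\<exists>q M. linear_resolution
      (mon_ideal (\<lambda>m. \<not> clique G (Poly_Mapping.keys m \<inter> S)) :: ('v, 'k::field) mpoly set) 2 q M \<and>
      (\<forall>j. int (q (Suc j)) = coeff (component_poly G S) (j + 2))"
  using G finite[of S]
proof (induction rule: chordal_elimination_induct)
  case empty
  have "(mon_ideal (\<lambda>m. \<not> clique G (Poly_Mapping.keys m \<inter> {})) :: ('v, 'k) mpoly set) = {0}"
    by (auto simp: mon_ideal_def clique_def)
  then show ?case
    using linear_resolution_zero_ideal[where 'v='v and 'k='k and t=2]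
    by (intro exI conjI) (auto simp: component_poly_empty one_pCons)
next
  case (insert v S)
  let ?Q = "(\<lambda>S m. \<not> clique G (Poly_Mapping.keys m \<inter> S)) :: 'v set \<Rightarrow> ('v \<Rightarrow>\<^sub>0 nat) \<Rightarrow> bool"
  let ?N = "{u \<in> S. (v, u) \<in> G}"
  let ?P = "(\<lambda>m. Poly_Mapping.keys m \<inter> (S - ?N) \<noteq> {}) :: ('v \<Rightarrow>\<^sub>0 nat) \<Rightarrow> bool"
  obtain q M where M: "linear_resolution (mon_ideal (?Q S) :: ('v, 'k) mpoly set) (1 + 1) q M"
    and q: "\<And>j. int (q (Suc j)) = coeff (component_poly G S) (j + 2)"
    using insert.IH by auto
  obtain N where N: "linear_resolution (mon_ideal ?P :: ('v, 'k) mpoly set) 1 (\<lambda>j. card (S - ?N) choose j) N"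
    using linear_resolution_variables by blast
  have sub: "?P m" if "?Q S m" for m
    using that insert.hyps(3) unfolding clique_def by blast
  have "\<exists>D. linear_resolution (mon_ideal (?Q (insert v S)) :: ('v, 'k) mpoly set) (1 + 1)
      (cone_rank q (\<lambda>j. card (S - ?N) choose j)) D"
  proof (rule linear_cone_resolution[OF M N, of v])
    show "mon_ideal (?Q S) \<subseteq> (mon_ideal ?P :: ('v, 'k) mpoly set)"
      using sub unfolding mon_ideal_def by blast
  next
    fix f :: "('v, 'k) mpoly" assume "Var v * f \<in> mon_ideal (?Q S)"
    then show "f \<in> mon_ideal (?Q S)"
    proof (rule Var_times_mon_ideal)
      fix m :: "'v \<Rightarrow>\<^sub>0 nat"
      have "Poly_Mapping.keys (Poly_Mapping.single v 1 + m) \<inter> S = Poly_Mapping.keys m \<inter> S"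
        using insert.hyps(2) by (auto simp: in_keys_iff lookup_add lookup_single when_def split: if_splits)
      then show "?Q S (Poly_Mapping.single v 1 + m) \<Longrightarrow> ?Q S m" by simp
    qed
  next
    have v_keys: "Poly_Mapping.keys (Poly_Mapping.single v 1 + a) = insert v (Poly_Mapping.keys a)"
      for a :: "'v \<Rightarrow>\<^sub>0 nat"
      by (auto simp: in_keys_iff lookup_add lookup_single when_def split: if_splits)
    have insert_iff: "?Q (insert v S) m \<longleftrightarrow> ?Q S m \<or> v \<in> Poly_Mapping.keys m \<and> ?P m" for m
    proof (cases "v \<in> Poly_Mapping.keys m")
      case True
      then have "Poly_Mapping.keys m \<inter> insert v S = insert v (Poly_Mapping.keys m \<inter> S)" by auto
      moreover have "v \<notin> Poly_Mapping.keys m \<inter> S" using insert.hyps(2) by auto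
      ultimately show ?thesis
        using True clique_insert_iff[OF G(1)] by auto
    next
      case False
      then have "Poly_Mapping.keys m \<inter> insert v S = Poly_Mapping.keys m \<inter> S" by auto
      then show ?thesis using False by simp
    qed
    fix f :: "('v, 'k) mpoly"
    show "f \<in> mon_ideal (?Q (insert v S)) \<longleftrightarrow>
        (\<exists>g\<in>mon_ideal (?Q S). \<exists>p\<in>mon_ideal ?P. f = g + Var v * p)"
    proof (rule mon_ideal_Var_decomposition)
      show "?Q (insert v S) m" if "?Q S m" for m using that insert_iff by blast
      show "?Q (insert v S) (Poly_Mapping.single v 1 + m)" if "?P m" for m
      proof -
        have "v \<in> Poly_Mapping.keys (Poly_Mapping.single v 1 + m)" "?P (Poly_Mapping.single v 1 + m)"
          using that unfolding v_keys by blast+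
        then show ?thesis using insert_iff by blast
      qed
      show "?Q S m \<or> Poly_Mapping.lookup m v \<noteq> 0 \<and> ?P (m - Poly_Mapping.single v 1)"
        if "?Q (insert v S) m" for m
      proof -
        have "Poly_Mapping.keys (m - Poly_Mapping.single v 1) \<inter> (S - ?N) = Poly_Mapping.keys m \<inter> (S - ?N)"
          using insert.hyps(2) by (auto simp: in_keys_iff lookup_minus lookup_single when_def split: if_splits)
        then show ?thesis using that unfolding insert_iff in_keys_iff by auto
      qed
    qed
  qed
  moreover have "int (cone_rank q (\<lambda>j. card (S - ?N) choose j) (Suc j)) =
      coeff (component_poly G (insert v S)) (j + 2)" for j
  proof -
    have card: "card (S - ?N) = card S - card ?N" by (rule card_Diff_subset) auto
    \<comment> \<open>Single vertices are connected. The vanishing coefficient accounts for the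
      missing shifted copy of \<open>I\<close> in homological degree 1.\<close>
    have "coeff (component_poly G S) 1 = 0"
    proof -
      have "num_components_minus G (- U) = 1" if U: "card U = 1" for U :: "'v set"
      proof -
        obtain u where "U = {u}" using U by (rule card_1_singletonE)
        then show ?thesis
          using num_components_insert_simplicial[OF G(1), of "{}" u]
          by (simp add: num_components_minus_UNIV clique_def)
      qed
      then show ?thesis unfolding coeff_component_poly by (intro sum.neutral) auto
    qed
    then have "int (if j = 0 then 0 else q j) = coeff (component_poly G S) (Suc j)"
      using q[of "j - 1"] by (cases j) auto
    then show ?thesis
      unfolding component_poly_insert[OF G(1) insert.hyps(1-3)] cone_rank_def card
      by (cases "j = 0") (simp_all add: q coeff_linear_one_power)
  qed
  ultimately show ?case unfolding one_add_one by blast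
qed

section \<open>Betti numbers\<close>

lemma minimal_free_resolution_imp_free:
  fixes I :: "('a::finite, 'b::field) mpoly set"
  assumes "minimal_free_resolution I rk sh e \<phi>"
  shows "free_resolution I rk e \<phi>"
    and "map_mat (\<lambda>f. Poly_Mapping.lookup f 0) (\<phi> j) = 0\<^sub>m (rk j) (rk (Suc j))"
proof -
  show "free_resolution I rk e \<phi>"
    using assms by (simp add: minimal_free_resolution_def free_resolution_def)
  have c: "\<phi> j \<in> carrier_mat (rk j) (rk (Suc j))"
    and m: "\<And>p r. p < rk j \<Longrightarrow> r < rk (Suc j) \<Longrightarrow> \<phi> j $$ (p, r) \<in> max_ideal"
    using assms by (simp_all add: minimal_free_resolution_def)
  show "map_mat (\<lambda>f. Poly_Mapping.lookup f 0) (\<phi> j) = 0\<^sub>m (rk j) (rk (Suc j))"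
  proof (rule eq_matI)
    fix p r assume "p < dim_row (0\<^sub>m (rk j) (rk (Suc j)))" "r < dim_col (0\<^sub>m (rk j) (rk (Suc j)))"
    then have pr: "p < rk j" "r < rk (Suc j)" by simp_all
    have "0 \<notin> Poly_Mapping.keys (\<phi> j $$ (p, r))"
      using m[OF pr] unfolding max_ideal_eq mon_ideal_def by blast
    then show "map_mat (\<lambda>f. Poly_Mapping.lookup f 0) (\<phi> j) $$ (p, r) = 0\<^sub>m (rk j) (rk (Suc j)) $$ (p, r)"
      using c pr by (simp add: in_keys_iff)
  qed (use c in simp_all)
qed

text \<open>Rank uniqueness, applied in both directions, gives the definite description its
  value.\<close>

lemma betti_eq:
  fixes I :: "('v::finite, 'k::field) mpoly set"
  assumes I: "is_ideal I" and F: "minimal_free_resolution I rk sh e \<phi>"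
  shows "betti I j = rk j"
  unfolding betti_def
proof (rule the_equality)
  show "\<exists>rk' sh e \<phi>. minimal_free_resolution I rk' sh e \<phi> \<and> rk' j = rk j" using F by blast
next
  fix r assume "\<exists>rk' sh e \<phi>. minimal_free_resolution I rk' sh e \<phi> \<and> rk' j = r"
  then obtain rk' sh' e' \<phi>' where F': "minimal_free_resolution I rk' sh' e' \<phi>'" "rk' j = r" by blast
  have "rk j \<le> rk' j" "rk' j \<le> rk j"
    by (rule minimal_resolution_ranks_unique[OF semiring_hom_const_coeff I];
        rule minimal_free_resolution_imp_free[OF F] minimal_free_resolution_imp_free[OF F'(1)])+
  then show "r = rk j" using F'(2) by simp
qed

text \<open>F_0 sits in degree 0 and F_j in degree t + j - 1 for j >= 1. The bound on t puts the
  entries of the first matrix, like the linear ones after it, into \<open>max_ideal\<close>.\<close>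

lemma linear_resolution_minimal:
  fixes J :: "('v::finite, 'k::field) mpoly set"
  assumes J: "is_ideal J" and M: "linear_resolution J t q M" and "t \<ge> 1"
  shows "minimal_free_resolution J q (\<lambda>j p. if j = 0 then 0 else t + int (j - 1)) (vec 1 (\<lambda>_. 1)) M"
proof -
  have R: "ideal_resolution J q M" using M by (simp add: linear_resolution_def)
  note q0 = ideal_resolutionD(1)[OF R] and c = ideal_resolutionD(2)[OF R]
  have e: "vec 1 (\<lambda>_. 1) \<bullet> v = v $ 0" if "v \<in> carrier_vec 1" for v :: "('v, 'k) mpoly vec"
    using that by (simp add: scalar_prod_def)
  have hom: "homogeneous_of_deg (if j = 0 then t else 1) (M j $$ (p, r))"
    if "p < q j" "r < q (Suc j)" for j p r
    using M c[of j] that by (cases j) (auto simp: linear_resolution_def hom_mat_def)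
  have max: "f \<in> max_ideal" if "homogeneous_of_deg s f" "s \<ge> 1" for s and f :: "('v, 'k) mpoly"
    using that by (auto simp: max_ideal_eq mon_ideal_def homogeneous_iff tdeg_def)
  show ?thesis
    unfolding minimal_free_resolution_def
  proof (intro conjI allI impI)
    fix f :: "('v, 'k) mpoly"
    have "f - vec 1 (\<lambda>_. 1) \<bullet> vec 1 (\<lambda>_. f) = 0" by (simp add: scalar_prod_def)
    then have "f - vec 1 (\<lambda>_. 1) \<bullet> vec 1 (\<lambda>_. f) \<in> J" using J by (simp only: is_ideal_def)
    then show "\<exists>v\<in>carrier_vec (q 0). f - vec 1 (\<lambda>_. 1) \<bullet> v \<in> J"
      using q0 by (intro bexI[of _ "vec 1 (\<lambda>_. f)"]) simp_all
  next
    show "{v \<in> carrier_vec (q 0). vec 1 (\<lambda>_. 1) \<bullet> v \<in> J} = mat_image (M 0)"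
      using R e q0 by (auto simp: ideal_resolution_def)
  next
    fix j p r assume pr: "p < q j" "r < q (Suc j)"
    show "homogeneous_of_deg ((if Suc j = 0 then 0 else t + int (Suc j - 1)) -
        (if j = 0 then 0 else t + int (j - 1))) (M j $$ (p, r))"
      using hom[OF pr] by (cases j) simp_all
    show "M j $$ (p, r) \<in> max_ideal"
      by (rule max[OF hom[OF pr]]) (use \<open>t \<ge> 1\<close> in simp)
  next
    show "mat_kernel (M j) = mat_image (M (Suc j))" for j
      using R by (simp add: ideal_resolution_def)
  qed (use q0 c in \<open>simp_all add: homogeneous_1\<close>)
qed

lemma betti_chordal:
  fixes G :: "'v::finite rel"
  assumes G: "simple_graph G" "chordal G" and i: "1 \<le> i" "i < card (UNIV :: 'v set)"
  shows "int (betti (sr_ideal G :: ('v, 'k::field) mpoly set) (card (UNIV :: 'v set) - i)) =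
    (\<Sum>Y | card Y = i - 1. int (num_components_minus G Y) - 1)"
proof -
  let ?I = "sr_ideal G :: ('v, 'k) mpoly set" and ?n = "card (UNIV :: 'v set)"
  have "?I = mon_ideal (\<lambda>m. \<not> clique G (Poly_Mapping.keys m \<inter> UNIV))"
    by (simp add: sr_ideal_eq)
  then obtain q M where M: "linear_resolution ?I 2 q M"
    and q: "\<And>j. int (q (Suc j)) = coeff (component_poly G UNIV) (j + 2)"
    using linear_resolution_chordal[OF G, of UNIV, where 'k = 'k] by auto
  have I: "is_ideal ?I" unfolding sr_ideal_def by (rule is_ideal_span)
  \<comment> \<open>Since i < n, the homological degree n - i is positive, so its rank is the
    coefficient of X^(n - i + 1). The offset by one matches the quadratic generators in homological
    degree 1.\<close>
  have "Suc (?n - i - 1) = ?n - i" using i by linarith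
  then have "betti ?I (?n - i) = q (Suc (?n - i - 1))"
    by (simp only:) (rule betti_eq[OF I linear_resolution_minimal[OF I M]], simp)
  moreover have "?n - i - 1 + 2 = ?n - i + 1" using i by simp
  ultimately show ?thesis
    using sum_separators[of i G] i q[of "?n - i - 1"] by simp
qed

theorem theorem5p13:
  fixes G :: "'v::finite rel" and b :: "nat \<Rightarrow> int" and n \<kappa> d :: nat
    and I :: "('v, 'k::field) mpoly set"
  assumes "simple_graph G" and "\<not> complete_graph G" and "chordal G"
    and "n = card (UNIV :: 'v set)" and "\<kappa> = vertex_connectivity G" and "d = clique_number G"
    and "is_b_vector G b"
    and "I = sr_ideal G"
  shows
    "(\<forall>i \<in> {1..\<kappa> + 1}.
        b i = (\<Sum>Y | card Y = i - 1. int (num_components_minus G Y) - 1) + 1 \<and>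
        (\<Sum>Y | card Y = i - 1. int (num_components_minus G Y) - 1) + 1
          = int (betti I (n - i)) + 1) \<and>
     (\<forall>i \<in> {\<kappa> + 2..d}.
        b i < (\<Sum>Y | card Y = i - 1. int (num_components_minus G Y) - 1) + 1 \<and>
        (\<Sum>Y | card Y = i - 1. int (num_components_minus G Y) - 1) + 1
          = int (betti I (n - i)) + 1)"
proof -
  note bounds = chordal_b_vector_bounds[OF assms(1-3,7)]
  \<comment> \<open>Together with d < n this keeps every index of both ranges strictly below n,
    where the Betti formula applies.\<close>
  have "\<kappa> + 2 \<le> n"
    using vertex_connectivity_separator[OF assms(1,2)] assms(4,5) by metis
  moreover have "d < n" using bounds(3) assms(4,6) by simp
  ultimately have "(\<Sum>Y | card Y = i - 1. int (num_components_minus G Y) - 1) = int (betti I (n - i))"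
    if "i \<in> {1..\<kappa> + 1} \<union> {\<kappa> + 2..d}" for i
    using betti_chordal[OF assms(1,3), of i, where 'k = 'k] that unfolding assms(4,8) by auto
  then show ?thesis
    using bounds(1,2) unfolding assms(5,6) by simp
qed

end
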